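(* Let $(\mathcal M,g)$ be a 4-dimensional oriented and time-oriented Lorentzian spacetime which is not conformally flat and satisfies the Einstein equations $R_{ij}=\lambda g_{ij}$. Let $\tilde{\mathcal P}=\tilde{\mathcal P}_1\cup\tilde{\mathcal P}_2$ (over an open set $\mathcal O\subset\mathcal M$ with a null coframe) be the elliptic fibration over the spacetime defined in the context, and let $\mathcal P$ be the Penrose bundle of null directions over the spacetime. Then $\tilde{\mathcal P}$ constitutes a double branched cover of $\mathcal P$. The covering map is the map $f$ given by $$\tilde{\mathcal P}_1\ni(x;w,z,y)\mapsto(x,z)\in\mathcal O\times\mathbf C,\qquad \tilde{\mathcal P}_2\ni(x;w',z',y')\mapsto(x,z')\in\mathcal O\times\mathbf C,$$ where the two copies of $\mathbf C$, related by $z'=1/z$, are two coordinate charts on a 2-dimensional sphere, which is the sphere of null directions at the given point $x$ of $\mathcal O$ (via the correspondence described in the context). If $z$ (or $z'$) is not a root of $$-\bar\Psi_4+4\bar\Psi_3z-6\bar\Psi_2z^2+4\bar\Psi_1z^3-\bar\Psi_0z^4=0$$ $$\text{(resp. } -\bar\Psi_0+4\bar\Psi_1z'-6\bar\Psi_2z'^2+4\bar\Psi_3z'^3-\bar\Psi_4z'^4=0),$$ then $f^{-1}(z)$ is a two-point set; in the at most four cases when $z$ is a root, $f^{-1}(z)$ is a one-point set. The singular points of the cover are branch points.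
   Context: **Null coframes and Weyl coefficients.** $g$ has signature $(+,+,+,-)$. A null coframe is $\theta^i=(M,\bar M,K,L)$ with $M$ complex and $K,L$ real, such that $g=M\otimes\bar M+\bar M\otimes M-K\otimes L-L\otimes K$; its dual frame is $(m,\bar m,k,l)$. Thus $g_{12}=g_{21}=1$, $g_{34}=g_{43}=-1$, and the other $g_{ij}$ vanish. The connection forms are defined by $d\theta^i=-\Gamma^i{}_j\wedge\theta^j$, $\Gamma_{ij}+\Gamma_{ji}=0$ (indices lowered with $g$), and the curvature by $\mathcal R^k{}_i=\frac12R^k{}_{imj}\theta^m\wedge\theta^j=d\Gamma^k{}_i+\Gamma^k{}_j\wedge\Gamma^j{}_i$, $R_{ij}=R^k{}_{ikj}$, $R=g^{ij}R_{ij}$. For an Einstein metric the complex functions $\Psi_0,\dots,\Psi_4$, the components of the Weyl tensor in the null coframe, are defined by $$\mathcal R_{23}=\bar\Psi_4\bar M\wedge K+\bar\Psi_3(L\wedge K-M\wedge\bar M)+(\bar\Psi_2+\tfrac1{12}R)L\wedge M,$$ $$\mathcal R_{14}=-(\bar\Psi_2+\tfrac1{12}R)\bar M\wedge K-\bar\Psi_1(L\wedge K-M\wedge\bar M)-\bar\Psi_0L\wedge M,$$ $$\tfrac12(\mathcal R_{43}-\mathcal R_{12})=\bar\Psi_3\bar M\wedge K+(\bar\Psi_2-\tfrac1{24}R)(L\wedge K-M\wedge\bar M)+\bar\Psi_1L\wedge M.$$ Put $\Psi=\bar\Psi_4-4\bar\Psi_3z+6\bar\Psi_2z^2-4\bar\Psi_1z^3+\bar\Psi_0z^4$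 and $\Psi'=\bar\Psi_0-4\bar\Psi_1z'+6\bar\Psi_2z'^2-4\bar\Psi_3z'^3+\bar\Psi_4z'^4$. Not conformally flat means $\Psi\not\equiv0$. **The fibration $\tilde{\mathcal P}$.** Over an open set $\mathcal O\subset\mathcal M$ carrying a null coframe, $\tilde{\mathcal P}=\tilde{\mathcal P}_1\cup\tilde{\mathcal P}_2$ with $$\tilde{\mathcal P}_1=\{(x;w,z,y)\in\mathcal O\times\mathbf C^3:\ \Psi y+\tfrac14\Psi_z=0,\ \Psi+w^2=0\},$$ $$\tilde{\mathcal P}_2=\{(x;w',z',y')\in\mathcal O\times\mathbf C^3:\ \Psi'y'+\tfrac14\Psi'_{z'}=0,\ \Psi'+w'^2=0\},$$ and transition functions $w=-w'/z'^2$, $z=1/z'$, $y=-z'(1+y'z')$. Here $y$ is regarded as subordinated to $z$ by the first equation (and $y'$ to $z'$), and the fibre over $x$ is described as the (possibly degenerate) elliptic curve consisting of the pairs $(w,z)$ with $w^2=-\Psi(z)$ and the pairs $(w',z')$ with $w'^2=-\Psi'(z')$, glued by $w=-w'/z'^2$, $z=1/z'$. **Null directions.** $\mathcal P$ is the bundle over $\mathcal M$ whose fibre at $x$ is the 2-sphere of null directions at $x$. The value $z\in\mathbf C$ corresponds to the direction of the 1-form $L(z)=L+z\bar zK+z\bar M+\bar zM$ at $x$, equivalently to the null direction of $k(z)=k+z\bar zl-zm-\bar z\bar m$ via $L(z)=-g(k(z),\cdot)$. The value $z'\in\mathbf C$ corresponds to the null direction associated in the same way with the direction of the 1-form $K(z')=K+z'\bar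 z'L+z'M+\bar z'\bar M$; this family includes the direction of $l$, which is missing from the first one.
   Formalization: The bound of four roots and the branched-cover and branch-point claims are made over the open set of points of O where Ψ is not identically 0 in z (elsewhere every z is a root and they fail); points of the fibration are pairs (w,z), (w',z'), with y fixed by z off the roots. *)

theory Defs
  imports "HOL-Analysis.Analysis"
begin

section \<open>Final topologies\<close>

definition coinduced_topology :: "'a topology \<Rightarrow> ('a \<Rightarrow> 'b) \<Rightarrow> 'b topology" where
  "coinduced_topology X q =
     topology (\<lambda>V. V \<subseteq> q ` topspace X \<and> openin X {x \<in> topspace X. q x \<in> V})"

lemma istopology_coinduced:
  "istopology (\<lambda>V. V \<subseteq> q ` topspace X \<and> openin X {x \<in> topspace X. q x \<in> V})"
proof -
  have 1: "{x \<in> topspace X. q x \<in> S \<inter> T} =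
           {x \<in> topspace X. q x \<in> S} \<inter> {x \<in> topspace X. q x \<in> T}" for S T
    by auto
  have 2: "{x \<in> topspace X. q x \<in> \<Union>\<K>} = (\<Union>K\<in>\<K>. {x \<in> topspace X. q x \<in> K})" for \<K>
    by auto
  show ?thesis
    unfolding istopology_def 1 2 by blast
qed

lemma openin_coinduced_topology:
  "openin (coinduced_topology X q) V \<longleftrightarrow>
     V \<subseteq> q ` topspace X \<and> openin X {x \<in> topspace X. q x \<in> V}"
  by (simp add: coinduced_topology_def istopology_coinduced)


section \<open>Smooth 4-manifolds\<close>

primrec Ck_on :: "nat \<Rightarrow> (real^4) set \<Rightarrow> (real^4 \<Rightarrow> 'b::real_normed_vector) \<Rightarrow> bool" where
  "Ck_on 0 S f \<longleftrightarrow> continuous_on S f"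
| "Ck_on (Suc n) S f \<longleftrightarrow>
     (\<forall>u\<in>S. f differentiable (at u)) \<and> (\<forall>v. Ck_on n S (\<lambda>u. frechet_derivative f (at u) v))"

text \<open>This is only used for open sets.\<close>

definition smooth_on :: "(real^4) set \<Rightarrow> (real^4 \<Rightarrow> 'b::real_normed_vector) \<Rightarrow> bool" where
  "smooth_on S f \<longleftrightarrow> (\<forall>n. Ck_on n S f)"

text \<open>The manifold is the whole type \<open>'m\<close>, which carries its topology; a chart is a pair
  of an open domain and a coordinate map.\<close>

type_synonym 'm chart = "'m set \<times> ('m \<Rightarrow> real^4)"

definition chart_inv :: "'m chart \<Rightarrow> real^4 \<Rightarrow> 'm" where
  "chart_inv c = inv_into (fst c) (snd c)"

definition transition_deriv :: "'m chart \<Rightarrow> 'm chart \<Rightarrow> 'm \<Rightarrow> real^4 \<Rightarrow> real^4" where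
  "transition_deriv c c' x = frechet_derivative (snd c' \<circ> chart_inv c) (at (snd c x))"

definition oriented_smooth_atlas :: "('m::topological_space) chart set \<Rightarrow> bool" where
  "oriented_smooth_atlas A \<longleftrightarrow>
     (\<Union>c\<in>A. fst c) = UNIV \<and>
     (\<forall>c\<in>A. open (fst c) \<and> open (snd c ` fst c) \<and>
        homeomorphism (fst c) (snd c ` fst c) (snd c) (chart_inv c)) \<and>
     (\<forall>c\<in>A. \<forall>c'\<in>A. smooth_on (snd c ` (fst c \<inter> fst c')) (snd c' \<circ> chart_inv c) \<and>
        (\<forall>x \<in> fst c \<inter> fst c'. 0 < det (matrix (transition_deriv c c' x))))"

text \<open>A tangent vector at \<open>x\<close> is represented by its component vector with respect to one fixed
  chart \<open>chart_at A x\<close> around \<open>x\<close>, so every tangent space is \<open>real^4\<close>.  As \<open>chart_at A x\<close> may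
  jump with \<open>x\<close>, continuity and smoothness of fields always refer to components in
  fixed charts: \<open>of_chart A c x\<close> sends the components in \<open>c\<close> of a vector at \<open>x\<close> to the vector.\<close>

definition chart_at :: "'m chart set \<Rightarrow> 'm \<Rightarrow> 'm chart" where
  "chart_at A x = (SOME c. c \<in> A \<and> x \<in> fst c)"

definition of_chart :: "'m chart set \<Rightarrow> 'm chart \<Rightarrow> 'm \<Rightarrow> real^4 \<Rightarrow> real^4" where
  "of_chart A c x = transition_deriv c (chart_at A x) x"

definition tangent_bundle :: "('m::topological_space) chart set \<Rightarrow> ('m \<times> (real^4)) topology" where
  "tangent_bundle A =
     coinduced_topology (sum_topology (\<lambda>c. top_of_set ((snd c ` fst c) \<times> (UNIV :: (real^4) set))) A)
       (\<lambda>(c, u, v). (chart_inv c u, of_chart A c (chart_inv c u) v))"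


section \<open>Differential forms\<close>

text \<open>Complex-valued forms, evaluated on real tangent vectors.\<close>

type_synonym 'm form1 = "'m \<Rightarrow> real^4 \<Rightarrow> complex"
type_synonym 'm form2 = "'m \<Rightarrow> real^4 \<Rightarrow> real^4 \<Rightarrow> complex"

definition form_coeff :: "'m chart set \<Rightarrow> 'm chart \<Rightarrow> 'm form1 \<Rightarrow> real^4 \<Rightarrow> real^4 \<Rightarrow> complex" where
  "form_coeff A c \<omega> v u = \<omega> (chart_inv c u) (of_chart A c (chart_inv c u) v)"

definition smooth_form :: "'m chart set \<Rightarrow> 'm set \<Rightarrow> 'm form1 \<Rightarrow> bool" where
  "smooth_form A S \<omega> \<longleftrightarrow>
     (\<forall>x\<in>S. linear (\<omega> x)) \<and> (\<forall>c\<in>A. \<forall>v. smooth_on (snd c ` (fst c \<inter> S)) (form_coeff A c \<omega> v))"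

definition wedge :: "'m form1 \<Rightarrow> 'm form1 \<Rightarrow> 'm form2" where
  "wedge \<alpha> \<beta> x v w = \<alpha> x v * \<beta> x w - \<alpha> x w * \<beta> x v"

text \<open>\<open>\<Omega> = d\<omega>\<close> on \<open>S\<close>, expressed through the coordinate formula in every chart.\<close>

definition is_ext_deriv :: "'m chart set \<Rightarrow> 'm set \<Rightarrow> 'm form1 \<Rightarrow> 'm form2 \<Rightarrow> bool" where
  "is_ext_deriv A S \<omega> \<Omega> \<longleftrightarrow>
     (\<forall>c\<in>A. \<forall>x \<in> fst c \<inter> S. \<forall>v w.
        \<Omega> x (of_chart A c x v) (of_chart A c x w) =
          frechet_derivative (form_coeff A c \<omega> w) (at (snd c x)) v
        - frechet_derivative (form_coeff A c \<omega> v) (at (snd c x)) w)"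


section \<open>Spacetimes and null coframes\<close>

type_synonym 'm metric = "'m \<Rightarrow> real^4 \<Rightarrow> real^4 \<Rightarrow> real"

definition lorentzian_metric :: "'m chart set \<Rightarrow> 'm metric \<Rightarrow> bool" where
  "lorentzian_metric A g \<longleftrightarrow>
     (\<forall>x. bilinear (g x) \<and> (\<forall>v w. g x v w = g x w v) \<and>
        (\<exists>e :: 4 \<Rightarrow> real^4. \<forall>i j. g x (e i) (e j) = (if i \<noteq> j then 0 else if i = 4 then -1 else 1))) \<and>
     (\<forall>c\<in>A. \<forall>v w. smooth_on (snd c ` fst c)
        (\<lambda>u. g (chart_inv c u) (of_chart A c (chart_inv c u) v) (of_chart A c (chart_inv c u) w)))"

definition time_orientation ::
  "('m::topological_space) chart set \<Rightarrow> 'm metric \<Rightarrow> ('m \<Rightarrow> real^4) \<Rightarrow> bool" where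
  "time_orientation A g T \<longleftrightarrow>
     continuous_map euclidean (tangent_bundle A) (\<lambda>x. (x, T x)) \<and> (\<forall>x. g x (T x) (T x) < 0)"

text \<open>Frame indices are the elements \<open>1, 2, 3, 4\<close> of the type \<open>4\<close>.  The matrix \<open>\<eta>\<close> of the
  \<open>g\<^sub>i\<^sub>j\<close> is its own inverse, so it also raises indices.\<close>

definition \<eta> :: "4 \<Rightarrow> 4 \<Rightarrow> complex" where
  "\<eta> i j = (if {i, j} = {1, 2} then 1 else if {i, j} = {3, 4} then -1 else 0)"

text \<open>\<open>\<theta> 1, \<theta> 2, \<theta> 3, \<theta> 4\<close> are \<open>M\<close>, its conjugate, \<open>K\<close> and \<open>L\<close>.\<close>

definition null_coframe ::
  "'m chart set \<Rightarrow> 'm metric \<Rightarrow> 'm set \<Rightarrow> (4 \<Rightarrow> 'm form1) \<Rightarrow> bool" where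
  "null_coframe A g S \<theta> \<longleftrightarrow>
     (\<forall>i. smooth_form A S (\<theta> i)) \<and>
     (\<forall>x\<in>S. \<forall>v. \<theta> 2 x v = cnj (\<theta> 1 x v) \<and> \<theta> 3 x v \<in> \<real> \<and> \<theta> 4 x v \<in> \<real>) \<and>
     (\<forall>x\<in>S. \<forall>v w. complex_of_real (g x v w) =
        \<theta> 1 x v * \<theta> 2 x w + \<theta> 2 x v * \<theta> 1 x w - \<theta> 3 x v * \<theta> 4 x w - \<theta> 4 x v * \<theta> 3 x w)"

definition connection_forms ::
  "'m chart set \<Rightarrow> 'm set \<Rightarrow> (4 \<Rightarrow> 'm form1) \<Rightarrow> (4 \<Rightarrow> 4 \<Rightarrow> 'm form1) \<Rightarrow> bool" where
  "connection_forms A S \<theta> \<Gamma> \<longleftrightarrow>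
     (\<forall>i j. smooth_form A S (\<Gamma> i j)) \<and>
     (\<forall>i. is_ext_deriv A S (\<theta> i) (\<lambda>x v w. - (\<Sum>j\<in>UNIV. wedge (\<Gamma> i j) (\<theta> j) x v w))) \<and>
     (\<forall>i j. \<forall>x\<in>S. \<forall>v. (\<Sum>k\<in>UNIV. \<eta> i k * \<Gamma> k j x v) + (\<Sum>k\<in>UNIV. \<eta> j k * \<Gamma> k i x v) = 0)"

text \<open>\<open>Riem x k i m j\<close> is the component with upper index \<open>k\<close> and lower indices \<open>i, m, j\<close>.\<close>

type_synonym 'm riemann = "'m \<Rightarrow> 4 \<Rightarrow> 4 \<Rightarrow> 4 \<Rightarrow> 4 \<Rightarrow> complex"

definition curv :: "(4 \<Rightarrow> 'm form1) \<Rightarrow> 'm riemann \<Rightarrow> 4 \<Rightarrow> 4 \<Rightarrow> 'm form2" where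
  "curv \<theta> Riem k i x v w =
     (1/2) * (\<Sum>m\<in>UNIV. \<Sum>j\<in>UNIV. Riem x k i m j * wedge (\<theta> m) (\<theta> j) x v w)"

text \<open>The curvature forms equal \<open>d\<Gamma> + \<Gamma> \<and> \<Gamma>\<close>.\<close>

definition curvature_components ::
  "'m chart set \<Rightarrow> 'm set \<Rightarrow> (4 \<Rightarrow> 'm form1) \<Rightarrow> (4 \<Rightarrow> 4 \<Rightarrow> 'm form1) \<Rightarrow> 'm riemann \<Rightarrow> bool" where
  "curvature_components A S \<theta> \<Gamma> Riem \<longleftrightarrow>
     (\<forall>x\<in>S. \<forall>k i m j. Riem x k i m j = - Riem x k i j m) \<and>
     (\<forall>k i. is_ext_deriv A S (\<Gamma> k i)
        (\<lambda>x v w. curv \<theta> Riem k i x v w - (\<Sum>j\<in>UNIV. wedge (\<Gamma> k j) (\<Gamma> j i) x v w)))"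

definition curv_low :: "(4 \<Rightarrow> 'm form1) \<Rightarrow> 'm riemann \<Rightarrow> 4 \<Rightarrow> 4 \<Rightarrow> 'm form2" where
  "curv_low \<theta> Riem k i x v w = (\<Sum>j\<in>UNIV. \<eta> k j * curv \<theta> Riem j i x v w)"

definition ricci :: "'m riemann \<Rightarrow> 'm \<Rightarrow> 4 \<Rightarrow> 4 \<Rightarrow> complex" where
  "ricci Riem x i j = (\<Sum>k\<in>UNIV. Riem x k i k j)"

definition scalar_curv :: "'m riemann \<Rightarrow> 'm \<Rightarrow> complex" where
  "scalar_curv Riem x = (\<Sum>i\<in>UNIV. \<Sum>j\<in>UNIV. \<eta> i j * ricci Riem x i j)"

text \<open>\<open>psi 0, \<dots>, psi 4\<close> are the five Weyl coefficients.\<close>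

definition weyl_coefficients ::
  "'m set \<Rightarrow> (4 \<Rightarrow> 'm form1) \<Rightarrow> 'm riemann \<Rightarrow> (nat \<Rightarrow> 'm \<Rightarrow> complex) \<Rightarrow> bool" where
  "weyl_coefficients S \<theta> Riem psi \<longleftrightarrow>
     (\<forall>x\<in>S. \<forall>v w.
        let M = \<theta> 1; Mb = \<theta> 2; K = \<theta> 3; L = \<theta> 4; R = scalar_curv Riem x;
            MbK = wedge Mb K x v w;
            LK_MMb = wedge L K x v w - wedge M Mb x v w;
            LM = wedge L M x v w
        in
          curv_low \<theta> Riem 2 3 x v w =
            cnj (psi 4 x) * MbK + cnj (psi 3 x) * LK_MMb + (cnj (psi 2 x) + R/12) * LM \<and>
          curv_low \<theta> Riem 1 4 x v w =
            - (cnj (psi 2 x) + R/12) * MbK - cnj (psi 1 x) * LK_MMb - cnj (psi 0 x) * LM \<and>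
          (1/2) * (curv_low \<theta> Riem 4 3 x v w - curv_low \<theta> Riem 1 2 x v w) =
            cnj (psi 3 x) * MbK + (cnj (psi 2 x) - R/24) * LK_MMb + cnj (psi 1 x) * LM)"


section \<open>The elliptic fibration\<close>

definition \<Psi> :: "(nat \<Rightarrow> 'm \<Rightarrow> complex) \<Rightarrow> 'm \<Rightarrow> complex \<Rightarrow> complex" where
  "\<Psi> psi x z = cnj (psi 4 x) - 4 * cnj (psi 3 x) * z + 6 * cnj (psi 2 x) * z^2
     - 4 * cnj (psi 1 x) * z^3 + cnj (psi 0 x) * z^4"

definition \<Psi>' :: "(nat \<Rightarrow> 'm \<Rightarrow> complex) \<Rightarrow> 'm \<Rightarrow> complex \<Rightarrow> complex" where
  "\<Psi>' psi x z = cnj (psi 0 x) - 4 * cnj (psi 1 x) * z + 6 * cnj (psi 2 x) * z^2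
     - 4 * cnj (psi 3 x) * z^3 + cnj (psi 4 x) * z^4"

text \<open>The defining equations including the variable \<open>y\<close>.\<close>

definition eqs1 :: "(nat \<Rightarrow> 'm \<Rightarrow> complex) \<Rightarrow> 'm set \<Rightarrow> ('m \<times> complex \<times> complex \<times> complex) set" where
  "eqs1 psi S = {(x, w, z, y). x \<in> S \<and> \<Psi> psi x z * y + (1/4) * deriv (\<Psi> psi x) z = 0 \<and>
     \<Psi> psi x z + w^2 = 0}"

definition eqs2 :: "(nat \<Rightarrow> 'm \<Rightarrow> complex) \<Rightarrow> 'm set \<Rightarrow> ('m \<times> complex \<times> complex \<times> complex) set" where
  "eqs2 psi S = {(x, w, z, y). x \<in> S \<and> \<Psi>' psi x z * y + (1/4) * deriv (\<Psi>' psi x) z = 0 \<and>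
     \<Psi>' psi x z + w^2 = 0}"

text \<open>The variable \<open>y\<close> is subordinated to \<open>z\<close>: it is the meromorphic function
  \<open>- \<Psi>\<^sub>z / (4 \<Psi>)\<close> of \<open>z\<close>, with a pole at each root of \<open>\<Psi>\<close>.  A finite \<open>y\<close> solving the first
  equation does not exist at a simple root and is arbitrary at a multiple root, so a point of the
  completed fibre is determined by \<open>(w, z)\<close>, and \<open>y\<close> is not stored in it.\<close>

definition curve1 :: "(nat \<Rightarrow> 'm \<Rightarrow> complex) \<Rightarrow> 'm set \<Rightarrow> ('m \<times> complex \<times> complex) set" where
  "curve1 psi S = {(x, w, z). x \<in> S \<and> \<Psi> psi x z + w^2 = 0}"

definition curve2 :: "(nat \<Rightarrow> 'm \<Rightarrow> complex) \<Rightarrow> 'm set \<Rightarrow> ('m \<times> complex \<times> complex) set" where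
  "curve2 psi S = {(x, w, z). x \<in> S \<and> \<Psi>' psi x z + w^2 = 0}"

text \<open>Gluing of the two pieces, which are tagged \<open>1\<close> and \<open>2\<close>.\<close>

type_synonym 'm tagged = "nat \<times> 'm \<times> complex \<times> complex"

definition glue12 :: "('m tagged \<times> 'm tagged) set" where
  "glue12 = {((1, x, - w' / z'^2, 1 / z'), (2, x, w', z')) | x w' z'. z' \<noteq> 0}"

definition glue :: "('m tagged \<times> 'm tagged) set" where
  "glue = Id \<union> glue12 \<union> glue12\<inverse>"

definition cls :: "'m tagged \<Rightarrow> 'm tagged set" where
  "cls p = glue `` {p}"

definition Ptilde ::
  "(nat \<Rightarrow> ('m::topological_space) \<Rightarrow> complex) \<Rightarrow> 'm set \<Rightarrow> 'm tagged set topology" where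
  "Ptilde psi S = coinduced_topology
     (sum_topology (\<lambda>i. top_of_set (if i = 1 then curve1 psi S else curve2 psi S)) {1, 2}) cls"


section \<open>Null directions\<close>

definition Pnull :: "('m::topological_space) chart set \<Rightarrow> 'm metric \<Rightarrow> 'm set \<Rightarrow>
    ('m \<times> (real^4) set) topology" where
  "Pnull A g S = coinduced_topology
     (subtopology (tangent_bundle A) {(x, v). x \<in> S \<and> v \<noteq> 0 \<and> g x v v = 0})
     (\<lambda>(x, v). (x, span {v}))"

definition Lform :: "(4 \<Rightarrow> 'm form1) \<Rightarrow> complex \<Rightarrow> 'm form1" where
  "Lform \<theta> z x v = \<theta> 4 x v + z * cnj z * \<theta> 3 x v + z * \<theta> 2 x v + cnj z * \<theta> 1 x v"

definition Kform :: "(4 \<Rightarrow> 'm form1) \<Rightarrow> complex \<Rightarrow> 'm form1" where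
  "Kform \<theta> z x v = \<theta> 3 x v + z * cnj z * \<theta> 4 x v + z * \<theta> 1 x v + cnj z * \<theta> 2 x v"

text \<open>The line of tangent vectors \<open>k\<close> for which \<open>g(k, \<cdot>)\<close> is a real multiple of the (real)
  form \<open>\<alpha>\<close>.\<close>

definition dual_line :: "'m metric \<Rightarrow> 'm form1 \<Rightarrow> 'm \<Rightarrow> (real^4) set" where
  "dual_line g \<alpha> x = {k. \<exists>r::real. \<forall>v. complex_of_real (g x k v) = - complex_of_real r * \<alpha> x v}"

definition dir1 :: "'m metric \<Rightarrow> (4 \<Rightarrow> 'm form1) \<Rightarrow> 'm \<Rightarrow> complex \<Rightarrow> (real^4) set" where
  "dir1 g \<theta> x z = dual_line g (Lform \<theta> z) x"

definition dir2 :: "'m metric \<Rightarrow> (4 \<Rightarrow> 'm form1) \<Rightarrow> 'm \<Rightarrow> complex \<Rightarrow> (real^4) set" where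
  "dir2 g \<theta> x z = dual_line g (Kform \<theta> z) x"

text \<open>The value on a class is computed from any representative; the statement asserts that it does
  not depend on the choice.\<close>

definition cover_map ::
  "'m metric \<Rightarrow> (4 \<Rightarrow> 'm form1) \<Rightarrow> 'm tagged set \<Rightarrow> 'm \<times> (real^4) set" where
  "cover_map g \<theta> C =
     the_elem ((\<lambda>(i, x, w, z). (x, if i = 1 then dir1 g \<theta> x z else dir2 g \<theta> x z)) ` C)"

definition root_locus :: "'m metric \<Rightarrow> (4 \<Rightarrow> 'm form1) \<Rightarrow> (nat \<Rightarrow> 'm \<Rightarrow> complex) \<Rightarrow> 'm set \<Rightarrow>
    ('m \<times> (real^4) set) set" where
  "root_locus g \<theta> psi S =
     {(x, dir1 g \<theta> x z) | x z. x \<in> S \<and> \<Psi> psi x z = 0} \<union>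
     {(x, dir2 g \<theta> x z) | x z. x \<in> S \<and> \<Psi>' psi x z = 0}"


definition dir_chart1 :: "'m metric \<Rightarrow> (4 \<Rightarrow> 'm form1) \<Rightarrow> 'm \<times> complex \<Rightarrow> 'm \<times> (real^4) set" where
  "dir_chart1 g \<theta> = (\<lambda>(x, z). (x, dir1 g \<theta> x z))"

definition dir_chart2 :: "'m metric \<Rightarrow> (4 \<Rightarrow> 'm form1) \<Rightarrow> 'm \<times> complex \<Rightarrow> 'm \<times> (real^4) set" where
  "dir_chart2 g \<theta> = (\<lambda>(x, z). (x, dir2 g \<theta> x z))"

text \<open>At a point where all Weyl coefficients vanish every \<open>z\<close> is a root and nothing is a two-sheeted
  cover; the points at which the metric is not conformally flat form the following set.\<close>

definition nonflat_part :: "(nat \<Rightarrow> 'm \<Rightarrow> complex) \<Rightarrow> 'm set \<Rightarrow> 'm set" where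
  "nonflat_part psi S = {x \<in> S. \<exists>z. \<Psi> psi x z \<noteq> 0}"


section \<open>Branched covers\<close>

definition two_sheeted_covering :: "'a topology \<Rightarrow> 'b topology \<Rightarrow> ('a \<Rightarrow> 'b) \<Rightarrow> bool" where
  "two_sheeted_covering X Y f \<longleftrightarrow>
     continuous_map X Y f \<and>
     (\<forall>y \<in> topspace Y. \<exists>V U1 U2. openin Y V \<and> y \<in> V \<and> openin X U1 \<and> openin X U2 \<and>
        U1 \<inter> U2 = {} \<and> {p \<in> topspace X. f p \<in> V} = U1 \<union> U2 \<and>
        homeomorphic_map (subtopology X U1) (subtopology Y V) f \<and>
        homeomorphic_map (subtopology X U2) (subtopology Y V) f)"

text \<open>A double cover branched over the closed nowhere dense set \<open>B\<close>.\<close>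

definition double_branched_cover :: "'a topology \<Rightarrow> 'b topology \<Rightarrow> ('a \<Rightarrow> 'b) \<Rightarrow> 'b set \<Rightarrow> bool" where
  "double_branched_cover X Y f B \<longleftrightarrow>
     continuous_map X Y f \<and> f ` topspace X = topspace Y \<and> open_map X Y f \<and> proper_map X Y f \<and>
     closedin Y B \<and> Y interior_of B = {} \<and>
     two_sheeted_covering (subtopology X {p. f p \<notin> B}) (subtopology Y (- B)) f"

definition singular_point :: "'a topology \<Rightarrow> 'b topology \<Rightarrow> ('a \<Rightarrow> 'b) \<Rightarrow> 'a \<Rightarrow> bool" where
  "singular_point X Y f p \<longleftrightarrow> p \<in> topspace X \<and>
     \<not> (\<exists>U. openin X U \<and> p \<in> U \<and> openin Y (f ` U) \<and>
          homeomorphic_map (subtopology X U) (subtopology Y (f ` U)) f)"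

text \<open>Sheets come together at a branch point.\<close>

definition branch_point :: "'a topology \<Rightarrow> ('a \<Rightarrow> 'b) \<Rightarrow> 'a \<Rightarrow> bool" where
  "branch_point X f p \<longleftrightarrow> p \<in> topspace X \<and>
     {q \<in> topspace X. f q = f p} = {p} \<and>
     (\<forall>U. openin X U \<and> p \<in> U \<longrightarrow> (\<exists>q\<in>U. \<exists>r\<in>U. q \<noteq> r \<and> f q = f r))"

end

theory Submission
  imports Defs
begin

text \<open>A null coframe trivializes the tangent bundle over \<open>D\<close>, continuously in charts by Cramer's rule.  It
  identifies the null directions with the lines of a fixed cone, and there \<open>z\<close>, \<open>z'\<close> and a point of the unit
  sphere are continuous normalizations of a null vector.

  Evaluating the curvature forms on the frame exhibits the Weyl coefficients, hence \<open>\<Psi>\<close>, as continuous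
  functions.  Over a chart the cover is \<open>w\<^sup>2 = - \<Psi>\<close>.  The map \<open>(x, w, z) \<mapsto> (x, z)\<close> is open because every
  square root \<open>w\<^sub>0\<close> of \<open>c\<^sub>0\<close> has near it a square root \<open>w\<close> of \<open>c\<close>, namely with
  \<open>\<bar>w - w\<^sub>0\<bar>\<^sup>2 \<le> \<bar>c - c\<^sub>0\<bar>\<close>; it is closed because its fibres are the orbits of \<open>w \<mapsto> - w\<close>.  Near a point with
  \<open>w\<^sub>0 \<noteq> 0\<close> the sign of \<open>Re (w / w\<^sub>0)\<close> separates two sheets.  At a root, isolated because
  \<open>\<Psi>\<close> is a nonzero polynomial, nearby nonroots have two small square roots, so the sheets meet.\<close>

section \<open>The glued curves\<close>

text \<open>Both spaces carry quotient topologies, and tangent vectors are recorded in charts that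
  may jump from point to point. Openness is therefore always decided upstairs, on the curves in
  \<open>(x, w, z)\<close> or on \<open>S \<times> null_cone\<close>, and then pushed down. The two
  charts are interchangeable because \<Psi> behaves like a section of O(4) over the sphere and
  \<open>w\<close> like a section of O(2). No continuous square root exists near a simple root, and
  \<open>csqrt\<close> jumps along the negative axis, so only estimates that hold for one of the two
  signs are available. Fibre counts, continuity and surjectivity hold over all of \<open>D\<close>,
  but where the Weyl coefficients vanish every direction is a root. The covering statements
  therefore live over \<open>nonflat_part psi D\<close>, whose spaces are built anew as quotients;
  this is why the frame theory is parametrized by the base set and instantiated twice.\<close>

text \<open>Both pieces are treated at once: \<open>i \<in> {1, 2}\<close> is the tag of a piece, and \<open>3 - i\<close> that of the other one.\<close>

definition quartic :: "nat \<Rightarrow> (nat \<Rightarrow> 'm \<Rightarrow> complex) \<Rightarrow> 'm \<Rightarrow> complex \<Rightarrow> complex" where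
  "quartic i psi = (if i = 1 then \<Psi> psi else \<Psi>' psi)"

definition sheet :: "nat \<Rightarrow> (nat \<Rightarrow> 'm \<Rightarrow> complex) \<Rightarrow> 'm set \<Rightarrow> ('m \<times> complex \<times> complex) set" where
  "sheet i psi S = (if i = 1 then curve1 psi S else curve2 psi S)"

lemma mem_sheet: "(x, w, z) \<in> sheet i psi S \<longleftrightarrow> x \<in> S \<and> w^2 = - quartic i psi x z"
  by (auto simp: sheet_def curve1_def curve2_def quartic_def eq_neg_iff_add_eq_0 add.commute)

text \<open>The two quartics list the same coefficients in opposite order, so inversion of
  \<open>z\<close> exchanges them up to the factor \<open>z^4\<close>. Writing the other tag as
  \<open>3 - i\<close> covers both directions at once.\<close>

lemma quartic_inverse:
  assumes "z \<noteq> 0" "i \<in> {1, 2}"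
  shows "quartic (3 - i) psi x (1 / z) = quartic i psi x z / z^4"
  using assms by (auto simp: quartic_def \<Psi>_def \<Psi>'_def field_simps power2_eq_square power3_eq_cube power4_eq_xxxx)

text \<open>The transition has the same shape in both directions, since
  \<open>w = - w' / z'^2\<close> and \<open>z = 1 / z'\<close> give \<open>w' = - w / z^2\<close>.
  Both sides of the curve equation are divided by \<open>z^4\<close>.\<close>

lemma sheet_flip:
  assumes "z \<noteq> 0" "i \<in> {1, 2}"
  shows "(x, - w / z^2, 1 / z) \<in> sheet (3 - i) psi S \<longleftrightarrow> (x, w, z) \<in> sheet i psi S"
proof -
  have "(- w / z^2)^2 = w^2 / z^4" by (simp add: power_divide flip: power_mult)
  then show ?thesis using assms unfolding mem_sheet quartic_inverse[OF assms]
    by (auto simp: divide_simps)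
qed

text \<open>\<open>glue\<close> involves no transitive closure: a point has at most one partner in
  the other piece, and the partner of the partner is the point itself.\<close>

lemma cls_eq_insert:
  assumes "i \<in> {1, 2}"
  shows "cls (i, x, w, z) = insert (i, x, w, z) (if z = 0 then {} else {(3 - i, x, - w / z^2, 1 / z)})"
proof (cases "i = 1")
  case True
  have "((1, x, w, z), q) \<in> glue12 \<longleftrightarrow> z \<noteq> 0 \<and> q = (2, x, - w / z^2, 1 / z)" for q
  proof
    assume "z \<noteq> 0 \<and> q = (2, x, - w / z^2, 1 / z)"
    moreover from this have "w = - (- w / z^2) / (1 / z)^2" "z = 1 / (1 / z)" "1 / z \<noteq> 0"
      by (simp_all add: power_divide)
    ultimately show "((1, x, w, z), q) \<in> glue12" unfolding glue12_def by blast
  qed (auto simp: glue12_def power_divide)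
  moreover have "(q, (1, x, w, z)) \<notin> glue12" for q by (auto simp: glue12_def)
  ultimately show ?thesis using True by (auto simp: cls_def glue_def)
next
  case False
  with assms have "i = 2" by auto
  then show ?thesis by (auto simp: cls_def glue_def glue12_def)
qed

lemma cls_eq_iff:
  assumes "i \<in> {1, 2}" "j \<in> {1, 2}"
  shows "cls (i, x, w, z) = cls (j, x', w', z') \<longleftrightarrow>
    (i, x, w, z) = (j, x', w', z') \<or> (j = 3 - i \<and> z \<noteq> 0 \<and> x' = x \<and> w' = - w / z^2 \<and> z' = 1 / z)"
  (is "?L \<longleftrightarrow> ?R")
proof
  assume ?L
  moreover have "(j, x', w', z') \<in> cls (j, x', w', z')" using assms by (simp add: cls_eq_insert)
  ultimately have "(j, x', w', z') \<in> cls (i, x, w, z)" by simp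
  then show ?R using assms by (auto simp: cls_eq_insert split: if_splits)
next
  assume R: ?R
  show ?L
  proof (cases "(i, x, w, z) = (j, x', w', z')")
    case False
    with R have z: "j = 3 - i" "i = 3 - j" "z \<noteq> 0" "x' = x" "w' = - w / z^2" "z' = 1 / z" "z' \<noteq> 0"
      using assms by auto
    then have "- w' / z'^2 = w" "1 / z' = z" by (simp_all add: power_divide)
    then show ?thesis using z assms by (simp add: cls_eq_insert insert_commute)
  qed simp
qed

lemma Ptilde_eq:
  "Ptilde psi S = coinduced_topology (sum_topology (\<lambda>i. top_of_set (sheet i psi S)) {1, 2}) cls"
  by (simp add: Ptilde_def sheet_def)

lemma cls_flip:
  assumes "z \<noteq> 0" "i \<in> {1, 2}"
  shows "cls (3 - i, x, - w / z^2, 1 / z) = cls (i, x, w, z)"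
  using assms cls_eq_iff[of i "3 - i" x w z x "- w / z^2" "1 / z"] by auto

definition glued_points :: "(nat \<Rightarrow> 'm \<Rightarrow> complex) \<Rightarrow> 'm set \<Rightarrow> 'm tagged set set" where
  "glued_points psi S = cls ` (SIGMA i:{1, 2}. sheet i psi S)"

lemma glued_points_iff: "p \<in> glued_points psi S \<longleftrightarrow> (\<exists>i\<in>{1, 2}. \<exists>x w z. (x, w, z) \<in> sheet i psi S \<and> p = cls (i, x, w, z))"
  unfolding glued_points_def by force

text \<open>The transition preserves the curve equation, so it does not matter which representative
  is tested. Preimages of sets of glued points thus fall inside the curves by themselves.\<close>

lemma cls_mem_glued_points:
  assumes "i \<in> {1, 2}"
  shows "cls (i, x, w, z) \<in> glued_points psi S \<longleftrightarrow> (x, w, z) \<in> sheet i psi S"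
proof
  assume "cls (i, x, w, z) \<in> glued_points psi S"
  then obtain j x' w' z' where j: "j \<in> {1, 2}" "(x', w', z') \<in> sheet j psi S"
    "cls (j, x', w', z') = cls (i, x, w, z)"
    unfolding glued_points_iff by metis
  then show "(x, w, z) \<in> sheet i psi S"
    using cls_eq_iff[OF j(1) assms, of x' w' z' x w z] sheet_flip[of z' j x' w' psi S] by auto
next
  assume "(x, w, z) \<in> sheet i psi S"
  then show "cls (i, x, w, z) \<in> glued_points psi S" using assms unfolding glued_points_iff by blast
qed

lemma openin_Ptilde:
  "openin (Ptilde psi S) V \<longleftrightarrow> V \<subseteq> glued_points psi S \<and>
     (\<forall>i\<in>{1, 2}. openin (top_of_set (sheet i psi S)) {(x, w, z). cls (i, x, w, z) \<in> V})"
proof -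
  have top: "topspace (sum_topology (\<lambda>i. top_of_set (sheet i psi S)) {1, 2}) = (SIGMA i:{1, 2}. sheet i psi S)"
    by (auto simp: topspace_sum_topology)
  have "{q. (i, q) \<in> {x \<in> (SIGMA i:{1, 2}. sheet i psi S). cls x \<in> V}} = {(x, w, z). cls (i, x, w, z) \<in> V}"
    if "V \<subseteq> glued_points psi S" "i \<in> {1, 2}" for i
    using that cls_mem_glued_points[OF that(2), of _ _ _ psi S] by auto
  then show ?thesis
    unfolding Ptilde_eq openin_coinduced_topology openin_sum_topology top glued_points_def
    by (auto simp: comp_def)
qed

lemma topspace_Ptilde: "topspace (Ptilde psi S) = glued_points psi S"
proof
  show "topspace (Ptilde psi S) \<subseteq> glued_points psi S"
    using openin_Ptilde[of psi S] openin_topspace by blast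
  have "{(x, w, z). cls (i, x, w, z) \<in> glued_points psi S} = sheet i psi S" if "i \<in> {1, 2}" for i
    using cls_mem_glued_points[OF that, of _ _ _ psi S] by auto
  then have "openin (Ptilde psi S) (glued_points psi S)"
    by (simp add: openin_Ptilde)
  then show "glued_points psi S \<subseteq> topspace (Ptilde psi S)" by (rule openin_subset)
qed

text \<open>In the other piece \<open>U\<close> appears as its preimage under the transition map, which is continuous.\<close>

lemma open_piece_Ptilde:
  assumes i: "i \<in> {1, 2}" and U: "openin (top_of_set (sheet i psi S)) U"
  shows "openin (Ptilde psi S) ((\<lambda>q. cls (i, q)) ` U)"
  unfolding openin_Ptilde
proof (intro conjI ballI)
  have sub: "U \<subseteq> sheet i psi S" using U openin_imp_subset by blast
  then show "(\<lambda>q. cls (i, q)) ` U \<subseteq> glued_points psi S"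
    using i by (auto simp: cls_mem_glued_points)
  fix j :: nat assume j: "j \<in> {1, 2}"
  show "openin (top_of_set (sheet j psi S)) {(x, w, z). cls (j, x, w, z) \<in> (\<lambda>q. cls (i, q)) ` U}"
  proof (cases "j = i")
    case True
    have "cls (i, x, w, z) \<in> (\<lambda>q. cls (i, q)) ` U \<longleftrightarrow> (x, w, z) \<in> U" for x w z
    proof
      assume "cls (i, x, w, z) \<in> (\<lambda>q. cls (i, q)) ` U"
      then obtain x' w' z' where "(x', w', z') \<in> U" "cls (i, x, w, z) = cls (i, x', w', z')" by auto
      then show "(x, w, z) \<in> U" using cls_eq_iff[OF i i, of x w z x' w' z'] i by auto
    qed blast
    then show ?thesis using U True by simp
  next
    case False
    with i j have j3: "j = 3 - i" "i = 3 - j" by auto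
    let ?E = "sheet j psi S \<inter> {(x, w, z). z \<noteq> 0}"
    let ?h = "\<lambda>(x::'a, w::complex, z::complex). (x, - w / z^2, 1 / z)"
    have flip: "(x, - w / z^2, 1 / z) \<in> sheet i psi S \<longleftrightarrow> (x, w, z) \<in> sheet j psi S" if "z \<noteq> 0" for x w z
      using sheet_flip[OF that j, of x w psi S] j3(2) by simp
    have iff: "cls (j, x, w, z) \<in> (\<lambda>q. cls (i, q)) ` U \<longleftrightarrow> z \<noteq> 0 \<and> (x, - w / z^2, 1 / z) \<in> U" for x w z
    proof
      assume "cls (j, x, w, z) \<in> (\<lambda>q. cls (i, q)) ` U"
      then obtain x' w' z' where q: "(x', w', z') \<in> U" "cls (j, x, w, z) = cls (i, x', w', z')" by auto
      with cls_eq_iff[OF j i, of x w z x' w' z'] False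
      show "z \<noteq> 0 \<and> (x, - w / z^2, 1 / z) \<in> U" by auto
    next
      assume a: "z \<noteq> 0 \<and> (x, - w / z^2, 1 / z) \<in> U"
      then have "cls (j, x, w, z) = (\<lambda>q. cls (i, q)) (x, - w / z^2, 1 / z)"
        using cls_flip[OF conjunct1[OF a] j, of x w, folded j3(2)] by simp
      then show "cls (j, x, w, z) \<in> (\<lambda>q. cls (i, q)) ` U"
        by (rule image_eqI) (use a in blast)
    qed
    have "openin (top_of_set ?E) (?E \<inter> ?h -` U)"
    proof (rule continuous_openin_preimage[OF _ _ U])
      show "continuous_on ?E ?h"
        by (auto simp: case_prod_unfold intro!: continuous_intros)
      show "?h \<in> ?E \<rightarrow> sheet i psi S"
        using flip by auto
    qed
    moreover have "openin (top_of_set (sheet j psi S)) ?E"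
    proof -
      have "open {q :: 'a \<times> complex \<times> complex. snd (snd q) \<noteq> 0}"
        by (intro open_Collect_neq continuous_intros)
      moreover have "?E = sheet j psi S \<inter> {q. snd (snd q) \<noteq> 0}" by auto
      ultimately show ?thesis by (simp only: openin_open_Int)
    qed
    ultimately have "openin (top_of_set (sheet j psi S)) (?E \<inter> ?h -` U)"
      using openin_trans by blast
    moreover have "{(x, w, z). cls (j, x, w, z) \<in> (\<lambda>q. cls (i, q)) ` U} = ?E \<inter> ?h -` U"
      using sub flip unfolding iff by auto
    ultimately show ?thesis by simp
  qed
qed

section \<open>Square roots and roots of the quartics\<close>

text \<open>Once a map is known to be open and continuous, only injectivity on an open set remains
  to be checked; this serves the local sheets and the direction charts alike.\<close>

lemma homeomorphic_map_open_restriction: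
  assumes "continuous_map X Y f" "open_map X Y f" "openin X U" "inj_on f U"
  shows "homeomorphic_map (subtopology X U) (subtopology Y (f ` U)) f"
proof (rule bijective_open_imp_homeomorphic_map)
  have top: "topspace (subtopology X U) = U"
    using openin_subset[OF assms(3)] by (auto simp: topspace_subtopology)
  have fU: "openin Y (f ` U)" using assms(2,3) by (auto simp: open_map_def)
  show "continuous_map (subtopology X U) (subtopology Y (f ` U)) f"
    using continuous_map_from_subtopology[OF assms(1), of U]
    by (rule continuous_map_into_subtopology) (auto simp: top)
  show "open_map (subtopology X U) (subtopology Y (f ` U)) f"
    unfolding open_map_def openin_open_subtopology[OF assms(3)] openin_open_subtopology[OF fU]
    using assms(2) by (auto simp: open_map_def)
  show "f ` topspace (subtopology X U) = topspace (subtopology Y (f ` U))"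
    unfolding top using openin_subset[OF fU] by (auto simp: topspace_subtopology)
  show "inj_on f (topspace (subtopology X U))" using assms(4) top by simp
qed

text \<open>With \<open>s = csqrt c\<close>, the product of \<open>s - w0\<close> and
  \<open>s + w0\<close> is \<open>c - w0^2\<close>, and the smaller factor has squared modulus at
  most that of the product. Choosing the sign separately for each \<open>c\<close> avoids the jump
  of \<open>csqrt\<close>, and the bound stays valid at \<open>w0 = 0\<close>.\<close>

lemma nearby_square_root:
  fixes c w0 :: complex
  obtains w where "w^2 = c" "cmod (w - w0)^2 \<le> cmod (c - w0^2)"
proof -
  have prod: "cmod (csqrt c - w0) * cmod (csqrt c + w0) = cmod (c - w0^2)"
  proof -
    have "(csqrt c - w0) * (csqrt c + w0) = csqrt c ^ 2 - w0^2"
      by (simp add: power2_eq_square algebra_simps)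
    then show ?thesis by (simp flip: norm_mult)
  qed
  show ?thesis
  proof (cases "cmod (csqrt c - w0) \<le> cmod (csqrt c + w0)")
    case True
    then have "cmod (csqrt c - w0)^2 \<le> cmod (c - w0^2)"
      unfolding prod[symmetric] unfolding power2_eq_square by (intro mult_left_mono) auto
    then show ?thesis using that[of "csqrt c"] by simp
  next
    case False
    have eq: "cmod (- csqrt c - w0) = cmod (csqrt c + w0)"
      using norm_minus_cancel[of "csqrt c + w0"] by simp
    have "cmod (- csqrt c - w0)^2 \<le> cmod (c - w0^2)"
      unfolding eq prod[symmetric] unfolding power2_eq_square using False by (intro mult_right_mono) auto
    then show ?thesis using that[of "- csqrt c"] by simp
  qed
qed

lemma complex_square_roots: "{w. w^2 = (c::complex)} = {csqrt c, - csqrt c}"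
  using power2_eq_iff[of _ "csqrt c"] by auto

lemma card_complex_square_roots: "card {w. w^2 = (c::complex)} = (if c = 0 then 1 else 2)"
  unfolding complex_square_roots by auto

text \<open>The bound 3 for \<open>psi 0 x = 0\<close> leaves room for the root at infinity, that is
  at \<open>z' = 0\<close>, which occurs in exactly this case.\<close>

lemma finite_roots_\<Psi>:
  assumes "\<Psi> psi x z0 \<noteq> 0"
  shows "finite {z. \<Psi> psi x z = 0}"
    and "card {z. \<Psi> psi x z = 0} \<le> (if psi 0 x = 0 then 3 else 4)"
proof -
  define c where "c = (\<lambda>i::nat. if i = 0 then cnj (psi 4 x) else if i = 1 then - 4 * cnj (psi 3 x)
     else if i = 2 then 6 * cnj (psi 2 x) else if i = 3 then - 4 * cnj (psi 1 x) else cnj (psi 0 x))"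
  define n :: nat where "n = (if psi 0 x = 0 then 3 else 4)"
  have eq: "\<Psi> psi x z = (\<Sum>i\<le>n. c i * z^i)" for z
    by (simp add: \<Psi>_def c_def n_def eval_nat_numeral)
  have "\<exists>k\<le>n. c k \<noteq> 0"
  proof (rule ccontr)
    assume "\<not> ?thesis"
    then have "\<Psi> psi x z0 = 0" unfolding eq by (intro sum.neutral) auto
    with assms show False by simp
  qed
  from polyfun_rootbound[where c = c, OF this]
  show "finite {z. \<Psi> psi x z = 0}" "card {z. \<Psi> psi x z = 0} \<le> (if psi 0 x = 0 then 3 else 4)"
    unfolding eq n_def by auto
qed

text \<open>Only indices up to 4 enter \<Psi>, so truncated subtraction does no harm, and results on
  \<Psi> carry over by reversing the coefficients.\<close>

lemma \<Psi>'_eq_\<Psi>_reversed: "\<Psi>' psi = \<Psi> (\<lambda>k. psi (4 - k))"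
  by (auto simp: fun_eq_iff \<Psi>_def \<Psi>'_def)

lemma quartic_nonzero_transfer:
  assumes "\<Psi> psi x z0 \<noteq> 0"
  shows "\<exists>z. \<Psi>' psi x z \<noteq> 0"
proof -
  have "infinite (UNIV - {z. \<Psi> psi x z = 0})"
    using finite_roots_\<Psi>(1)[OF assms] infinite_UNIV_char_0[where 'a=complex]
    by (metis finite_Diff2)
  then have "\<not> (UNIV - {z. \<Psi> psi x z = 0} \<subseteq> {0})"
    using finite_subset by blast
  then obtain z where "\<Psi> psi x z \<noteq> 0" "z \<noteq> 0" by auto
  then show ?thesis
    using quartic_inverse[of z 1 psi x] by (intro exI[of _ "1 / z"]) (simp add: quartic_def)
qed

lemma finite_roots_quartic:
  assumes "\<exists>z. \<Psi> psi x z \<noteq> 0"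
  shows "finite {z. quartic i psi x z = 0}"
proof (cases "i = 1")
  case True
  from assms obtain z where "\<Psi> psi x z \<noteq> 0" by blast
  then have "finite {z. \<Psi> psi x z = 0}" by (rule finite_roots_\<Psi>(1))
  then show ?thesis using True by (simp add: quartic_def)
next
  case False
  from assms obtain z0 where "\<Psi> psi x z0 \<noteq> 0" by blast
  from quartic_nonzero_transfer[OF this] obtain z where "\<Psi>' psi x z \<noteq> 0" by blast
  then have "finite {z. \<Psi>' psi x z = 0}"
    unfolding \<Psi>'_eq_\<Psi>_reversed by (rule finite_roots_\<Psi>(1))
  then show ?thesis using False by (simp add: quartic_def)
qed

section \<open>Double covers of a space with two inverse charts\<close>

lemma continuous_on_quartic:
  assumes "\<And>k. k \<le> 4 \<Longrightarrow> continuous_on S (psi k)"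
  shows "continuous_on (S \<times> UNIV) (\<lambda>q. quartic i psi (fst q) (snd q))"
proof -
  have "continuous_on (S \<times> (UNIV :: complex set)) (\<lambda>q. psi k (fst q))" if "k \<le> 4" for k
    by (rule continuous_on_compose2[OF assms[OF that]]) (auto intro: continuous_intros)
  then show ?thesis
    by (cases "i = 1") (auto simp: quartic_def \<Psi>_def \<Psi>'_def intro!: continuous_intros)
qed

text \<open>Stands for the bundle of null directions, reduced to two open charts glued by inversion.
  Nothing is said about the vanishing of \<Psi>, so fibre counts and continuity apply over
  conformally flat points as well.\<close>

locale direction_cover =
  fixes psi :: "nat \<Rightarrow> 'm::topological_space \<Rightarrow> complex" and S :: "'m set"
    and Y :: "'b topology" and \<phi> :: "nat \<Rightarrow> 'm \<times> complex \<Rightarrow> 'b" and f :: "'m tagged set \<Rightarrow> 'b"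
  assumes cont_chart: "i \<in> {1, 2} \<Longrightarrow> continuous_map (top_of_set (S \<times> UNIV)) Y (\<phi> i)"
    and open_chart: "i \<in> {1, 2} \<Longrightarrow> open_map (top_of_set (S \<times> UNIV)) Y (\<phi> i)"
    and inj_chart: "i \<in> {1, 2} \<Longrightarrow> inj_on (\<phi> i) (S \<times> UNIV)"
    and charts_cover: "topspace Y = \<phi> 1 ` (S \<times> UNIV) \<union> \<phi> 2 ` (S \<times> UNIV)"
    and charts_overlap: "x \<in> S \<Longrightarrow> y \<in> S \<Longrightarrow>
      \<phi> 1 (x, z) = \<phi> 2 (y, z') \<longleftrightarrow> x = y \<and> z \<noteq> 0 \<and> z' = 1 / z"
    and f_cls: "i \<in> {1, 2} \<Longrightarrow> (x, w, z) \<in> sheet i psi S \<Longrightarrow> f (cls (i, x, w, z)) = \<phi> i (x, z)"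
begin

abbreviation X where "X \<equiv> Ptilde psi S"

lemma chart_eq_iff:
  assumes "i \<in> {1, 2}" "j \<in> {1, 2}" "x \<in> S" "y \<in> S"
  shows "\<phi> i (x, z) = \<phi> j (y, z') \<longleftrightarrow> x = y \<and> (if i = j then z = z' else z \<noteq> 0 \<and> z' = 1 / z)"
proof (cases "i = j")
  case True
  then show ?thesis using inj_chart[OF assms(1)] assms(3,4) by (auto dest: inj_onD)
next
  case False
  then consider "i = 1" "j = 2" | "i = 2" "j = 1" using assms by auto
  then show ?thesis
  proof cases
    case 1
    then show ?thesis using charts_overlap[OF assms(3,4), of z z'] by simp
  next
    case 2
    have "\<phi> i (x, z) = \<phi> j (y, z') \<longleftrightarrow> \<phi> 1 (y, z') = \<phi> 2 (x, z)" using 2 by auto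
    then show ?thesis using 2 charts_overlap[OF assms(4,3), of z' z] by auto
  qed
qed

lemma mem_topspace_Y: "y \<in> topspace Y \<longleftrightarrow> (\<exists>i\<in>{1, 2}. \<exists>x\<in>S. \<exists>z. y = \<phi> i (x, z))"
  unfolding charts_cover by auto

text \<open>A point given in the other piece can be moved into piece \<open>i\<close>: having a
  direction that chart \<open>i\<close> contains forces its coordinate to be nonzero.\<close>

lemma mem_fibreE:
  assumes "p \<in> glued_points psi S" "f p = \<phi> i (x, z)" "i \<in> {1, 2}" "x \<in> S"
  obtains w where "(x, w, z) \<in> sheet i psi S" "p = cls (i, x, w, z)"
proof -
  from assms(1) obtain j x' w' z' where j: "j \<in> {1, 2}" "(x', w', z') \<in> sheet j psi S"
    and p: "p = cls (j, x', w', z')"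
    unfolding glued_points_iff by blast
  have "x' \<in> S" using j(2) by (simp add: mem_sheet)
  have eq: "\<phi> j (x', z') = \<phi> i (x, z)" using f_cls[OF j] assms(2) p by simp
  show thesis
  proof (cases "j = i")
    case True
    then have "x' = x" "z' = z"
      using eq chart_eq_iff[OF j(1) assms(3) \<open>x' \<in> S\<close> assms(4)] by auto
    then show thesis using that j(2) p True by blast
  next
    case False
    then have *: "x' = x" "z' \<noteq> 0" "z = 1 / z'"
      using eq chart_eq_iff[OF j(1) assms(3) \<open>x' \<in> S\<close> assms(4)] by auto
    have "i = 3 - j" using False assms(3) j(1) by auto
    then show thesis
      using that[of "- w' / z'^2"] sheet_flip[OF *(2) j(1)] cls_flip[OF *(2) j(1)] j(2) p *
      by metis
  qed
qed

lemma fibre_eq: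
  assumes "i \<in> {1, 2}" "x \<in> S"
  shows "{p \<in> topspace X. f p = \<phi> i (x, z)} = (\<lambda>w. cls (i, x, w, z)) ` {w. w^2 = - quartic i psi x z}"
proof
  show "{p \<in> topspace X. f p = \<phi> i (x, z)} \<subseteq> (\<lambda>w. cls (i, x, w, z)) ` {w. w^2 = - quartic i psi x z}"
    unfolding topspace_Ptilde
  proof (clarify, goal_cases)
    case (1 p)
    then show ?case using mem_fibreE[OF _ _ assms] by (metis (mono_tags, lifting) image_eqI mem_Collect_eq mem_sheet)
  qed
  show "(\<lambda>w. cls (i, x, w, z)) ` {w. w^2 = - quartic i psi x z} \<subseteq> {p \<in> topspace X. f p = \<phi> i (x, z)}"
    using assms by (auto simp: topspace_Ptilde cls_mem_glued_points mem_sheet f_cls)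
qed

text \<open>Within one piece the gluing identifies nothing, so a fibre has as many points as
  \<open>- quartic i psi x z\<close> has square roots.\<close>

lemma card_fibre:
  assumes "i \<in> {1, 2}" "x \<in> S"
  shows "card {p \<in> topspace X. f p = \<phi> i (x, z)} = (if quartic i psi x z = 0 then 1 else 2)"
proof -
  have "inj_on (\<lambda>w. cls (i, x, w, z)) {w. w^2 = - quartic i psi x z}"
    using assms(1) by (auto simp: inj_on_def cls_eq_iff[OF assms(1) assms(1)])
  then show ?thesis
    unfolding fibre_eq[OF assms] by (simp add: card_image card_complex_square_roots)
qed

lemma finite_fibre:
  assumes "y \<in> topspace Y"
  shows "finite {p \<in> topspace X. f p = y}"
proof -
  obtain i x z where "i \<in> {1, 2}" "x \<in> S" "y = \<phi> i (x, z)" using assms mem_topspace_Y by blast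
  then show ?thesis using fibre_eq[of i x z] by (simp add: complex_square_roots)
qed

lemma continuous_map_f: "continuous_map X Y f"
  unfolding continuous_map_def topspace_Ptilde
proof (intro conjI allI impI)
  show "f \<in> glued_points psi S \<rightarrow> topspace Y"
  proof
    fix p assume "p \<in> glued_points psi S"
    then obtain i x w z where i: "i \<in> {1, 2}" "(x, w, z) \<in> sheet i psi S" "p = cls (i, x, w, z)"
      unfolding glued_points_iff by blast
    then have "f p = \<phi> i (x, z)" "x \<in> S" using f_cls by (auto simp: mem_sheet)
    then show "f p \<in> topspace Y" using i(1) mem_topspace_Y by blast
  qed
  fix U assume U: "openin Y U"
  show "openin X {p \<in> glued_points psi S. f p \<in> U}"
    unfolding openin_Ptilde
  proof (intro conjI ballI)
    fix i :: nat assume i: "i \<in> {1, 2}"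
    have "continuous_map (top_of_set (sheet i psi S)) (top_of_set (S \<times> UNIV)) (\<lambda>q. (fst q, snd (snd q)))"
      by (auto simp: mem_sheet intro!: continuous_intros)
    from continuous_map_compose[OF this cont_chart[OF i]] U
    have "openin (top_of_set (sheet i psi S)) {q \<in> sheet i psi S. \<phi> i (fst q, snd (snd q)) \<in> U}"
      by (simp add: continuous_map_def comp_def)
    moreover have "{(x, w, z). cls (i, x, w, z) \<in> {p \<in> glued_points psi S. f p \<in> U}} =
      {q \<in> sheet i psi S. \<phi> i (fst q, snd (snd q)) \<in> U}"
      using i by (auto simp: cls_mem_glued_points f_cls)
    ultimately show "openin (top_of_set (sheet i psi S))
      {(x, w, z). cls (i, x, w, z) \<in> {p \<in> glued_points psi S. f p \<in> U}}" by simp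
  qed auto
qed

lemma surj_f: "f ` topspace X = topspace Y"
proof
  show "f ` topspace X \<subseteq> topspace Y"
    using continuous_map_image_subset_topspace[OF continuous_map_f] .
  show "topspace Y \<subseteq> f ` topspace X"
  proof
    fix y assume "y \<in> topspace Y"
    then obtain i x z where i: "i \<in> {1, 2}" "x \<in> S" "y = \<phi> i (x, z)" using mem_topspace_Y by blast
    have "(x, csqrt (- quartic i psi x z), z) \<in> sheet i psi S" using i by (simp add: mem_sheet)
    then show "y \<in> f ` topspace X"
      using i f_cls cls_mem_glued_points topspace_Ptilde by (metis image_eqI)
  qed
qed

definition branch_locus :: "'b set" where
  "branch_locus = {\<phi> i (x, z) | i x z. i \<in> {1, 2} \<and> x \<in> S \<and> quartic i psi x z = 0}"

text \<open>Inversion takes roots to roots, so being a root is a property of the direction and can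
  be tested in any chart that contains it.\<close>

lemma chart_mem_branch_locus:
  assumes i: "i \<in> {1, 2}" and x: "x \<in> S"
  shows "\<phi> i (x, z) \<in> branch_locus \<longleftrightarrow> quartic i psi x z = 0"
proof
  assume "\<phi> i (x, z) \<in> branch_locus"
  then obtain j x' z' where j: "j \<in> {1, 2}" "x' \<in> S" "quartic j psi x' z' = 0"
    and "\<phi> j (x', z') = \<phi> i (x, z)"
    unfolding branch_locus_def by force
  with chart_eq_iff[OF j(1) i j(2) x]
  have *: "x' = x" "if j = i then z' = z else z' \<noteq> 0 \<and> z = 1 / z'" by auto
  show "quartic i psi x z = 0"
  proof (cases "j = i")
    case False
    then have "i = 3 - j" using i j by auto
    then show ?thesis using quartic_inverse[of z' j psi x] j * False by auto
  qed (use * j in auto)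
qed (use assms in \<open>auto simp: branch_locus_def\<close>)

end

text \<open>A quartic that is not identically zero over a base point has finitely many roots there;
  the density of nonroots and the meeting of sheets at roots rest on this.\<close>

locale nonflat_direction_cover = direction_cover +
  assumes open_S: "open S"
    and cont_psi: "\<And>k. k \<le> 4 \<Longrightarrow> continuous_on S (psi k)"
    and nonflat: "\<And>x. x \<in> S \<Longrightarrow> \<exists>z. \<Psi> psi x z \<noteq> 0"
begin

section \<open>Openness, closedness and properness of the cover\<close>

lemma open_projection:
  assumes "openin (top_of_set (sheet i psi S)) W"
  shows "openin (top_of_set (S \<times> UNIV)) ((\<lambda>q. (fst q, snd (snd q))) ` W)"
  unfolding openin_subopen[of _ "(\<lambda>q. (fst q, snd (snd q))) ` W"]
proof
  fix r assume "r \<in> (\<lambda>q. (fst q, snd (snd q))) ` W"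
  then obtain x0 w0 z0 where r: "r = (x0, z0)" and W0: "(x0, w0, z0) \<in> W" by force
  from assms obtain O' where O': "open O'" "W = sheet i psi S \<inter> O'" by (auto simp: openin_open)
  with W0 have "(x0, w0, z0) \<in> O'" "x0 \<in> S" and w0: "w0^2 = - quartic i psi x0 z0" by (auto simp: mem_sheet)
  then obtain A B where AB: "open A" "open B" "(x0, w0, z0) \<in> A \<times> B" "A \<times> B \<subseteq> O'"
    using open_prod_elim[OF O'(1)] by metis
  then obtain C E where CE: "open C" "open E" "(w0, z0) \<in> C \<times> E" "C \<times> E \<subseteq> B"
    using open_prod_elim[OF AB(2), of "(w0, z0)"] by auto
  then obtain e where e: "e > 0" "ball w0 e \<subseteq> C" by (auto elim: openE)
  let ?d = "\<lambda>q. cmod (quartic i psi (fst q) (snd q) - quartic i psi x0 z0)"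
  \<comment> \<open>A tolerance of \<open>e^2\<close> on the quartic becomes, by
    \<open>nearby_square_root\<close>, a distance below \<open>e\<close> between square roots, so
    that \<open>w\<close> stays in \<open>C\<close>.\<close>
  let ?N = "(S \<times> UNIV) \<inter> ?d -` {..<e^2} \<inter> (A \<times> E)"
  have "openin (top_of_set (S \<times> UNIV)) ((S \<times> UNIV) \<inter> ?d -` {..<e^2})"
    by (rule continuous_openin_preimage_gen) (auto intro!: continuous_intros continuous_on_quartic cont_psi)
  then have "openin (top_of_set (S \<times> UNIV)) ?N"
    by (rule openin_Int_open[OF _ open_Times[OF AB(1) CE(2)]])
  moreover have "r \<in> ?N" using r AB CE e \<open>x0 \<in> S\<close> by auto
  moreover have "?N \<subseteq> (\<lambda>q. (fst q, snd (snd q))) ` W"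
  proof
    fix q assume "q \<in> ?N"
    then obtain x z where q: "q = (x, z)"
      and xz: "x \<in> S" "?d (x, z) < e^2" "x \<in> A" "z \<in> E" by (cases q) auto
    obtain w where w: "w^2 = - quartic i psi x z" "cmod (w - w0)^2 \<le> cmod (- quartic i psi x z - w0^2)"
      by (rule nearby_square_root)
    have "cmod (- quartic i psi x z - w0^2) = ?d (x, z)"
      by (simp add: w0 norm_minus_commute)
    then have "cmod (w - w0)^2 < e^2" using w(2) xz(2) by simp
    then have "cmod (w - w0) < e" using e(1) by (simp add: power_less_imp_less_base)
    then have "w \<in> C" using e(2) by (auto simp: dist_norm norm_minus_commute)
    then have "(x, w, z) \<in> W" using O'(2) AB(4) CE(4) xz w by (auto simp: mem_sheet)
    then show "q \<in> (\<lambda>q. (fst q, snd (snd q))) ` W" unfolding q by force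
  qed
  ultimately show "\<exists>T. openin (top_of_set (S \<times> UNIV)) T \<and> r \<in> T \<and> T \<subseteq> (\<lambda>q. (fst q, snd (snd q))) ` W"
    by blast
qed

text \<open>On each piece the cover is the open projection followed by an open chart.\<close>

lemma open_map_f: "open_map X Y f"
  unfolding open_map_def
proof (intro allI impI)
  fix U assume U: "openin X U"
  define W where "W i = {(x, w, z). cls (i, x, w, z) \<in> U}" for i
  have W: "openin (top_of_set (sheet i psi S)) (W i)" if "i \<in> {1, 2}" for i
    using U that unfolding openin_Ptilde W_def by blast
  have sub: "U \<subseteq> glued_points psi S" using U openin_Ptilde by blast
  have "f ` U = (\<Union>i\<in>{1, 2}. \<phi> i ` (\<lambda>q. (fst q, snd (snd q))) ` W i)"
  proof (intro equalityI subsetI)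
    fix y assume "y \<in> f ` U"
    then obtain i x w z where i: "i \<in> {1, 2}" "(x, w, z) \<in> sheet i psi S" "cls (i, x, w, z) \<in> U"
      "y = f (cls (i, x, w, z))" using sub glued_points_iff by (smt (verit) imageE subsetD)
    then have "y = \<phi> i (x, z)" "(x, w, z) \<in> W i" using f_cls by (auto simp: W_def)
    then have "y \<in> \<phi> i ` (\<lambda>q. (fst q, snd (snd q))) ` W i" by force
    then show "y \<in> (\<Union>i\<in>{1, 2}. \<phi> i ` (\<lambda>q. (fst q, snd (snd q))) ` W i)" using i(1) by blast
  next
    fix y assume "y \<in> (\<Union>i\<in>{1, 2}. \<phi> i ` (\<lambda>q. (fst q, snd (snd q))) ` W i)"
    then obtain i x w z where i: "i \<in> {1, 2}" "(x, w, z) \<in> W i" "y = \<phi> i (x, z)" by force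
    then have "(x, w, z) \<in> sheet i psi S" using openin_imp_subset[OF W] by blast
    then have "y = f (cls (i, x, w, z))" "cls (i, x, w, z) \<in> U" using i f_cls by (auto simp: W_def)
    then show "y \<in> f ` U" by blast
  qed
  moreover have "openin Y (\<phi> i ` (\<lambda>q. (fst q, snd (snd q))) ` W i)" if "i \<in> {1, 2}" for i
    using open_chart[OF that] open_projection[OF W[OF that]] unfolding open_map_def by blast
  ultimately show "openin Y (f ` U)" by (auto intro: openin_Union)
qed


text \<open>The sheet exchange \<open>w \<mapsto> - w\<close>. The fibres of \<open>f\<close> are its orbits, which turns openness of
  \<open>f\<close> into closedness.\<close>

definition sheet_swap :: "'m tagged set \<Rightarrow> 'm tagged set" where
  "sheet_swap C = (\<lambda>(i, x, w, z). (i, x, - w, z)) ` C"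

text \<open>The sign change commutes with the transition, which is linear in \<open>w\<close>, so it
  may be applied to a class elementwise.\<close>

lemma sheet_swap_cls:
  assumes "i \<in> {1, 2}"
  shows "sheet_swap (cls (i, x, w, z)) = cls (i, x, - w, z)"
  using assms by (simp add: sheet_swap_def cls_eq_insert)

lemma sheet_swap_glued_points: "p \<in> glued_points psi S \<Longrightarrow> sheet_swap p \<in> glued_points psi S"
proof -
  assume "p \<in> glued_points psi S"
  then obtain i x w z where i: "i \<in> {1, 2}" "(x, w, z) \<in> sheet i psi S" "p = cls (i, x, w, z)"
    unfolding glued_points_iff by blast
  then show ?thesis
    using cls_mem_glued_points[OF i(1), of x "- w" z psi S] by (simp add: sheet_swap_cls[OF i(1)] mem_sheet)
qed

lemma f_sheet_swap:
  assumes "p \<in> glued_points psi S"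
  shows "f (sheet_swap p) = f p"
proof -
  from assms obtain i x w z where i: "i \<in> {1, 2}" "(x, w, z) \<in> sheet i psi S" "p = cls (i, x, w, z)"
    unfolding glued_points_iff by blast
  moreover from this have "(x, - w, z) \<in> sheet i psi S" by (simp add: mem_sheet)
  ultimately show ?thesis using f_cls by (simp add: sheet_swap_cls)
qed

lemma same_fibre:
  assumes "p \<in> glued_points psi S" "q \<in> glued_points psi S" "f p = f q"
  shows "q = p \<or> q = sheet_swap p"
proof -
  from assms obtain i x w z where i: "i \<in> {1, 2}" "(x, w, z) \<in> sheet i psi S" "p = cls (i, x, w, z)"
    unfolding glued_points_iff by blast
  then have x: "x \<in> S" by (simp add: mem_sheet)
  have "f q = \<phi> i (x, z)" using assms(3) f_cls i by simp
  from mem_fibreE[OF assms(2) this i(1) x]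
  obtain w' where w': "(x, w', z) \<in> sheet i psi S" "q = cls (i, x, w', z)" by blast
  then have "w' = w \<or> w' = - w" using i(2) power2_eq_iff[of w' w] by (simp add: mem_sheet)
  then show ?thesis unfolding w'(2) i(3) sheet_swap_cls[OF i(1)] by blast
qed

lemma open_sheet_swap_vimage:
  assumes "openin X U"
  shows "openin X {p \<in> glued_points psi S. sheet_swap p \<in> U}"
  unfolding openin_Ptilde
proof (intro conjI ballI)
  fix i :: nat assume i: "i \<in> {1, 2}"
  let ?W = "{(x, w, z). cls (i, x, w, z) \<in> U}"
  let ?h = "\<lambda>q :: 'm \<times> complex \<times> complex. (fst q, - fst (snd q), snd (snd q))"
  have W: "openin (top_of_set (sheet i psi S)) ?W" using assms i openin_Ptilde by blast
  have "openin (top_of_set (sheet i psi S)) (sheet i psi S \<inter> ?h -` ?W)"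
    by (rule continuous_openin_preimage[OF _ _ W]) (auto simp: mem_sheet intro!: continuous_intros)
  moreover have "{(x, w, z). cls (i, x, w, z) \<in> {p \<in> glued_points psi S. sheet_swap p \<in> U}} = sheet i psi S \<inter> ?h -` ?W"
    using i by (auto simp: cls_mem_glued_points sheet_swap_cls)
  ultimately show "openin (top_of_set (sheet i psi S))
    {(x, w, z). cls (i, x, w, z) \<in> {p \<in> glued_points psi S. sheet_swap p \<in> U}}" by simp
qed auto

text \<open>A point of the base lies outside the image of \<open>C\<close> exactly when its whole
  orbit under \<open>sheet_swap\<close> avoids \<open>C\<close>. The orbits avoiding
  \<open>C\<close> form an open set, and its image is open.\<close>

lemma closed_map_f: "closed_map X Y f"
  unfolding closed_map_def
proof (intro allI impI)
  fix C assume C: "closedin X C"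
  have CX: "C \<subseteq> glued_points psi S" using closedin_subset[OF C] by (simp add: topspace_Ptilde)
  define O' where "O' = glued_points psi S - C"
  have O': "openin X O'"
    using C unfolding O'_def by (metis closedin_def topspace_Ptilde)
  let ?W = "O' \<inter> {p \<in> glued_points psi S. sheet_swap p \<in> O'}"
  have "openin Y (f ` ?W)"
    using open_map_f openin_Int[OF O' open_sheet_swap_vimage[OF O']] unfolding open_map_def by blast
  moreover have "f ` ?W = topspace Y - f ` C"
  proof (intro equalityI subsetI)
    fix y assume "y \<in> f ` ?W"
    then obtain p where p: "p \<in> O'" "sheet_swap p \<in> O'" "y = f p" by blast
    then have pt: "p \<in> glued_points psi S" by (simp add: O'_def)
    have "y \<notin> f ` C"
    proof
      assume "y \<in> f ` C"
      then obtain c where c: "c \<in> C" "f p = f c" unfolding p(3) by (rule imageE)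
      from c(1) CX have "c \<in> glued_points psi S" by (rule subsetD[rotated])
      from same_fibre[OF pt this c(2)] have "c \<in> O'" using p(1,2) by (elim disjE) simp_all
      then show False using c(1) by (simp add: O'_def)
    qed
    moreover have "y \<in> topspace Y" using pt unfolding p(3) surj_f[symmetric] topspace_Ptilde by (rule imageI)
    ultimately show "y \<in> topspace Y - f ` C" by blast
  next
    fix y assume y: "y \<in> topspace Y - f ` C"
    then have "y \<in> f ` glued_points psi S" using surj_f by (simp add: topspace_Ptilde)
    then obtain p where p: "y = f p" "p \<in> glued_points psi S" by (rule imageE)
    have "p \<notin> C" using y p(1) by blast
    moreover have "sheet_swap p \<notin> C"
    proof
      assume "sheet_swap p \<in> C"
      then have "f (sheet_swap p) \<in> f ` C" by (rule imageI)
      then show False using y unfolding f_sheet_swap[OF p(2)] p(1) by simp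
    qed
    ultimately have "p \<in> ?W" using p(2) sheet_swap_glued_points[OF p(2)] by (simp add: O'_def)
    then show "y \<in> f ` ?W" unfolding p(1) by (rule imageI)
  qed
  ultimately have "openin Y (topspace Y - f ` C)" by simp
  moreover have "f ` C \<subseteq> topspace Y"
    using image_mono[OF CX, of f] surj_f by (simp add: topspace_Ptilde)
  ultimately show "closedin Y (f ` C)" by (simp add: closedin_def)
qed

lemma proper_map_f: "proper_map X Y f"
  unfolding proper_map_def using closed_map_f finite_fibre by (auto intro!: finite_imp_compactin)

section \<open>Topology of the branch locus\<close>

lemma closedin_branch_locus: "closedin Y branch_locus"
proof -
  let ?N = "\<lambda>i. (S \<times> UNIV) \<inter> (\<lambda>q. quartic i psi (fst q) (snd q)) -` (- {0})"
  have N: "openin (top_of_set (S \<times> UNIV)) (?N i)" for i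
    by (rule continuous_openin_preimage_gen) (auto intro!: continuous_on_quartic cont_psi)
  have "topspace Y - branch_locus = (\<Union>i\<in>{1, 2}. \<phi> i ` ?N i)"
  proof (intro equalityI subsetI)
    fix y assume y: "y \<in> topspace Y - branch_locus"
    then obtain i x z where i: "i \<in> {1, 2}" "x \<in> S" "y = \<phi> i (x, z)" using mem_topspace_Y by blast
    then have "quartic i psi x z \<noteq> 0" using y chart_mem_branch_locus by blast
    then show "y \<in> (\<Union>i\<in>{1, 2}. \<phi> i ` ?N i)" using i by force
  next
    fix y assume "y \<in> (\<Union>i\<in>{1, 2}. \<phi> i ` ?N i)"
    then obtain i x z where "i \<in> {1, 2}" "x \<in> S" "y = \<phi> i (x, z)" "quartic i psi x z \<noteq> 0" by force
    then show "y \<in> topspace Y - branch_locus"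
      using chart_mem_branch_locus mem_topspace_Y by blast
  qed
  moreover have "openin Y (\<phi> i ` ?N i)" if "i \<in> {1, 2}" for i
    using open_chart[OF that] N unfolding open_map_def by blast
  ultimately have "openin Y (topspace Y - branch_locus)" by auto
  moreover have "branch_locus \<subseteq> topspace Y"
    using mem_topspace_Y unfolding branch_locus_def by blast
  ultimately show ?thesis by (simp add: closedin_def)
qed

lemma nonroot_in_open:
  assumes "x \<in> S" "open E" "z \<in> E"
  obtains z' where "z' \<in> E" "quartic i psi x z' \<noteq> 0"
proof -
  have "finite {z. quartic i psi x z = 0}" by (rule finite_roots_quartic[OF nonflat[OF assms(1)]])
  then have "\<not> E \<subseteq> {z. quartic i psi x z = 0}"
    using empty_interior_finite[of "{z. quartic i psi x z = 0}"] assms(2,3) interior_maximal[of E] by blast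
  then show thesis using that by blast
qed

lemma interior_branch_locus: "Y interior_of branch_locus = {}"
proof (rule ccontr)
  assume "Y interior_of branch_locus \<noteq> {}"
  then obtain V y where V: "openin Y V" "V \<subseteq> branch_locus" "y \<in> V"
    unfolding interior_of_def by blast
  then have "y \<in> topspace Y" using openin_subset[OF V(1)] by blast
  then obtain i x z where i: "i \<in> {1, 2}" "x \<in> S" "y = \<phi> i (x, z)"
    using mem_topspace_Y by blast
  have "openin (top_of_set (S \<times> UNIV)) {q \<in> S \<times> UNIV. \<phi> i q \<in> V}"
    using cont_chart[OF i(1)] V(1) by (simp add: continuous_map_def)
  then have "open {q \<in> S \<times> UNIV. \<phi> i q \<in> V}"
    using open_S openin_open_trans open_Times open_UNIV by blast
  \<comment> \<open>The slice of the preimage over the fixed point \<open>x\<close> is open in the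
    plane, so it already contains a nonroot.\<close>
  then have "open ((\<lambda>z. (x, z)) -` {q \<in> S \<times> UNIV. \<phi> i q \<in> V})"
    by (rule open_vimage) (intro continuous_intros)
  moreover have "z \<in> (\<lambda>z. (x, z)) -` {q \<in> S \<times> UNIV. \<phi> i q \<in> V}" using V(3) i by simp
  ultimately obtain z' where "z' \<in> (\<lambda>z. (x, z)) -` {q \<in> S \<times> UNIV. \<phi> i q \<in> V}"
    and "quartic i psi x z' \<noteq> 0" by (rule nonroot_in_open[OF i(2)])
  then have "\<phi> i (x, z') \<in> V" "quartic i psi x z' \<noteq> 0" by auto
  then show False using V(2) chart_mem_branch_locus[OF i(1,2)] by blast
qed

text \<open>On the set \<open>N\<close> below, \<open>Q x z / Q x0 z0\<close> lies in the right
  half-plane. It equals \<open>(w / w0)^2\<close>, so \<open>w / w0\<close> is never imaginary, and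
  the sign of its real part tells \<open>w\<close> from \<open>- w\<close>.\<close>

lemma local_sheets:
  assumes "y \<in> topspace Y" "y \<notin> branch_locus"
  obtains V U1 U2 where "openin Y V" "y \<in> V" "V \<inter> branch_locus = {}" "openin X U1" "openin X U2"
    "U1 \<inter> U2 = {}" "{p \<in> topspace X. f p \<in> V} = U1 \<union> U2"
    "inj_on f U1" "inj_on f U2" "f ` U1 = V" "f ` U2 = V"
proof -
  obtain i x0 z0 where i: "i \<in> {1, 2}" "x0 \<in> S" "y = \<phi> i (x0, z0)" using assms mem_topspace_Y by blast
  define Q where "Q = quartic i psi"
  define w0 where "w0 = csqrt (- Q x0 z0)"
  have Q0: "Q x0 z0 \<noteq> 0" using chart_mem_branch_locus i assms Q_def by blast
  have w0: "w0^2 = - Q x0 z0" "w0 \<noteq> 0" using Q0 by (auto simp: w0_def)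
  have Re_square: "0 < Re (s^2) \<Longrightarrow> Re s \<noteq> 0" for s :: complex
    by (auto simp: power2_eq_square)
  define N where "N = (S \<times> UNIV) \<inter> (\<lambda>q. Re (Q (fst q) (snd q) / Q x0 z0)) -` {0<..}"
  have N: "openin (top_of_set (S \<times> UNIV)) N"
    unfolding N_def Q_def
    by (rule continuous_openin_preimage_gen)
       (use Q0 in \<open>auto simp: Q_def intro!: continuous_intros continuous_on_quartic cont_psi\<close>)
  \<comment> \<open>These conditions concern \<open>w\<close> alone, which makes the set visibly
    open; the curve equation turns the first of them into membership in \<open>N\<close>. The
    parameter \<open>e\<close>, used at 1 and -1, is the sign of the sheet.\<close>
  define H where "H e = sheet i psi S \<inter> (\<lambda>q. fst (snd q)) -` {w. 0 < Re (w^2 / w0^2) \<and> 0 < e * Re (w / w0)}"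
    for e :: real
  have H: "openin (top_of_set (sheet i psi S)) (H e)" for e
  proof -
    have "open {w. 0 < Re (w^2 / w0^2) \<and> 0 < e * Re (w / w0)}"
      by (intro open_Collect_conj open_Collect_less continuous_intros) (use w0 in auto)
    then show ?thesis
      unfolding H_def by (intro continuous_openin_preimage_gen continuous_intros)
  qed
  have mem_H: "(x, w, z) \<in> H e \<longleftrightarrow> (x, w, z) \<in> sheet i psi S \<and> (x, z) \<in> N \<and> 0 < e * Re (w / w0)" for x w z e
  proof -
    have "w^2 / w0^2 = Q x z / Q x0 z0" if "(x, w, z) \<in> sheet i psi S"
      using that w0 by (simp add: mem_sheet Q_def)
    then show ?thesis by (auto simp: H_def N_def mem_sheet)
  qed
  let ?U = "\<lambda>e. (\<lambda>q. cls (i, q)) ` H e"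
  have Re_w: "Re (w / w0) \<noteq> 0" if "(x, w, z) \<in> sheet i psi S" "(x, z) \<in> N" for x w z
  proof (rule Re_square)
    have "(w / w0)^2 = Q x z / Q x0 z0"
      using that w0 by (simp add: mem_sheet Q_def power_divide)
    then show "0 < Re ((w / w0)^2)" using that by (simp add: N_def)
  qed
  have f_U: "f ` ?U e = \<phi> i ` N" if e: "e = 1 \<or> e = - 1" for e
  proof (intro equalityI subsetI)
    fix v assume "v \<in> f ` ?U e"
    then obtain x w z where q: "(x, w, z) \<in> H e" "v = f (cls (i, x, w, z))" by force
    then have "v = \<phi> i (x, z)" using f_cls[OF i(1)] mem_H by blast
    then show "v \<in> \<phi> i ` N" using q mem_H by blast
  next
    fix v assume "v \<in> \<phi> i ` N"
    then obtain x z where v: "v = \<phi> i (x, z)" "(x, z) \<in> N" by force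
    then have x: "x \<in> S" by (simp add: N_def)
    define w where "w = csqrt (- Q x z)"
    have sh: "(x, w, z) \<in> sheet i psi S" "(x, - w, z) \<in> sheet i psi S"
      using x by (auto simp: mem_sheet w_def Q_def)
    have "0 < e * Re (w / w0) \<or> 0 < e * Re ((- w) / w0)" using Re_w[OF sh(1) v(2)] e by auto
    then obtain w' where "(x, w', z) \<in> H e" using sh v(2) mem_H by blast
    moreover from this have "f (cls (i, x, w', z)) = v" using f_cls[OF i(1)] v mem_H by blast
    ultimately show "v \<in> f ` ?U e" by force
  qed
  have inj: "inj_on f (?U e)" if e: "e = 1 \<or> e = - 1" for e
  proof (rule inj_onI)
    fix p p' assume "p \<in> ?U e" "p' \<in> ?U e" and eq: "f p = f p'"
    then obtain x w z x' w' z' where q: "(x, w, z) \<in> H e" "p = cls (i, x, w, z)"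
      "(x', w', z') \<in> H e" "p' = cls (i, x', w', z')" by force
    then have sh: "(x, w, z) \<in> sheet i psi S" "(x', w', z') \<in> sheet i psi S" using mem_H by auto
    then have "\<phi> i (x, z) = \<phi> i (x', z')" using eq f_cls[OF i(1)] q by simp
    then have *: "x' = x" "z' = z"
      using chart_eq_iff[OF i(1) i(1), of x x' z z'] sh by (auto simp: mem_sheet)
    then have "w' = w \<or> w' = - w" using sh power2_eq_iff[of w' w] by (simp add: mem_sheet)
    moreover have "w' \<noteq> - w"
    proof
      assume "w' = - w"
      then have "0 < e * Re (w / w0)" "0 < - (e * Re (w / w0))" using q(1,3) mem_H by auto
      then show False by linarith
    qed
    ultimately show "p = p'" using q * by simp
  qed
  show thesis
  proof (rule that)
    show "openin Y (\<phi> i ` N)" using open_chart[OF i(1)] N unfolding open_map_def by blast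
    show "y \<in> \<phi> i ` N" using i Q0 by (auto simp: N_def)
    show "\<phi> i ` N \<inter> branch_locus = {}"
    proof -
      have "\<phi> i (x, z) \<notin> branch_locus" if "(x, z) \<in> N" for x z
        using that chart_mem_branch_locus[OF i(1), of x z] by (auto simp: N_def Q_def)
      then show ?thesis by auto
    qed
    show "openin X (?U 1)" "openin X (?U (- 1))" by (rule open_piece_Ptilde[OF i(1) H])+
    show "?U 1 \<inter> ?U (- 1) = {}"
    proof (rule ccontr)
      assume "\<not> ?thesis"
      then obtain x w z x' w' z' where q: "(x, w, z) \<in> H 1" "(x', w', z') \<in> H (- 1)"
        "cls (i, x, w, z) = cls (i, x', w', z')" by force
      then have "w' = w" using cls_eq_iff[OF i(1) i(1), of x w z x' w' z'] i(1) by auto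
      then show False using q(1,2) mem_H by auto
    qed
    show "{p \<in> topspace X. f p \<in> \<phi> i ` N} = ?U 1 \<union> ?U (- 1)"
    proof (intro equalityI subsetI)
      fix p assume "p \<in> {p \<in> topspace X. f p \<in> \<phi> i ` N}"
      then obtain x z where p: "p \<in> glued_points psi S" "f p = \<phi> i (x, z)" "(x, z) \<in> N"
        by (auto simp: topspace_Ptilde)
      then have "x \<in> S" by (simp add: N_def)
      from mem_fibreE[OF p(1,2) i(1) this] obtain w where
        w: "(x, w, z) \<in> sheet i psi S" "p = cls (i, x, w, z)" by blast
      then have "(x, w, z) \<in> H 1 \<or> (x, w, z) \<in> H (- 1)"
        using mem_H p(3) Re_w[OF w(1) p(3)] by auto
      then show "p \<in> ?U 1 \<union> ?U (- 1)" using w(2) by blast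
    next
      fix p assume p: "p \<in> ?U 1 \<union> ?U (- 1)"
      then have "f p \<in> \<phi> i ` N" using f_U[of 1] f_U[of "- 1"] by blast
      moreover have "p \<in> topspace X" using p mem_H by (auto simp: topspace_Ptilde cls_mem_glued_points[OF i(1)])
      ultimately show "p \<in> {p \<in> topspace X. f p \<in> \<phi> i ` N}" by blast
    qed
  qed (use inj f_U in auto)
qed

lemma two_sheeted_covering_f:
  "two_sheeted_covering (subtopology X {p. f p \<notin> branch_locus}) (subtopology Y (- branch_locus)) f"
  (is "two_sheeted_covering ?X ?Y f")
  unfolding two_sheeted_covering_def
proof (intro conjI ballI)
  show "continuous_map ?X ?Y f"
    by (rule continuous_map_into_subtopology[OF continuous_map_from_subtopology[OF continuous_map_f]])
       auto
  fix y assume "y \<in> topspace ?Y"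
  then have "y \<in> topspace Y" "y \<notin> branch_locus" by auto
  then obtain V U1 U2 where *: "openin Y V" "y \<in> V" "V \<inter> branch_locus = {}" "openin X U1" "openin X U2"
    "U1 \<inter> U2 = {}" "{p \<in> topspace X. f p \<in> V} = U1 \<union> U2"
    "inj_on f U1" "inj_on f U2" "f ` U1 = V" "f ` U2 = V" by (rule local_sheets)
  have V: "- branch_locus \<inter> V = V" using *(3) by blast
  have U: "{p. f p \<notin> branch_locus} \<inter> U1 = U1" "{p. f p \<notin> branch_locus} \<inter> U2 = U2" using *(3,7) by blast+
  have "homeomorphic_map (subtopology ?X U1) (subtopology ?Y V) f"
    using homeomorphic_map_open_restriction[OF continuous_map_f open_map_f *(4,8)] *(10)
    by (simp add: subtopology_subtopology U V)
  moreover have "homeomorphic_map (subtopology ?X U2) (subtopology ?Y V) f"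
    using homeomorphic_map_open_restriction[OF continuous_map_f open_map_f *(5,9)] *(11)
    by (simp add: subtopology_subtopology U V)
  moreover have "openin ?Y V" using *(1) V by (metis inf_commute openin_subtopology)
  moreover have "openin ?X U1" "openin ?X U2" using *(4,5) U by (metis inf_commute openin_subtopology)+
  moreover have "{p \<in> topspace ?X. f p \<in> V} = U1 \<union> U2" using *(3,7) by auto
  ultimately show "\<exists>V U1 U2. openin ?Y V \<and> y \<in> V \<and> openin ?X U1 \<and> openin ?X U2 \<and>
      U1 \<inter> U2 = {} \<and> {p \<in> topspace ?X. f p \<in> V} = U1 \<union> U2 \<and>
      homeomorphic_map (subtopology ?X U1) (subtopology ?Y V) f \<and>
      homeomorphic_map (subtopology ?X U2) (subtopology ?Y V) f"
    using *(2,6) by blast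
qed

lemma double_branched_cover_f: "double_branched_cover X Y f branch_locus"
  unfolding double_branched_cover_def
  using continuous_map_f surj_f open_map_f proper_map_f closedin_branch_locus interior_branch_locus
    two_sheeted_covering_f by blast

text \<open>Over a root the only value is \<open>w = 0\<close>. Nearby nonroots over the same
  \<open>x\<close>, with quartic below \<open>e^2\<close> in modulus, have both square roots within
  \<open>e\<close> of 0; these are two distinct points with one image.\<close>

lemma branch_point_f:
  assumes p: "p \<in> topspace X" "f p \<in> branch_locus"
  shows "branch_point X f p"
  unfolding branch_point_def
proof (intro conjI allI impI)
  from p obtain i x w z where i: "i \<in> {1, 2}" "(x, w, z) \<in> sheet i psi S" "p = cls (i, x, w, z)"
    unfolding glued_points_iff topspace_Ptilde by blast
  then have x: "x \<in> S" and fp: "f p = \<phi> i (x, z)" using f_cls by (auto simp: mem_sheet)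
  have Q0: "quartic i psi x z = 0" using p(2) fp chart_mem_branch_locus[OF i(1) x] by simp
  then have w: "w = 0" using i(2) by (simp add: mem_sheet)
  show "{q \<in> topspace X. f q = f p} = {p}"
    unfolding fp fibre_eq[OF i(1) x] using i(3) w Q0 by simp
  fix U assume U: "openin X U \<and> p \<in> U"
  then have "openin (top_of_set (sheet i psi S)) {(x, w, z). cls (i, x, w, z) \<in> U}"
    using i(1) openin_Ptilde by blast
  then obtain O' where O': "open O'" "{(x, w, z). cls (i, x, w, z) \<in> U} = sheet i psi S \<inter> O'"
    by (auto simp: openin_open)
  have "(x, 0, z) \<in> {(x, w, z). cls (i, x, w, z) \<in> U}" using U i(3) w by simp
  then have O'0: "(x, 0, z) \<in> O'" using O'(2) by blast
  have "open ((\<lambda>q. (x, q)) -` O')" using O'(1) by (rule open_vimage) (intro continuous_intros)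
  then obtain C E where CE: "open C" "open E" "(0, z) \<in> C \<times> E" "C \<times> E \<subseteq> (\<lambda>q. (x, q)) -` O'"
    using open_prod_elim[of "(\<lambda>q. (x, q)) -` O'" "(0, z)"] O'0 by blast
  then obtain e where e: "e > 0" "ball 0 e \<subseteq> C" by (auto elim: openE)
  have "continuous_on UNIV (quartic i psi x)"
    by (cases "i = 1") (auto simp: quartic_def \<Psi>_def \<Psi>'_def[abs_def] \<Psi>_def[abs_def] intro!: continuous_intros)
  then have "open (E \<inter> (\<lambda>z. cmod (quartic i psi x z)) -` {..<e^2})"
    by (intro open_Int CE(2) open_vimage open_lessThan continuous_on_norm)
  moreover have "z \<in> E \<inter> (\<lambda>z. cmod (quartic i psi x z)) -` {..<e^2}" using CE(3) e Q0 by auto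
  ultimately obtain z' where "z' \<in> E \<inter> (\<lambda>z. cmod (quartic i psi x z)) -` {..<e^2}"
    and z'0: "quartic i psi x z' \<noteq> 0" by (rule nonroot_in_open[OF x])
  then have z': "z' \<in> E" "cmod (quartic i psi x z') < e^2" "quartic i psi x z' \<noteq> 0" by auto
  obtain w' where w': "w'^2 = - quartic i psi x z'" "cmod (w' - 0)^2 \<le> cmod (- quartic i psi x z' - 0^2)"
    by (rule nearby_square_root)
  then have "cmod w' ^ 2 < e^2" using z' by simp
  then have "cmod w' < e" using e(1) by (simp add: power_less_imp_less_base)
  then have "w' \<in> C" "- w' \<in> C" using e(2) by (auto simp: subset_iff)
  then have "(x, w', z') \<in> sheet i psi S \<inter> O'" "(x, - w', z') \<in> sheet i psi S \<inter> O'"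
    using CE(4) z' w' x by (auto simp: mem_sheet)
  then have "cls (i, x, w', z') \<in> U" "cls (i, x, - w', z') \<in> U" unfolding O'(2)[symmetric] by auto
  moreover have "f (cls (i, x, w', z')) = f (cls (i, x, - w', z'))"
    using f_cls[OF i(1)] w'(1) x by (simp add: mem_sheet)
  moreover have "cls (i, x, w', z') \<noteq> cls (i, x, - w', z')"
    using cls_eq_iff[OF i(1) i(1), of x w' z' x "- w'" z'] i(1) w'(1) z'(3) by auto
  ultimately show "\<exists>q\<in>U. \<exists>r\<in>U. q \<noteq> r \<and> f q = f r" by blast
qed (use p in auto)

text \<open>Over the locus, distinct points of equal image in every neighbourhood rule out local
  injectivity; elsewhere one of the two local sheets is a neighbourhood mapped
  homeomorphically.\<close>

lemma singular_point_iff: "singular_point X Y f p \<longleftrightarrow> p \<in> topspace X \<and> f p \<in> branch_locus"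
proof
  assume p: "p \<in> topspace X \<and> f p \<in> branch_locus"
  show "singular_point X Y f p"
    unfolding singular_point_def
  proof (intro conjI notI)
    assume "\<exists>U. openin X U \<and> p \<in> U \<and> openin Y (f ` U) \<and>
      homeomorphic_map (subtopology X U) (subtopology Y (f ` U)) f"
    then obtain U where U: "openin X U" "p \<in> U" and h: "homeomorphic_map (subtopology X U) (subtopology Y (f ` U)) f"
      by blast
    have "topspace (subtopology X U) = U" using openin_subset[OF U(1)] by (auto simp: topspace_subtopology)
    then have "inj_on f U" using homeomorphic_imp_injective_map[OF h] by simp
    moreover have "branch_point X f p" using p branch_point_f by simp
    then have "\<exists>q\<in>U. \<exists>r\<in>U. q \<noteq> r \<and> f q = f r" using U by (simp add: branch_point_def)
    then obtain q r where "q \<in> U" "r \<in> U" "q \<noteq> r" "f q = f r" by blast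
    ultimately show False by (auto dest: inj_onD)
  qed (use p in auto)
next
  assume s: "singular_point X Y f p"
  then have p: "p \<in> topspace X" by (simp add: singular_point_def)
  moreover have "f p \<in> branch_locus"
  proof (rule ccontr)
    assume nb: "f p \<notin> branch_locus"
    have "f p \<in> topspace Y" using p unfolding surj_f[symmetric] by (rule imageI)
    then obtain V U1 U2 where *: "openin Y V" "f p \<in> V" "V \<inter> branch_locus = {}"
      "openin X U1" "openin X U2" "U1 \<inter> U2 = {}" "{p \<in> topspace X. f p \<in> V} = U1 \<union> U2"
      "inj_on f U1" "inj_on f U2" "f ` U1 = V" "f ` U2 = V"
      by (rule local_sheets[OF _ nb])
    then have "p \<in> U1 \<union> U2" using p by (simp flip: *(7))
    then obtain U where U: "openin X U" "p \<in> U" "inj_on f U" "f ` U = V"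
      using *(4,5,8-11) by (elim UnE) simp_all
    have "homeomorphic_map (subtopology X U) (subtopology Y (f ` U)) f"
      by (rule homeomorphic_map_open_restriction[OF continuous_map_f open_map_f U(1,3)])
    then have "\<exists>U. openin X U \<and> p \<in> U \<and> openin Y (f ` U) \<and>
      homeomorphic_map (subtopology X U) (subtopology Y (f ` U)) f" using U *(1) by (intro exI[of _ U]) simp
    then show False using s unfolding singular_point_def by simp
  qed
  ultimately show "p \<in> topspace X \<and> f p \<in> branch_locus" by blast
qed

end

section \<open>Continuous frames\<close>

lemma atlas_chart:
  assumes "oriented_smooth_atlas A" "c \<in> A"
  shows "open (fst c)" "open (snd c ` fst c)" "homeomorphism (fst c) (snd c ` fst c) (snd c) (chart_inv c)"
  using assms unfolding oriented_smooth_atlas_def by auto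

lemma chart_inv_snd:
  assumes "oriented_smooth_atlas A" "c \<in> A" "x \<in> fst c"
  shows "chart_inv c (snd c x) = x"
  using homeomorphism_apply1[OF atlas_chart(3)[OF assms(1,2)] assms(3)] .

lemma chart_at_mem:
  assumes "oriented_smooth_atlas A"
  shows "chart_at A x \<in> A" "x \<in> fst (chart_at A x)"
proof -
  have "x \<in> (\<Union>c\<in>A. fst c)" using assms by (simp add: oriented_smooth_atlas_def)
  then have "\<exists>c. c \<in> A \<and> x \<in> fst c" by blast
  from someI_ex[OF this] show "chart_at A x \<in> A" "x \<in> fst (chart_at A x)"
    by (simp_all add: chart_at_def)
qed

text \<open>The positive Jacobians of the atlas enter here: they make a change of chart invertible
  on tangent spaces.\<close>

lemma of_chart_linear_bij:
  assumes A: "oriented_smooth_atlas A" "c \<in> A" "x \<in> fst c"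
  shows "linear (of_chart A c x)" "bij (of_chart A c x)"
proof -
  let ?c' = "chart_at A x"
  have c': "?c' \<in> A" "x \<in> fst ?c'" using chart_at_mem[OF A(1)] by auto
  have "smooth_on (snd c ` (fst c \<inter> fst ?c')) (snd ?c' \<circ> chart_inv c)"
    and det: "0 < det (matrix (transition_deriv c ?c' x))"
    using A c' unfolding oriented_smooth_atlas_def by auto
  then have "Ck_on 1 (snd c ` (fst c \<inter> fst ?c')) (snd ?c' \<circ> chart_inv c)"
    unfolding smooth_on_def by blast
  then have "(snd ?c' \<circ> chart_inv c) differentiable (at (snd c x))"
    using A(3) c'(2) by simp
  then show lin: "linear (of_chart A c x)"
    unfolding of_chart_def transition_deriv_def by (rule linear_frechet_derivative)
  then have "inj (of_chart A c x)"
    using det det_nz_iff_inj[OF lin] by (simp add: of_chart_def)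
  then show "bij (of_chart A c x)"
    using linear_injective_imp_surjective[OF lin] by (simp add: bij_def)
qed

text \<open>Each chart is a homeomorphism, so the coordinates \<open>u\<close> may be replaced by
  the point \<open>x\<close> itself. Every tangent vector is reached from
  \<open>chart_at A x\<close>, hence the image condition of the quotient topology holds for every
  \<open>V\<close>.\<close>

lemma openin_tangent_bundle:
  assumes A: "oriented_smooth_atlas A"
  shows "openin (tangent_bundle A) V \<longleftrightarrow>
    (\<forall>c\<in>A. open {(x, v). x \<in> fst c \<and> (x, of_chart A c x v) \<in> V})"
proof -
  let ?q = "\<lambda>(c, u, v). (chart_inv c u, of_chart A c (chart_inv c u) v)"
  let ?T = "sum_topology (\<lambda>c. top_of_set ((snd c ` fst c) \<times> (UNIV :: (real^4) set))) A"
  have top: "topspace ?T = (SIGMA c:A. (snd c ` fst c) \<times> UNIV)" by (auto simp: comp_def)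
  have sub: "V \<subseteq> ?q ` topspace ?T"
  proof clarify
    fix x v assume "(x, v) \<in> V"
    let ?c = "chart_at A x"
    have c: "?c \<in> A" "x \<in> fst ?c" using chart_at_mem[OF A] by auto
    obtain v' where "v = of_chart A ?c x v'" using bij_is_surj[OF of_chart_linear_bij(2)[OF A c]] by (metis surjD)
    then have "(x, v) = ?q (?c, snd ?c x, v')" using chart_inv_snd[OF A c] by simp
    moreover have "(?c, snd ?c x, v') \<in> topspace ?T" unfolding top using c by simp
    ultimately show "(x, v) \<in> ?q ` topspace ?T" by (rule image_eqI)
  qed
  have *: "openin (top_of_set ((snd c ` fst c) \<times> UNIV)) {q. (c, q) \<in> {p \<in> topspace ?T. ?q p \<in> V}} \<longleftrightarrow>
    open {(x, v). x \<in> fst c \<and> (x, of_chart A c x v) \<in> V}" if c: "c \<in> A" for c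
  proof -
    let ?O = "{(x, v). x \<in> fst c \<and> (x, of_chart A c x v) \<in> V}"
    let ?P = "{(u, v). u \<in> snd c ` fst c \<and> (chart_inv c u, of_chart A c (chart_inv c u) v) \<in> V}"
    note hom = atlas_chart(3)[OF A c]
    have opn: "open (snd c ` fst c \<times> (UNIV :: (real^4) set))" "open (fst c \<times> (UNIV :: (real^4) set))"
      using atlas_chart[OF A c] by (auto intro: open_Times)
    have P: "{q. (c, q) \<in> {p \<in> topspace ?T. ?q p \<in> V}} = ?P" unfolding top using c by auto
    have eq1: "?O = (fst c \<times> UNIV) \<inter> (\<lambda>q. (snd c (fst q), snd q)) -` ?P"
      using chart_inv_snd[OF A c] by auto
    have c1: "continuous_on (fst c \<times> (UNIV :: (real^4) set)) (\<lambda>q. (snd c (fst q), snd q))"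
      by (intro continuous_intros continuous_on_compose2[OF homeomorphism_cont1[OF hom]]) auto
    have 1: "open ?P \<Longrightarrow> open ?O"
      by (subst eq1) (rule continuous_open_preimage[OF c1 opn(2)])
    have eq2: "?P = (snd c ` fst c \<times> UNIV) \<inter> (\<lambda>q. (chart_inv c (fst q), snd q)) -` ?O"
      using chart_inv_snd[OF A c] by auto
    have c2: "continuous_on (snd c ` fst c \<times> (UNIV :: (real^4) set)) (\<lambda>q. (chart_inv c (fst q), snd q))"
      by (intro continuous_intros continuous_on_compose2[OF homeomorphism_cont2[OF hom]]) auto
    have 2: "open ?O \<Longrightarrow> open ?P"
      by (subst eq2) (rule continuous_open_preimage[OF c2 opn(1)])
    show ?thesis unfolding P openin_open_eq[OF opn(1)] using 1 2 by auto
  qed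
  show ?thesis
    unfolding tangent_bundle_def openin_coinduced_topology openin_sum_topology
    using sub * unfolding top by (auto simp: comp_def)
qed

lemma topspace_tangent_bundle:
  assumes A: "oriented_smooth_atlas A"
  shows "topspace (tangent_bundle A) = UNIV"
proof -
  have "{(x, v). x \<in> fst c \<and> (x, of_chart A c x v) \<in> UNIV} = fst c \<times> UNIV" for c by auto
  then have "openin (tangent_bundle A) UNIV"
    using atlas_chart(1)[OF A] by (simp add: openin_tangent_bundle[OF A] open_Times)
  then show ?thesis using openin_subset by blast
qed

text \<open>Pairing a combination \<open>F a\<close> of the orthonormal vectors with each of them
  returns the coefficients up to sign. So \<open>F\<close> is injective, by dimension surjective,
  and a vector orthogonal to everything has zero coefficients.\<close>

lemma lorentzian_nondegenerate:
  assumes "lorentzian_metric A g" "\<And>w. g x v w = 0"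
  shows "v = 0"
proof -
  from assms(1) have bil: "bilinear (g x)" unfolding lorentzian_metric_def by blast
  from assms(1) obtain e :: "4 \<Rightarrow> real^4" where
    e: "\<And>i j. g x (e i) (e j) = (if i \<noteq> j then 0 else if i = 4 then -1 else 1)"
    unfolding lorentzian_metric_def by blast
  define F where "F a = (\<Sum>i\<in>UNIV. a $ i *\<^sub>R e i)" for a :: "real^4"
  have lin: "linear F"
    by (rule linearI) (simp_all add: F_def scaleR_left_distrib sum.distrib scaleR_sum_right)
  have gF: "g x (F a) (e j) = a $ j * (if j = 4 then -1 else 1)" for a j
  proof -
    have "g x (F a) (e j) = (\<Sum>i\<in>UNIV. a $ i * g x (e i) (e j))"
      unfolding F_def using bilinear_def[of "g x"] bil
      by (simp add: linear_sum[of "\<lambda>v. g x v (e j)"] linear_scale[of "\<lambda>v. g x v (e j)"])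
    also have "\<dots> = (\<Sum>i\<in>UNIV. if i = j then a $ j * (if j = 4 then -1 else 1) else 0)"
      by (intro sum.cong refl) (auto simp: e)
    finally show ?thesis by simp
  qed
  have zero: "a = 0" if "\<And>j. g x (F a) (e j) = 0" for a
  proof -
    have "a $ j = 0" for j using that[of j] unfolding gF by (cases "j = 4") auto
    then show ?thesis by (simp add: vec_eq_iff)
  qed
  have "g x 0 (e j) = 0" for j using bilinear_lzero[OF bil] by simp
  then have "inj F" using lin zero by (simp add: linear_injective_0)
  then obtain a where a: "v = F a" using linear_injective_imp_surjective[OF lin] by (metis surjD)
  then have "a = 0" using zero assms(2) by simp
  then show ?thesis using a linear_0[OF lin] by simp
qed

text \<open>A real form of the complex coframe: \<open>\<theta> 2\<close> is conjugate to
  \<open>\<theta> 1\<close> and the last two forms are real, so these four numbers retain everything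
  and turn the coframe at a point into an endomorphism of \<open>real^4\<close>.\<close>

definition frame_coords :: "(4 \<Rightarrow> 'm form1) \<Rightarrow> 'm \<Rightarrow> real^4 \<Rightarrow> real^4" where
  "frame_coords \<theta> x v = vector [Re (\<theta> 1 x v), Im (\<theta> 1 x v), Re (\<theta> 3 x v), Re (\<theta> 4 x v)]"

lemma frame_coords_nth [simp]:
  "frame_coords \<theta> x v $ 1 = Re (\<theta> 1 x v)" "frame_coords \<theta> x v $ 2 = Im (\<theta> 1 x v)"
  "frame_coords \<theta> x v $ 3 = Re (\<theta> 3 x v)" "frame_coords \<theta> x v $ 4 = Re (\<theta> 4 x v)"
  by (simp_all add: frame_coords_def vector_def)

lemma continuous_on_det:
  fixes F :: "'a::topological_space \<Rightarrow> real^'n^'n"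
  assumes "\<And>i j. continuous_on X (\<lambda>q. F q $ i $ j)"
  shows "continuous_on X (\<lambda>q. det (F q))"
  unfolding det_def by (intro continuous_on_sum continuous_on_mult continuous_on_const continuous_on_prod assms)

locale null_framed =
  fixes A :: "('m::topological_space) chart set" and g :: "'m metric"
    and S :: "'m set" and \<theta> :: "4 \<Rightarrow> 'm form1"
  assumes atlas: "oriented_smooth_atlas A" and metric: "lorentzian_metric A g"
    and open_S: "open S" and coframe: "null_coframe A g S \<theta>"
begin

abbreviation \<Theta> where "\<Theta> \<equiv> frame_coords \<theta>"

lemma coframe_linear: "x \<in> S \<Longrightarrow> linear (\<theta> i x)"
  using coframe unfolding null_coframe_def smooth_form_def by blast

lemma coframe_components:
  assumes "x \<in> S"
  shows "\<theta> 1 x v = Complex (\<Theta> x v $ 1) (\<Theta> x v $ 2)" "\<theta> 2 x v = Complex (\<Theta> x v $ 1) (- (\<Theta> x v $ 2))"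
    "\<theta> 3 x v = of_real (\<Theta> x v $ 3)" "\<theta> 4 x v = of_real (\<Theta> x v $ 4)"
proof -
  have c: "\<theta> 2 x v = cnj (\<theta> 1 x v)" "\<theta> 3 x v \<in> \<real>" "\<theta> 4 x v \<in> \<real>"
    using coframe assms unfolding null_coframe_def by blast+
  then show "\<theta> 1 x v = Complex (\<Theta> x v $ 1) (\<Theta> x v $ 2)" "\<theta> 2 x v = Complex (\<Theta> x v $ 1) (- (\<Theta> x v $ 2))"
    "\<theta> 3 x v = of_real (\<Theta> x v $ 3)" "\<theta> 4 x v = of_real (\<Theta> x v $ 4)"
    by (auto simp: complex_eq_iff of_real_Re)
qed

lemma metric_coords:
  assumes "x \<in> S"
  shows "g x v w = 2 * (\<Theta> x v $ 1 * \<Theta> x w $ 1 + \<Theta> x v $ 2 * \<Theta> x w $ 2)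
    - \<Theta> x v $ 3 * \<Theta> x w $ 4 - \<Theta> x v $ 4 * \<Theta> x w $ 3"
proof -
  have "complex_of_real (g x v w) =
        \<theta> 1 x v * \<theta> 2 x w + \<theta> 2 x v * \<theta> 1 x w - \<theta> 3 x v * \<theta> 4 x w - \<theta> 4 x v * \<theta> 3 x w"
    using coframe assms unfolding null_coframe_def by blast
  then show ?thesis
    unfolding coframe_components[OF assms] by (auto simp: complex_eq_iff)
qed

lemma \<Theta>_linear:
  assumes "x \<in> S"
  shows "linear (\<Theta> x)"
  using coframe_linear[OF assms] 
  by (intro linearI) (simp_all add: vec_eq_iff forall_4 linear_add linear_scale)

text \<open>By \<open>metric_coords\<close>, a vector killed by the coframe is orthogonal to all
  vectors; nondegeneracy gives injectivity and the dimension does the rest.\<close>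

lemma \<Theta>_bij:
  assumes "x \<in> S"
  shows "bij (\<Theta> x)"
proof -
  have "v = 0" if "\<Theta> x v = 0" for v
    by (rule lorentzian_nondegenerate[OF metric, of x]) (simp only: metric_coords[OF assms] that, simp)
  then have "inj (\<Theta> x)" using \<Theta>_linear[OF assms] by (simp add: linear_injective_0)
  then show ?thesis using linear_injective_imp_surjective[OF \<Theta>_linear[OF assms]] by (simp add: bij_def)
qed

definition frame :: "'m \<Rightarrow> real^4 \<Rightarrow> real^4" where
  "frame x = inv (\<Theta> x)"

lemma \<Theta>_frame [simp]: "x \<in> S \<Longrightarrow> \<Theta> x (frame x a) = a"
  using \<Theta>_bij by (simp add: frame_def bij_is_surj surj_f_inv_f)

lemma frame_\<Theta> [simp]: "x \<in> S \<Longrightarrow> frame x (\<Theta> x v) = v"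
  using \<Theta>_bij by (simp add: frame_def bij_is_inj)

lemma frame_linear: "x \<in> S \<Longrightarrow> linear (frame x)"
  using \<Theta>_linear \<Theta>_bij unfolding frame_def by (metis bij_is_inj bij_is_surj inj_linear_imp_inv_linear)

text \<open>Smoothness of a form concerns its coefficients for one constant component vector at a
  time. An expansion in the standard basis uses linearity to upgrade this to joint
  continuity.\<close>

lemma continuous_on_form_in_chart:
  assumes \<omega>: "smooth_form A S \<omega>" and c: "c \<in> A"
  shows "continuous_on ((fst c \<inter> S) \<times> UNIV) (\<lambda>q. \<omega> (fst q) (of_chart A c (fst q) (snd q)))"
proof -
  have basis: "continuous_on (fst c \<inter> S) (\<lambda>x. \<omega> x (of_chart A c x v))" for v
  proof -
    have "Ck_on 0 (snd c ` (fst c \<inter> S)) (form_coeff A c \<omega> v)"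
      using \<omega> c unfolding smooth_form_def smooth_on_def by blast
    then have cont: "continuous_on (snd c ` (fst c \<inter> S)) (form_coeff A c \<omega> v)" by simp
    have "continuous_on (fst c \<inter> S) (snd c)"
      using homeomorphism_cont1[OF atlas_chart(3)[OF atlas c]] by (rule continuous_on_subset) auto
    from continuous_on_compose2[OF cont this]
    have "continuous_on (fst c \<inter> S) (\<lambda>x. form_coeff A c \<omega> v (snd c x))" by auto
    then show ?thesis
      by (rule continuous_on_eq) (use chart_inv_snd[OF atlas c] in \<open>auto simp: form_coeff_def\<close>)
  qed
  have expand: "\<omega> x (of_chart A c x v) = (\<Sum>j\<in>UNIV. v $ j *\<^sub>R \<omega> x (of_chart A c x (axis j 1)))"
    if "x \<in> fst c \<inter> S" for x v
  proof -
    have lin: "linear (\<lambda>v. \<omega> x (of_chart A c x v))"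
      using that \<omega> linear_compose[OF of_chart_linear_bij(1)[OF atlas c], of x "\<omega> x"]
      by (auto simp: smooth_form_def comp_def)
    have "v = (\<Sum>j\<in>UNIV. v $ j *\<^sub>R axis j 1)"
      using basis_expansion[of v] by (simp add: scalar_mult_eq_scaleR)
    then have "\<omega> x (of_chart A c x v) = \<omega> x (of_chart A c x (\<Sum>j\<in>UNIV. v $ j *\<^sub>R axis j 1))" by simp
    then show ?thesis
      using linear_sum[OF lin, of "\<lambda>j. v $ j *\<^sub>R axis j 1" UNIV] linear_scale[OF lin] by simp
  qed
  have "continuous_on ((fst c \<inter> S) \<times> UNIV)
    (\<lambda>q. \<Sum>j\<in>UNIV. (snd q :: real^4) $ j *\<^sub>R \<omega> (fst q) (of_chart A c (fst q) (axis j 1)))"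
    by (intro continuous_intros continuous_on_compose2[OF basis]) auto
  then show ?thesis
    by (rule continuous_on_eq) (use expand in auto)
qed

lemma continuous_on_\<Theta>_in_chart:
  assumes c: "c \<in> A"
  shows "continuous_on ((fst c \<inter> S) \<times> UNIV) (\<lambda>q. \<Theta> (fst q) (of_chart A c (fst q) (snd q)))"
proof -
  have *: "continuous_on ((fst c \<inter> S) \<times> UNIV) (\<lambda>q. \<theta> i (fst q) (of_chart A c (fst q) (snd q)))" for i
    using coframe c unfolding null_coframe_def by (intro continuous_on_form_in_chart) auto
  have "continuous_on ((fst c \<inter> S) \<times> UNIV) (\<lambda>q. \<Theta> (fst q) (of_chart A c (fst q) (snd q)) $ i)" for i
    using exhaust_4[of i] continuous_on_Re[OF *] continuous_on_Im[OF *] by (elim disjE) simp_all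
  then show ?thesis
    using continuous_on_vec_lambda[of "(fst c \<inter> S) \<times> UNIV" "\<lambda>i q. \<Theta> (fst q) (of_chart A c (fst q) (snd q)) $ i"]
    by simp
qed

text \<open>Cramer's rule makes the inverse of the coframe continuous.\<close>

lemma frame_in_chart:
  assumes c: "c \<in> A"
  obtains W where "continuous_on ((fst c \<inter> S) \<times> UNIV) (\<lambda>q. W (fst q) (snd q))"
    "\<And>x a. x \<in> fst c \<inter> S \<Longrightarrow> of_chart A c x (W x a) = frame x a"
proof -
  \<comment> \<open>\<open>frame x a\<close> is recorded in \<open>chart_at A x\<close>, which may
    jump with \<open>x\<close>, so continuity is claimed for its components \<open>W x a\<close> in
    the fixed chart \<open>c\<close>. The matrix \<open>P x\<close> represents the coframe in this
    chart.\<close>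
  define P where "P x = matrix (\<lambda>v. \<Theta> x (of_chart A c x v))" for x
  define W where "W x a = (\<chi> k. det (\<chi> i j. if j = k then a $ i else P x $ i $ j) / det (P x))"
    for x and a :: "real^4"
  have lin: "linear (\<lambda>v. \<Theta> x (of_chart A c x v))" and inj: "inj (\<lambda>v. \<Theta> x (of_chart A c x v))"
    if "x \<in> fst c \<inter> S" for x
    using that linear_compose[OF of_chart_linear_bij(1)[OF atlas c] \<Theta>_linear]
      inj_compose[OF bij_is_inj[OF \<Theta>_bij] bij_is_inj[OF of_chart_linear_bij(2)[OF atlas c]]]
    by (auto simp: comp_def)
  have det: "det (P x) \<noteq> 0" if "x \<in> fst c \<inter> S" for x
    using det_nz_iff_inj[OF lin[OF that]] inj[OF that] by (simp add: P_def)
  have P: "P x $ i $ j = \<Theta> x (of_chart A c x (axis j 1)) $ i" for x i j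
    by (simp add: P_def matrix_def)
  have contP: "continuous_on ((fst c \<inter> S) \<times> (UNIV :: (real^4) set)) (\<lambda>q. P (fst q) $ i $ j)" for i j
    unfolding P
    by (intro continuous_intros continuous_on_compose2[OF continuous_on_\<Theta>_in_chart[OF c],
          of _ "\<lambda>q. (fst q, axis j 1)", simplified]) auto
  have "continuous_on ((fst c \<inter> S) \<times> UNIV) (\<lambda>q. W (fst q) (snd q))"
    unfolding W_def
  proof (intro continuous_on_vec_lambda continuous_on_divide ballI)
    fix k
    have *: "continuous_on ((fst c \<inter> S) \<times> (UNIV :: (real^4) set))
        (\<lambda>q. (\<chi> i j. if j = k then snd q $ i else P (fst q) $ i $ j) $ i $ j)" for i j
      by (cases "j = k") (auto intro!: continuous_intros contP)
    show "continuous_on ((fst c \<inter> S) \<times> UNIV)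
        (\<lambda>q. det (\<chi> i j. if j = k then snd q $ i else P (fst q) $ i $ j))"
      by (rule continuous_on_det[OF *])
    show "continuous_on ((fst c \<inter> S) \<times> (UNIV :: (real^4) set)) (\<lambda>q. det (P (fst q)))"
      by (rule continuous_on_det[OF contP])
  qed (use det in auto)
  moreover have "of_chart A c x (W x a) = frame x a" if x: "x \<in> fst c \<inter> S" for x a
  proof -
    have "P x *v W x a = a"
      using cramer[OF det[OF x]] unfolding W_def by blast
    then have "\<Theta> x (of_chart A c x (W x a)) = a"
      unfolding P_def using fun_cong[OF matrix_vector_mul(2)[OF lin[OF x]], of "W x a"] by simp
    then show ?thesis using frame_\<Theta>[of x "of_chart A c x (W x a)"] x by simp
  qed
  ultimately show thesis using that by blast
qed

end

section \<open>The bundle of null directions\<close>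

text \<open>The light cone without its vertex, in frame components: \<open>g x v v\<close> is twice
  the difference of the two sides.\<close>

definition null_cone :: "(real^4) set" where
  "null_cone = {a. a \<noteq> 0 \<and> (a $ 1)^2 + (a $ 2)^2 = a $ 3 * a $ 4}"

lemma span_singleton_eq_iff:
  fixes a b :: "'v::real_vector"
  assumes "a \<noteq> 0"
  shows "span {a} = span {b} \<longleftrightarrow> (\<exists>t. a = t *\<^sub>R b)"
proof
  assume "span {a} = span {b}"
  then have "a \<in> span {b}" using span_base[of a "{a}"] by simp
  then show "\<exists>t. a = t *\<^sub>R b" by (auto simp: span_singleton)
next
  assume "\<exists>t. a = t *\<^sub>R b"
  then obtain t where t: "a = t *\<^sub>R b" "t \<noteq> 0" using assms by auto
  then have b: "b = (1 / t) *\<^sub>R a" by simp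
  show "span {a} = span {b}"
  proof
    show "span {a} \<subseteq> span {b}" unfolding t(1) by (auto simp: span_singleton)
    show "span {b} \<subseteq> span {a}" by (subst b) (auto simp: span_singleton)
  qed
qed

context null_framed
begin

lemma null_iff:
  assumes "x \<in> S"
  shows "v \<noteq> 0 \<and> g x v v = 0 \<longleftrightarrow> \<Theta> x v \<in> null_cone"
proof -
  have "\<Theta> x v = 0 \<longleftrightarrow> v = 0"
    using frame_\<Theta>[OF assms, of v] linear_0[OF frame_linear[OF assms]] linear_0[OF \<Theta>_linear[OF assms]] by metis
  moreover have "g x v v = 2 * ((\<Theta> x v $ 1)^2 + (\<Theta> x v $ 2)^2 - \<Theta> x v $ 3 * \<Theta> x v $ 4)"
    unfolding metric_coords[OF assms] by (simp add: power2_eq_square)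
  ultimately show ?thesis unfolding null_cone_def by auto
qed

text \<open>Together with \<open>open_coords_of_tangent_bundle\<close>, this makes \<Theta> a
  trivialization of the tangent bundle over \<open>S\<close>, a homeomorphism onto
  \<open>S \<times> real^4\<close>.\<close>

lemma openin_tangent_bundle_of_coords:
  assumes "open Q"
  shows "openin (tangent_bundle A) {(x, v). x \<in> S \<and> (x, \<Theta> x v) \<in> Q}"
  unfolding openin_tangent_bundle[OF atlas]
proof
  fix c assume c: "c \<in> A"
  have "{(x, v). x \<in> fst c \<and> (x, of_chart A c x v) \<in> {(x, v). x \<in> S \<and> (x, \<Theta> x v) \<in> Q}} =
    ((fst c \<inter> S) \<times> UNIV) \<inter> (\<lambda>q. (fst q, \<Theta> (fst q) (of_chart A c (fst q) (snd q)))) -` Q"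
    by auto
  moreover have "open \<dots>"
    using atlas_chart(1)[OF atlas c] open_S assms
    by (intro continuous_open_preimage continuous_intros continuous_on_\<Theta>_in_chart[OF c] open_Times open_Int) auto
  ultimately show "open {(x, v). x \<in> fst c \<and> (x, of_chart A c x v) \<in> {(x, v). x \<in> S \<and> (x, \<Theta> x v) \<in> Q}}"
    by simp
qed

lemma open_coords_of_tangent_bundle:
  assumes V: "openin (tangent_bundle A) V"
  shows "open {(x, a). x \<in> S \<and> (x, frame x a) \<in> V}"
proof -
  have "open {(x, a). x \<in> fst c \<inter> S \<and> (x, frame x a) \<in> V}" if c: "c \<in> A" for c
  proof -
    obtain W where W: "continuous_on ((fst c \<inter> S) \<times> UNIV) (\<lambda>q. W (fst q) (snd q))"
      "\<And>x a. x \<in> fst c \<inter> S \<Longrightarrow> of_chart A c x (W x a) = frame x a"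
      by (rule frame_in_chart[OF c]) (rule that)
    let ?O = "{(x, v). x \<in> fst c \<and> (x, of_chart A c x v) \<in> V}"
    have "open ?O" using V c openin_tangent_bundle[OF atlas] by blast
    then have "open (((fst c \<inter> S) \<times> UNIV) \<inter> (\<lambda>q. (fst q, W (fst q) (snd q))) -` ?O)"
      using atlas_chart(1)[OF atlas c] open_S
      by (intro continuous_open_preimage continuous_intros W(1) open_Times open_Int) auto
    moreover have "((fst c \<inter> S) \<times> UNIV) \<inter> (\<lambda>q. (fst q, W (fst q) (snd q))) -` ?O =
      {(x, a). x \<in> fst c \<inter> S \<and> (x, frame x a) \<in> V}"
      using W(2) by auto
    ultimately show ?thesis by simp
  qed
  then have "open (\<Union>c\<in>A. {(x, a). x \<in> fst c \<inter> S \<and> (x, frame x a) \<in> V})" by blast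
  moreover have "(\<Union>c\<in>A. {(x, a). x \<in> fst c \<inter> S \<and> (x, frame x a) \<in> V}) = {(x, a). x \<in> S \<and> (x, frame x a) \<in> V}"
    using chart_at_mem[OF atlas] by auto
  ultimately show ?thesis by simp
qed

text \<open>In frame components the bundle of null directions is the quotient of \<open>S \<times> null_cone\<close>.\<close>

lemma openin_Pnull:
  "openin (Pnull A g S) V \<longleftrightarrow> V \<subseteq> (\<lambda>(x, a). (x, span {frame x a})) ` (S \<times> null_cone) \<and>
     openin (top_of_set (S \<times> null_cone)) {(x, a) \<in> S \<times> null_cone. (x, span {frame x a}) \<in> V}"
proof -
  let ?N = "{(x, v). x \<in> S \<and> v \<noteq> 0 \<and> g x v v = 0}"
  let ?\<pi> = "\<lambda>(x, v :: real^4). (x, span {v})"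
  have N: "?N = {(x, v). x \<in> S \<and> \<Theta> x v \<in> null_cone}"
    using null_iff by blast
  have top: "topspace (subtopology (tangent_bundle A) ?N) = {(x, v). x \<in> S \<and> \<Theta> x v \<in> null_cone}"
    unfolding N by (simp add: topspace_subtopology topspace_tangent_bundle[OF atlas])
  have img: "?\<pi> ` {(x, v). x \<in> S \<and> \<Theta> x v \<in> null_cone} =
    (\<lambda>(x, a). (x, span {frame x a})) ` (S \<times> null_cone)"
  proof (intro equalityI subsetI)
    fix p assume "p \<in> ?\<pi> ` {(x, v). x \<in> S \<and> \<Theta> x v \<in> null_cone}"
    then obtain x v where "p = (x, span {v})" "x \<in> S" "\<Theta> x v \<in> null_cone" by auto
    then have "p = (\<lambda>(x, a). (x, span {frame x a})) (x, \<Theta> x v)" "(x, \<Theta> x v) \<in> S \<times> null_cone" by auto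
    then show "p \<in> (\<lambda>(x, a). (x, span {frame x a})) ` (S \<times> null_cone)" by (rule image_eqI)
  next
    fix p assume "p \<in> (\<lambda>(x, a). (x, span {frame x a})) ` (S \<times> null_cone)"
    then obtain x a where p: "p = (x, span {frame x a})" "x \<in> S" "a \<in> null_cone" by auto
    then have "p = ?\<pi> (x, frame x a)" "(x, frame x a) \<in> {(x, v). x \<in> S \<and> \<Theta> x v \<in> null_cone}" by auto
    then show "p \<in> ?\<pi> ` {(x, v). x \<in> S \<and> \<Theta> x v \<in> null_cone}" by (rule image_eqI)
  qed
  let ?V = "{p \<in> {(x, v). x \<in> S \<and> \<Theta> x v \<in> null_cone}. ?\<pi> p \<in> V}"
  let ?W = "{(x, a) \<in> S \<times> null_cone. (x, span {frame x a}) \<in> V}"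
  have "openin (subtopology (tangent_bundle A) ?N) ?V \<longleftrightarrow> openin (top_of_set (S \<times> null_cone)) ?W"
  proof
    assume "openin (subtopology (tangent_bundle A) ?N) ?V"
    then obtain Q where Q: "openin (tangent_bundle A) Q" "?V = Q \<inter> ?N" by (auto simp: openin_subtopology)
    have "?W = (S \<times> null_cone) \<inter> {(x, a). x \<in> S \<and> (x, frame x a) \<in> Q}"
    proof -
      have "(x, span {frame x a}) \<in> V \<longleftrightarrow> (x, frame x a) \<in> Q" if "x \<in> S" "a \<in> null_cone" for x a
      proof -
        have "(x, frame x a) \<in> ?V \<longleftrightarrow> (x, frame x a) \<in> Q \<inter> ?N" using Q(2) by simp
        moreover have "(x, frame x a) \<in> ?N" using that unfolding N by simp
        ultimately show ?thesis using that by simp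
      qed
      then show ?thesis by auto
    qed
    then show "openin (top_of_set (S \<times> null_cone)) ?W"
      using open_coords_of_tangent_bundle[OF Q(1)] by (simp add: openin_open_Int)
  next
    assume "openin (top_of_set (S \<times> null_cone)) ?W"
    then obtain Q where Q: "open Q" "?W = (S \<times> null_cone) \<inter> Q" by (auto simp: openin_open)
    have "?V = {(x, v). x \<in> S \<and> (x, \<Theta> x v) \<in> Q} \<inter> ?N"
    proof -
      have "(x, span {v}) \<in> V \<longleftrightarrow> (x, \<Theta> x v) \<in> Q" if "x \<in> S" "\<Theta> x v \<in> null_cone" for x v
      proof -
        have "(x, \<Theta> x v) \<in> ?W \<longleftrightarrow> (x, \<Theta> x v) \<in> (S \<times> null_cone) \<inter> Q" using Q(2) by simp
        then show ?thesis using that by simp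
      qed
      then show ?thesis unfolding N by auto
    qed
    then show "openin (subtopology (tangent_bundle A) ?N) ?V"
      using openin_tangent_bundle_of_coords[OF Q(1)] unfolding openin_subtopology by blast
  qed
  then show ?thesis
    unfolding Pnull_def openin_coinduced_topology top img by simp
qed

lemma topspace_Pnull: "topspace (Pnull A g S) = (\<lambda>(x, a). (x, span {frame x a})) ` (S \<times> null_cone)"
proof
  show "topspace (Pnull A g S) \<subseteq> (\<lambda>(x, a). (x, span {frame x a})) ` (S \<times> null_cone)"
    using openin_Pnull[of "topspace (Pnull A g S)"] by simp
  have "{(x, a) \<in> S \<times> null_cone. (x, span {frame x a}) \<in> (\<lambda>(x, a). (x, span {frame x a})) ` (S \<times> null_cone)}
    = S \<times> null_cone" by auto
  then have "openin (Pnull A g S) ((\<lambda>(x, a). (x, span {frame x a})) ` (S \<times> null_cone))"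
    by (subst openin_Pnull) simp
  then show "(\<lambda>(x, a). (x, span {frame x a})) ` (S \<times> null_cone) \<subseteq> topspace (Pnull A g S)"
    by (rule openin_subset)
qed

lemma span_frame_eq_iff:
  assumes "x \<in> S" "a \<in> null_cone"
  shows "span {frame x a} = span {frame x b} \<longleftrightarrow> (\<exists>t. a = t *\<^sub>R b)"
proof -
  have "frame x a \<noteq> 0"
    using \<Theta>_frame[OF assms(1), of a] linear_0[OF \<Theta>_linear[OF assms(1)]] assms(2) by (auto simp: null_cone_def)
  moreover have "frame x a = t *\<^sub>R frame x b \<longleftrightarrow> a = t *\<^sub>R b" for t
    using \<Theta>_frame[OF assms(1)] linear_scale[OF frame_linear[OF assms(1)], of t b] by metis
  ultimately show ?thesis by (simp add: span_singleton_eq_iff)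
qed

text \<open>A continuous normalization \<open>n\<close> of the null vectors in an open cone \<open>Q\<close>, with inverse \<open>\<nu>\<close>,
  parametrizes an open set of null directions.\<close>

lemma direction_chart:
  fixes n :: "'z::topological_space \<Rightarrow> real^4"
  assumes n: "continuous_on Z n" "\<And>z. z \<in> Z \<Longrightarrow> n z \<in> null_cone"
    and \<nu>: "continuous_on (null_cone \<inter> Q) \<nu>" "\<And>a. a \<in> null_cone \<inter> Q \<Longrightarrow> \<nu> a \<in> Z"
    and Q: "open Q"
    and inverse: "\<And>z a. z \<in> Z \<Longrightarrow> a \<in> null_cone \<Longrightarrow> (\<exists>t. a = t *\<^sub>R n z) \<longleftrightarrow> a \<in> Q \<and> \<nu> a = z"
  defines "\<phi> \<equiv> \<lambda>(x, z). (x, span {frame x (n z)})"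
  shows "continuous_map (top_of_set (S \<times> Z)) (Pnull A g S) \<phi>"
    and "open_map (top_of_set (S \<times> Z)) (Pnull A g S) \<phi>"
    and "inj_on \<phi> (S \<times> Z)"
    and "\<phi> ` (S \<times> Z) = (\<lambda>(x, a). (x, span {frame x a})) ` (S \<times> (null_cone \<inter> Q))"
proof -
  have eq: "span {frame x a} = span {frame x (n z)} \<longleftrightarrow> a \<in> Q \<and> \<nu> a = z"
    if "x \<in> S" "a \<in> null_cone" "z \<in> Z" for x a z
    using span_frame_eq_iff[OF that(1,2)] inverse[OF that(3,2)] by simp
  have n_self: "n z \<in> Q \<and> \<nu> (n z) = z" if "z \<in> Z" for z
    using inverse[OF that n(2)[OF that]] scaleR_one[of "n z"] by metis
  show "inj_on \<phi> (S \<times> Z)"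
    using eq n(2) n_self by (auto simp: inj_on_def \<phi>_def)
  show img: "\<phi> ` (S \<times> Z) = (\<lambda>(x, a). (x, span {frame x a})) ` (S \<times> (null_cone \<inter> Q))"
  proof (intro equalityI subsetI)
    fix p assume "p \<in> \<phi> ` (S \<times> Z)"
    then obtain x z where p: "p = (x, span {frame x (n z)})" "x \<in> S" "z \<in> Z" by (auto simp: \<phi>_def)
    have "(x, n z) \<in> S \<times> (null_cone \<inter> Q)" using p n_self n(2) by blast
    then show "p \<in> (\<lambda>(x, a). (x, span {frame x a})) ` (S \<times> (null_cone \<inter> Q))"
      by (rule rev_image_eqI) (simp add: p(1))
  next
    fix p assume "p \<in> (\<lambda>(x, a). (x, span {frame x a})) ` (S \<times> (null_cone \<inter> Q))"
    then obtain x a where p: "p = (x, span {frame x a})" "x \<in> S" "a \<in> null_cone" "a \<in> Q" by auto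
    then have "\<nu> a \<in> Z" using \<nu>(2) by blast
    then have "p = \<phi> (x, \<nu> a)" "(x, \<nu> a) \<in> S \<times> Z" using eq[OF p(2,3)] p by (auto simp: \<phi>_def)
    then show "p \<in> \<phi> ` (S \<times> Z)" by (rule image_eqI)
  qed
  show "continuous_map (top_of_set (S \<times> Z)) (Pnull A g S) \<phi>"
    unfolding continuous_map_def
  proof (intro conjI allI impI)
    have "\<phi> ` (S \<times> Z) \<subseteq> topspace (Pnull A g S)" unfolding img topspace_Pnull by (intro image_mono) auto
    then show "\<phi> \<in> topspace (top_of_set (S \<times> Z)) \<rightarrow> topspace (Pnull A g S)" by auto
    fix V assume "openin (Pnull A g S) V"
    then have V: "openin (top_of_set (S \<times> null_cone)) {(x, a) \<in> S \<times> null_cone. (x, span {frame x a}) \<in> V}"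
      using openin_Pnull by blast
    have "continuous_on (S \<times> Z) (\<lambda>q. (fst q, n (snd q)))"
      by (intro continuous_intros continuous_on_compose2[OF n(1)]) auto
    then have "openin (top_of_set (S \<times> Z)) ((S \<times> Z) \<inter> (\<lambda>q. (fst q, n (snd q))) -`
      {(x, a) \<in> S \<times> null_cone. (x, span {frame x a}) \<in> V})"
      by (rule continuous_openin_preimage[OF _ _ V]) (use n(2) in auto)
    moreover have "(S \<times> Z) \<inter> (\<lambda>q. (fst q, n (snd q))) -` {(x, a) \<in> S \<times> null_cone. (x, span {frame x a}) \<in> V}
      = {q \<in> S \<times> Z. \<phi> q \<in> V}" using n(2) by (auto simp: \<phi>_def)
    ultimately show "openin (top_of_set (S \<times> Z)) {q \<in> topspace (top_of_set (S \<times> Z)). \<phi> q \<in> V}" by simp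
  qed
  show "open_map (top_of_set (S \<times> Z)) (Pnull A g S) \<phi>"
    unfolding open_map_def
  proof (intro allI impI)
    fix W assume W: "openin (top_of_set (S \<times> Z)) W"
    then have sub: "W \<subseteq> S \<times> Z" by (rule openin_imp_subset)
    \<comment> \<open>The preimage of the image is the whole cone over \<open>W\<close>. Normalizing
      by \<nu> describes it as a preimage of \<open>W\<close> itself, hence as an open set.\<close>
    have "{(x, a) \<in> S \<times> null_cone. (x, span {frame x a}) \<in> \<phi> ` W} =
      (S \<times> (null_cone \<inter> Q)) \<inter> (\<lambda>q. (fst q, \<nu> (snd q))) -` W"
    proof -
      have *: "(x, span {frame x a}) \<in> \<phi> ` W \<longleftrightarrow> a \<in> Q \<and> (x, \<nu> a) \<in> W" if "x \<in> S" "a \<in> null_cone" for x a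
      proof
        assume "(x, span {frame x a}) \<in> \<phi> ` W"
        then obtain z where z: "(x, z) \<in> W" "span {frame x a} = span {frame x (n z)}"
          by (auto simp: \<phi>_def)
        then have "z \<in> Z" using sub by blast
        then have "a \<in> Q \<and> \<nu> a = z" using z(2) eq[OF that, of z] by blast
        then show "a \<in> Q \<and> (x, \<nu> a) \<in> W" using z(1) by blast
      next
        assume a: "a \<in> Q \<and> (x, \<nu> a) \<in> W"
        then have "\<nu> a \<in> Z" using sub by blast
        then have "(x, span {frame x a}) = \<phi> (x, \<nu> a)" using eq[OF that] a by (simp add: \<phi>_def)
        then show "(x, span {frame x a}) \<in> \<phi> ` W" using a by blast
      qed
      show ?thesis
      proof (rule set_eqI)
        fix q :: "'m \<times> (real^4)"
        obtain x a where "q = (x, a)" by (cases q)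
        then show "q \<in> {(x, a) \<in> S \<times> null_cone. (x, span {frame x a}) \<in> \<phi> ` W} \<longleftrightarrow>
          q \<in> (S \<times> (null_cone \<inter> Q)) \<inter> (\<lambda>q. (fst q, \<nu> (snd q))) -` W"
          using *[of x a] by (simp del: image_iff) blast
      qed
    qed
    moreover have "openin (top_of_set (S \<times> null_cone)) \<dots>"
    proof (rule openin_trans)
      have "continuous_on (S \<times> (null_cone \<inter> Q)) (\<lambda>q. (fst q, \<nu> (snd q)))"
        by (intro continuous_intros continuous_on_compose2[OF \<nu>(1)]) auto
      then show "openin (top_of_set (S \<times> (null_cone \<inter> Q))) ((S \<times> (null_cone \<inter> Q)) \<inter> (\<lambda>q. (fst q, \<nu> (snd q))) -` W)"
        by (rule continuous_openin_preimage[OF _ _ W]) (use \<nu>(2) in auto)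
      have "S \<times> (null_cone \<inter> Q) = (S \<times> null_cone) \<inter> (UNIV \<times> Q)" by auto
      then show "openin (top_of_set (S \<times> null_cone)) (S \<times> (null_cone \<inter> Q))"
        using Q by (simp add: openin_open_Int open_Times)
    qed
    moreover have "\<phi> ` W \<subseteq> (\<lambda>(x, a). (x, span {frame x a})) ` (S \<times> null_cone)"
    proof -
      have "\<phi> ` W \<subseteq> \<phi> ` (S \<times> Z)" using sub by (rule image_mono)
      also have "\<dots> \<subseteq> (\<lambda>(x, a). (x, span {frame x a})) ` (S \<times> null_cone)"
        unfolding img by (intro image_mono) auto
      finally show ?thesis .
    qed
    ultimately show "openin (Pnull A g S) (\<phi> ` W)" unfolding openin_Pnull by simp
  qed
qed

end

text \<open>The components of \<open>k(z)\<close>, and of its analogue dual to \<open>K(z)\<close>.\<close>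

definition null_vec :: "nat \<Rightarrow> complex \<Rightarrow> real^4" where
  "null_vec i z = (if i = 1 then vector [- Re z, - Im z, 1, (cmod z)^2] else vector [- Re z, Im z, (cmod z)^2, 1])"

text \<open>The entry 1 of \<open>null_vec i z\<close> sits in place 3 or 4; exactly the null
  vectors with this component nonzero can be scaled into family \<open>i\<close>.\<close>

definition null_vec_domain :: "nat \<Rightarrow> (real^4) set" where
  "null_vec_domain i = (if i = 1 then {a. a $ 3 \<noteq> 0} else {a. a $ 4 \<noteq> 0})"

text \<open>After scaling the distinguished component to 1, \<open>z\<close> is read off the
  \<open>M\<close> component. For \<open>i = 2\<close> that component is \<open>- cnj z\<close>,
  because \<open>K(z)\<close> arises from \<open>L(z)\<close> by exchanging \<open>K\<close> with
  \<open>L\<close> and \<open>M\<close> with its conjugate; hence the different sign of the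
  imaginary part.\<close>

definition null_vec_param :: "nat \<Rightarrow> real^4 \<Rightarrow> complex" where
  "null_vec_param i a = (if i = 1 then Complex (- a $ 1 / a $ 3) (- a $ 2 / a $ 3) else Complex (- a $ 1 / a $ 4) (a $ 2 / a $ 4))"

lemma continuous_on_vector_4:
  fixes f1 f2 f3 f4 :: "'z::topological_space \<Rightarrow> real"
  assumes "continuous_on Z f1" "continuous_on Z f2" "continuous_on Z f3" "continuous_on Z f4"
  shows "continuous_on Z (\<lambda>z. vector [f1 z, f2 z, f3 z, f4 z] :: real^4)"
proof -
  have "continuous_on Z (\<lambda>z. (vector [f1 z, f2 z, f3 z, f4 z] :: real^4) $ i)" for i
    using exhaust_4[of i] assms by (auto simp: vector_def)
  then show ?thesis
    using continuous_on_vec_lambda[of Z "\<lambda>i z. (vector [f1 z, f2 z, f3 z, f4 z] :: real^4) $ i"] by simp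
qed

lemma vector_4_nth [simp]:
  "(vector [a, b, c, d] :: real^4) $ 1 = a" "(vector [a, b, c, d] :: real^4) $ 2 = b"
  "(vector [a, b, c, d] :: real^4) $ 3 = c" "(vector [a, b, c, d] :: real^4) $ 4 = d"
  by (simp_all add: vector_def)

lemma null_vec_cone: "null_vec i z \<in> null_cone"
proof -
  have "(vector [a, b, c, 1] :: real^4) \<noteq> 0" "(vector [a, b, 1, c] :: real^4) \<noteq> 0" for a b c
    by (metis vector_4_nth zero_index zero_neq_one)+
  then show ?thesis by (auto simp: null_cone_def null_vec_def cmod_power2)
qed

lemma continuous_on_null_vec: "continuous_on UNIV (null_vec i)"
  unfolding null_vec_def[abs_def]
  by (cases "i = 1") (auto intro!: continuous_on_vector_4 continuous_intros)

lemma open_null_vec_domain: "open (null_vec_domain i)"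
  by (auto simp: null_vec_domain_def intro!: open_Collect_neq continuous_intros)

lemma continuous_on_null_vec_param: "continuous_on (null_cone \<inter> null_vec_domain i) (null_vec_param i)"
  unfolding null_vec_param_def[abs_def] null_vec_domain_def Complex_eq
  by (cases "i = 1") (auto intro!: continuous_intros)

text \<open>The scalar can only be the component normalized to 1. The parts of \<open>z\<close> then
  fix two more components, and the cone equation forces the last one to fit
  \<open>(cmod z)^2\<close>.\<close>

lemma null_vec_inverse:
  assumes "a \<in> null_cone"
  shows "(\<exists>t. a = t *\<^sub>R null_vec i z) \<longleftrightarrow> a \<in> null_vec_domain i \<and> null_vec_param i a = z"
proof
  assume "\<exists>t. a = t *\<^sub>R null_vec i z"
  then obtain t where t: "a = t *\<^sub>R null_vec i z" "t \<noteq> 0" using assms by (auto simp: null_cone_def)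
  then show "a \<in> null_vec_domain i \<and> null_vec_param i a = z"
    by (auto simp: null_vec_def null_vec_domain_def null_vec_param_def complex_eq_iff)
next
  assume a: "a \<in> null_vec_domain i \<and> null_vec_param i a = z"
  have cone: "(a $ 1)^2 + (a $ 2)^2 = a $ 3 * a $ 4" using assms by (simp add: null_cone_def)
  show "\<exists>t. a = t *\<^sub>R null_vec i z"
  proof (cases "i = 1")
    case True
    then have z: "a $ 3 \<noteq> 0" "Re z = - a $ 1 / a $ 3" "Im z = - a $ 2 / a $ 3"
      using a by (auto simp: null_vec_domain_def null_vec_param_def)
    have "a $ 3 * (cmod z)^2 = a $ 4"
      unfolding cmod_power2 z(2,3) using z(1) cone by (simp add: power_divide add_divide_distrib[symmetric] power2_eq_square)
    then have "a = a $ 3 *\<^sub>R null_vec i z"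
      using True z by (simp add: vec_eq_iff forall_4 null_vec_def)
    then show ?thesis by blast
  next
    case False
    then have z: "a $ 4 \<noteq> 0" "Re z = - a $ 1 / a $ 4" "Im z = a $ 2 / a $ 4"
      using a by (auto simp: null_vec_domain_def null_vec_param_def)
    have "a $ 4 * (cmod z)^2 = a $ 3"
      unfolding cmod_power2 z(2,3) using z(1) cone by (simp add: power_divide add_divide_distrib[symmetric] power2_eq_square)
    then have "a = a $ 4 *\<^sub>R null_vec i z"
      using False z by (simp add: vec_eq_iff forall_4 null_vec_def)
    then show ?thesis by blast
  qed
qed

lemma null_vec_overlap:
  "null_vec 2 z' \<in> null_vec_domain 1 \<and> null_vec_param 1 (null_vec 2 z') = z \<longleftrightarrow> z \<noteq> 0 \<and> z' = 1 / z"
proof -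
  \<comment> \<open>The left side is \<open>cnj z' / (cmod z')^2\<close>. The equation holds even at
    \<open>z' = 0\<close>, where both sides are 0 by the convention on division; the domain
    condition excludes that point separately.\<close>
  have "null_vec_param 1 (null_vec 2 z') = 1 / z'"
    by (simp add: null_vec_param_def null_vec_def complex_eq_iff cmod_power2 Re_divide Im_divide)
  moreover have "null_vec 2 z' \<in> null_vec_domain 1 \<longleftrightarrow> z' \<noteq> 0"
    by (simp add: null_vec_domain_def null_vec_def)
  ultimately show ?thesis by auto
qed

lemma null_cone_domains: "null_cone \<subseteq> null_vec_domain 1 \<union> null_vec_domain 2"
  by (auto simp: null_cone_def null_vec_domain_def vec_eq_iff forall_4)

section \<open>The two families of null directions as charts\<close>

context null_framed
begin

definition direction :: "nat \<Rightarrow> 'm \<times> complex \<Rightarrow> 'm \<times> (real^4) set" where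
  "direction i = (if i = 1 then dir_chart1 g \<theta> else dir_chart2 g \<theta>)"

text \<open>Nondegeneracy makes the vector dual to a given form unique, so each real factor
  \<open>r\<close> yields exactly one vector.\<close>

lemma dual_line_eq_span:
  assumes x: "x \<in> S" and b: "\<And>v. complex_of_real (g x b v) = - \<alpha> x v"
  shows "dual_line g \<alpha> x = span {b}"
proof -
  have bil: "bilinear (g x)" using metric unfolding lorentzian_metric_def by blast
  have "(\<forall>v. complex_of_real (g x k v) = - complex_of_real r * \<alpha> x v) \<longleftrightarrow> k = r *\<^sub>R b" for k r
  proof -
    have "- complex_of_real r * \<alpha> x v = complex_of_real (g x (r *\<^sub>R b) v)" for v
      using b[of v] bilinear_lmul[OF bil, of r b v] by simp
    then have "(\<forall>v. complex_of_real (g x k v) = - complex_of_real r * \<alpha> x v) \<longleftrightarrow>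
      (\<forall>v. g x k v = g x (r *\<^sub>R b) v)" by simp
    also have "\<dots> \<longleftrightarrow> (\<forall>v. g x (k - r *\<^sub>R b) v = 0)"
      using bilinear_lsub[OF bil, of k "r *\<^sub>R b"] by simp
    also have "\<dots> \<longleftrightarrow> k = r *\<^sub>R b"
      using lorentzian_nondegenerate[OF metric, of x "k - r *\<^sub>R b"] bilinear_lzero[OF bil] by auto
    finally show ?thesis .
  qed
  then show ?thesis by (auto simp: dual_line_def span_singleton)
qed

lemma dir_eq_span:
  assumes x: "x \<in> S"
  shows "dir1 g \<theta> x z = span {frame x (null_vec 1 z)}" "dir2 g \<theta> x z = span {frame x (null_vec 2 z)}"
proof -
  have "complex_of_real (g x (frame x (null_vec 1 z)) v) = - Lform \<theta> z x v"
    and "complex_of_real (g x (frame x (null_vec 2 z)) v) = - Kform \<theta> z x v" for v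
    unfolding metric_coords[OF x] \<Theta>_frame[OF x] Lform_def Kform_def coframe_components[OF x]
      complex_mult_cnj null_vec_def cmod_power2
    by (simp_all add: complex_eq_iff algebra_simps del: frame_coords_nth)
  then show "dir1 g \<theta> x z = span {frame x (null_vec 1 z)}" "dir2 g \<theta> x z = span {frame x (null_vec 2 z)}"
    unfolding dir1_def dir2_def by (auto intro!: dual_line_eq_span[OF x])
qed

lemma direction_eq:
  assumes "x \<in> S" "i \<in> {1, 2}"
  shows "direction i (x, z) = (x, span {frame x (null_vec i z)})"
  using assms by (auto simp: direction_def dir_chart1_def dir_chart2_def dir_eq_span)

lemma direction_chart_maps:
  assumes i: "i \<in> {1, 2}"
  shows "continuous_map (top_of_set (S \<times> UNIV)) (Pnull A g S) (direction i)"
    and "open_map (top_of_set (S \<times> UNIV)) (Pnull A g S) (direction i)"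
    and "inj_on (direction i) (S \<times> UNIV)"
    and "direction i ` (S \<times> UNIV) = (\<lambda>(x, a). (x, span {frame x a})) ` (S \<times> (null_cone \<inter> null_vec_domain i))"
proof -
  note chart = direction_chart[OF continuous_on_null_vec null_vec_cone continuous_on_null_vec_param UNIV_I
      open_null_vec_domain null_vec_inverse, of i]
  \<comment> \<open>\<open>direction\<close> is defined by dual lines and is identified with the
    description by frames over \<open>S\<close>, so the conclusions are transferred on subsets of
    \<open>S \<times> UNIV\<close>.\<close>
  have eq: "(\<lambda>(x, z). (x, span {frame x (null_vec i z)})) p = direction i p" if "p \<in> S \<times> UNIV" for p
    using that direction_eq[OF _ i] by auto
  show "continuous_map (top_of_set (S \<times> UNIV)) (Pnull A g S) (direction i)"
    by (rule continuous_map_eq[OF chart(1)]) (use eq in auto)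
  have img: "(\<lambda>(x, z). (x, span {frame x (null_vec i z)})) ` W = direction i ` W" if "W \<subseteq> S \<times> UNIV" for W
    using that eq by (intro image_cong) auto
  show "open_map (top_of_set (S \<times> UNIV)) (Pnull A g S) (direction i)"
    unfolding open_map_def
  proof (intro allI impI)
    fix W :: "('m \<times> complex) set" assume W: "openin (top_of_set (S \<times> UNIV)) W"
    then have "openin (Pnull A g S) ((\<lambda>(x, z). (x, span {frame x (null_vec i z)})) ` W)"
      using chart(2) unfolding open_map_def by blast
    then show "openin (Pnull A g S) (direction i ` W)"
      by (simp only: img[OF openin_imp_subset[OF W]])
  qed
  show "inj_on (direction i) (S \<times> UNIV)"
    by (rule iffD1[OF inj_on_cong chart(3)]) (rule eq)
  show "direction i ` (S \<times> UNIV) = (\<lambda>(x, a). (x, span {frame x a})) ` (S \<times> (null_cone \<inter> null_vec_domain i))"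
    using chart(4) img[of "S \<times> UNIV"] by simp
qed

lemma directions_cover: "topspace (Pnull A g S) = direction 1 ` (S \<times> UNIV) \<union> direction 2 ` (S \<times> UNIV)"
proof -
  have split: "S \<times> null_cone = S \<times> (null_cone \<inter> null_vec_domain 1) \<union> S \<times> (null_cone \<inter> null_vec_domain 2)"
    using null_cone_domains by auto
  have "direction i ` (S \<times> UNIV) = (\<lambda>(x, a). (x, span {frame x a})) ` (S \<times> (null_cone \<inter> null_vec_domain i))"
    if "i = 1 \<or> i = 2" for i
    using that by (intro direction_chart_maps(4)) auto
  then show ?thesis
    unfolding topspace_Pnull split image_Un by simp
qed

lemma dir1_eq_dir2_iff:
  assumes x: "x \<in> S"
  shows "dir1 g \<theta> x z = dir2 g \<theta> x z' \<longleftrightarrow> z \<noteq> 0 \<and> z' = 1 / z"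
proof -
  have "dir1 g \<theta> x z = dir2 g \<theta> x z' \<longleftrightarrow> span {frame x (null_vec 2 z')} = span {frame x (null_vec 1 z)}"
    unfolding dir_eq_span[OF x] by auto
  also have "\<dots> \<longleftrightarrow> null_vec 2 z' \<in> null_vec_domain 1 \<and> null_vec_param 1 (null_vec 2 z') = z"
    using span_frame_eq_iff[OF x null_vec_cone] null_vec_inverse[OF null_vec_cone] by simp
  finally show ?thesis using null_vec_overlap by simp
qed

lemma directions_overlap:
  assumes "x \<in> S" "y \<in> S"
  shows "direction 1 (x, z) = direction 2 (y, z') \<longleftrightarrow> x = y \<and> z \<noteq> 0 \<and> z' = 1 / z"
  using dir1_eq_dir2_iff[OF assms(1)] by (auto simp: direction_def dir_chart1_def dir_chart2_def)

section \<open>The sphere of null directions at a point\<close>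

definition sphere_vec :: "real^3 \<Rightarrow> real^4" where
  "sphere_vec s = vector [s $ 1 / 2, s $ 2 / 2, (1 + s $ 3) / 2, (1 - s $ 3) / 2]"

text \<open>On the cone, \<open>(2 * a $ 1)^2 + (2 * a $ 2)^2 + (a $ 3 - a $ 4)^2 = (a $ 3 + a $
  4)^2\<close>; dividing by the right side gives the celestial sphere. \<open>sphere_vec\<close>
  picks the null vector with \<open>a $ 3 + a $ 4 = 1\<close>.\<close>

definition sphere_param :: "real^4 \<Rightarrow> real^3" where
  "sphere_param a = (1 / (a $ 3 + a $ 4)) *\<^sub>R vector [2 * a $ 1, 2 * a $ 2, a $ 3 - a $ 4]"

lemma unit_sphere_3: "s \<in> sphere 0 1 \<longleftrightarrow> (s $ 1)^2 + (s $ 2)^2 + (s $ 3)^2 = 1" for s :: "real^3"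
  by (simp add: norm_eq_1 inner_vec_def sum_3 power2_eq_square)

lemma null_cone_trace_nonzero:
  assumes "a \<in> null_cone"
  shows "a $ 3 + a $ 4 \<noteq> 0"
proof
  assume *: "a $ 3 + a $ 4 = 0"
  then have "a $ 4 = - a $ 3" by simp
  then have "(a $ 1)^2 + (a $ 2)^2 + (a $ 3)^2 = 0" using assms by (simp add: null_cone_def power2_eq_square)
  then have "a $ 1 = 0" "a $ 2 = 0" "a $ 3 = 0" by (auto simp: add_nonneg_eq_0_iff)
  then have "a = 0" using * by (simp add: vec_eq_iff forall_4)
  then show False using assms by (simp add: null_cone_def)
qed

text \<open>Unlike the charts in \<open>z\<close>, this normalization covers the whole cone, so it
  yields a homeomorphism of \<open>S\<close> times the sphere with the entire bundle, which is then
  restricted to the point \<open>x\<close>.\<close>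

lemma fibre_Pnull_sphere:
  assumes x: "x \<in> S"
  shows "subtopology (Pnull A g S) ({x} \<times> UNIV) homeomorphic_space top_of_set (sphere (0 :: real^3) 1)"
proof -
  let ?Z = "sphere (0 :: real^3) 1"
  let ?\<phi> = "\<lambda>(x, s). (x, span {frame x (sphere_vec s)})"
  have n: "continuous_on ?Z sphere_vec"
    unfolding sphere_vec_def[abs_def] by (intro continuous_on_vector_4 continuous_intros) auto
  have n_cone: "sphere_vec s \<in> null_cone" if "s \<in> ?Z" for s
  proof -
    have "sphere_vec s $ 3 + sphere_vec s $ 4 = 1" by (simp add: sphere_vec_def field_simps)
    then have "sphere_vec s \<noteq> 0" by auto
    moreover have "(sphere_vec s $ 1)^2 + (sphere_vec s $ 2)^2 = sphere_vec s $ 3 * sphere_vec s $ 4"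
      using that unfolding unit_sphere_3 by (simp add: sphere_vec_def power2_eq_square field_simps)
    ultimately show ?thesis by (simp add: null_cone_def)
  qed
  have components: "sphere_param a $ 1 = 2 * a $ 1 / (a $ 3 + a $ 4)"
    "sphere_param a $ 2 = 2 * a $ 2 / (a $ 3 + a $ 4)"
    "sphere_param a $ 3 = (a $ 3 - a $ 4) / (a $ 3 + a $ 4)" for a
    by (simp_all add: sphere_param_def)
  have "continuous_on null_cone (\<lambda>a. sphere_param a $ i)" for i
  proof -
    have "continuous_on null_cone (\<lambda>a. sphere_param a $ 1)" "continuous_on null_cone (\<lambda>a. sphere_param a $ 2)"
      "continuous_on null_cone (\<lambda>a. sphere_param a $ 3)"
      unfolding components by (intro continuous_intros; use null_cone_trace_nonzero in blast)+
    then show ?thesis using exhaust_3[of i] by auto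
  qed
  then have \<nu>: "continuous_on (null_cone \<inter> UNIV) sphere_param"
    using continuous_on_vec_lambda[of null_cone "\<lambda>i a. sphere_param a $ i"] by simp
  have \<nu>_Z: "sphere_param a \<in> ?Z" if "a \<in> null_cone \<inter> UNIV" for a
  proof -
    have "(2 * a $ 1)^2 + (2 * a $ 2)^2 + (a $ 3 - a $ 4)^2 = (a $ 3 + a $ 4)^2"
      using that by (simp add: null_cone_def power2_eq_square algebra_simps)
    then show ?thesis
      unfolding unit_sphere_3 sphere_param_def using null_cone_trace_nonzero[of a] that
      by (simp add: power_divide add_divide_distrib[symmetric])
  qed
  have inverse: "(\<exists>t. a = t *\<^sub>R sphere_vec s) \<longleftrightarrow> a \<in> UNIV \<and> sphere_param a = s"
    if s: "s \<in> ?Z" and a: "a \<in> null_cone" for a s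
  proof
    assume "\<exists>t. a = t *\<^sub>R sphere_vec s"
    then obtain t where t: "a = t *\<^sub>R sphere_vec s" "t \<noteq> 0" using a by (auto simp: null_cone_def)
    then show "a \<in> UNIV \<and> sphere_param a = s"
      by (simp add: sphere_param_def sphere_vec_def vec_eq_iff forall_3 field_simps)
  next
    assume "a \<in> UNIV \<and> sphere_param a = s"
    then have "s $ 1 = 2 * a $ 1 / (a $ 3 + a $ 4)" "s $ 2 = 2 * a $ 2 / (a $ 3 + a $ 4)"
      "s $ 3 = (a $ 3 - a $ 4) / (a $ 3 + a $ 4)" using components by auto
    then have "a = (a $ 3 + a $ 4) *\<^sub>R sphere_vec s"
      using null_cone_trace_nonzero[OF a] by (simp add: sphere_vec_def vec_eq_iff forall_4 field_simps)
    then show "\<exists>t. a = t *\<^sub>R sphere_vec s" by blast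
  qed
  note chart = direction_chart[OF n n_cone \<nu> \<nu>_Z open_UNIV inverse]
  have "homeomorphic_map (top_of_set (S \<times> ?Z)) (Pnull A g S) ?\<phi>"
    by (rule bijective_open_imp_homeomorphic_map[OF chart(1,2)])
       (use chart(3,4) topspace_Pnull in simp_all)
  then have h: "homeomorphic_map (subtopology (top_of_set (S \<times> ?Z)) ({x} \<times> UNIV))
      (subtopology (Pnull A g S) ({x} \<times> UNIV)) ?\<phi>"
    by (rule homeomorphic_map_subtopologies_alt) auto
  have sub: "subtopology (top_of_set (S \<times> ?Z)) ({x} \<times> UNIV) = top_of_set ({x} \<times> ?Z)"
    using x by (simp add: subtopology_subtopology Times_Int_Times)
  have 1: "top_of_set ({x} \<times> ?Z) homeomorphic_space subtopology (Pnull A g S) ({x} \<times> UNIV)"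
    using homeomorphic_map_imp_homeomorphic_space[OF h] by (simp only: sub)
  have 2: "top_of_set ({x} \<times> ?Z) homeomorphic_space top_of_set ?Z"
    unfolding homeomorphic_space_def homeomorphic_maps_def
    by (intro exI[of _ snd] exI[of _ "\<lambda>s. (x, s)"]) (auto intro!: continuous_intros)
  show ?thesis by (rule homeomorphic_space_trans[OF homeomorphic_space_sym[THEN iffD1, OF 1] 2])
qed

end

section \<open>Continuity of the Weyl coefficients\<close>

lemma linear_times_left:
  fixes f :: "'v::real_vector \<Rightarrow> 'a::real_algebra"
  assumes "linear f"
  shows "linear (\<lambda>v. c * f v)"
  using assms by (auto intro!: linearI simp: linear_add linear_scale algebra_simps)

context null_framed
begin

lemma curv_low_bilinear:
  assumes "x \<in> S"
  shows "linear (\<lambda>v. curv_low \<theta> Riem k i x v w)" "linear (\<lambda>w. curv_low \<theta> Riem k i x v w)"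
proof -
  have "linear (\<lambda>v. wedge (\<theta> m) (\<theta> j) x v w)" "linear (\<lambda>w. wedge (\<theta> m) (\<theta> j) x v w)" for m j v w
    using coframe_linear[OF assms, of m] coframe_linear[OF assms, of j]
    by (auto intro!: linearI simp: wedge_def linear_add linear_scale algebra_simps)
  then show "linear (\<lambda>v. curv_low \<theta> Riem k i x v w)" "linear (\<lambda>w. curv_low \<theta> Riem k i x v w)"
    unfolding curv_low_def curv_def by (intro linear_compose_sum ballI linear_times_left; blast)+
qed

text \<open>\<open>Riem\<close> comes with no regularity of its own. The structure equation
  expresses the curvature by first derivatives and products of the smooth connection forms, and
  these are continuous.\<close>

lemma continuous_on_curv_in_chart:
  assumes conn: "connection_forms A S \<theta> \<Gamma>" and curv: "curvature_components A S \<theta> \<Gamma> Riem"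
    and c: "c \<in> A"
  shows "continuous_on (fst c \<inter> S) (\<lambda>x. curv \<theta> Riem k i x (of_chart A c x v) (of_chart A c x w))"
proof -
  have \<Gamma>: "smooth_form A S (\<Gamma> k i)" for k i using conn unfolding connection_forms_def by blast
  have d: "continuous_on (fst c \<inter> S) (\<lambda>x. frechet_derivative (form_coeff A c (\<Gamma> k i) w) (at (snd c x)) v)" for v w
  proof -
    have "Ck_on 1 (snd c ` (fst c \<inter> S)) (form_coeff A c (\<Gamma> k i) w)"
      using \<Gamma>[of k i] c unfolding smooth_form_def smooth_on_def by blast
    then have "continuous_on (snd c ` (fst c \<inter> S)) (\<lambda>u. frechet_derivative (form_coeff A c (\<Gamma> k i) w) (at u) v)"
      by simp
    moreover have "continuous_on (fst c \<inter> S) (snd c)"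
      using homeomorphism_cont1[OF atlas_chart(3)[OF atlas c]] by (rule continuous_on_subset) auto
    ultimately show ?thesis by (rule continuous_on_compose2) auto
  qed
  have \<Gamma>c: "continuous_on (fst c \<inter> S) (\<lambda>x. \<Gamma> k i x (of_chart A c x v))" for k i v
    using continuous_on_compose2[OF continuous_on_form_in_chart[OF \<Gamma> c], of "fst c \<inter> S" "\<lambda>x. (x, v)" k i]
    by (simp add: continuous_on_Pair continuous_on_const image_subset_iff)
  have eq: "curv \<theta> Riem k i x (of_chart A c x v) (of_chart A c x w) =
      frechet_derivative (form_coeff A c (\<Gamma> k i) w) (at (snd c x)) v
      - frechet_derivative (form_coeff A c (\<Gamma> k i) v) (at (snd c x)) w
      + (\<Sum>j\<in>UNIV. wedge (\<Gamma> k j) (\<Gamma> j i) x (of_chart A c x v) (of_chart A c x w))"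
    if x: "x \<in> fst c \<inter> S" for x
  proof -
    have "is_ext_deriv A S (\<Gamma> k i)
        (\<lambda>x v w. curv \<theta> Riem k i x v w - (\<Sum>j\<in>UNIV. wedge (\<Gamma> k j) (\<Gamma> j i) x v w))"
      using curv unfolding curvature_components_def by blast
    then have "curv \<theta> Riem k i x (of_chart A c x v) (of_chart A c x w)
        - (\<Sum>j\<in>UNIV. wedge (\<Gamma> k j) (\<Gamma> j i) x (of_chart A c x v) (of_chart A c x w)) =
      frechet_derivative (form_coeff A c (\<Gamma> k i) w) (at (snd c x)) v
      - frechet_derivative (form_coeff A c (\<Gamma> k i) v) (at (snd c x)) w"
      using c x unfolding is_ext_deriv_def by blast
    then show ?thesis by (simp add: algebra_simps)
  qed
  have "continuous_on (fst c \<inter> S) (\<lambda>x.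
      frechet_derivative (form_coeff A c (\<Gamma> k i) w) (at (snd c x)) v
      - frechet_derivative (form_coeff A c (\<Gamma> k i) v) (at (snd c x)) w
      + (\<Sum>j\<in>UNIV. wedge (\<Gamma> k j) (\<Gamma> j i) x (of_chart A c x v) (of_chart A c x w)))"
    unfolding wedge_def by (intro continuous_on_add continuous_on_diff continuous_on_sum continuous_on_mult d \<Gamma>c)
  then show ?thesis by (subst continuous_on_cong[OF refl eq])
qed

text \<open>Frame vectors vary with the point, whereas the preceding lemma treats constant chart
  components. Bilinearity bridges the gap with the continuous coefficients \<open>W x a\<close>, and
  the charts cover \<open>S\<close> by open sets.\<close>

lemma continuous_on_curv_frame:
  assumes conn: "connection_forms A S \<theta> \<Gamma>" and curv: "curvature_components A S \<theta> \<Gamma> Riem"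
  shows "continuous_on S (\<lambda>x. curv_low \<theta> Riem k i x (frame x a) (frame x b))"
proof -
  have "continuous_on (fst c \<inter> S) (\<lambda>x. curv_low \<theta> Riem k i x (frame x a) (frame x b))" if c: "c \<in> A" for c
  proof -
    obtain W where W: "continuous_on ((fst c \<inter> S) \<times> UNIV) (\<lambda>q. W (fst q) (snd q))"
      "\<And>x a. x \<in> fst c \<inter> S \<Longrightarrow> of_chart A c x (W x a) = frame x a"
      by (rule frame_in_chart[OF c]) (rule that)
    have Wc: "continuous_on (fst c \<inter> S) (\<lambda>x. W x a)" for a
      using continuous_on_compose2[OF W(1), of "fst c \<inter> S" "\<lambda>x. (x, a)"]
      by (simp add: continuous_on_Pair continuous_on_const image_subset_iff)
    define G where "G x v w = curv_low \<theta> Riem k i x (of_chart A c x v) (of_chart A c x w)" for x v w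
    have Gc: "continuous_on (fst c \<inter> S) (\<lambda>x. G x v w)" for v w
      unfolding G_def curv_low_def
      by (intro continuous_on_sum continuous_on_mult continuous_on_const continuous_on_curv_in_chart[OF conn curv c])
    have eq: "curv_low \<theta> Riem k i x (frame x a) (frame x b) =
      (\<Sum>m\<in>UNIV. \<Sum>n\<in>UNIV. (W x a $ m * W x b $ n) *\<^sub>R G x (axis m 1) (axis n 1))"
      if x: "x \<in> fst c \<inter> S" for x
    proof -
      have xc: "x \<in> fst c" "x \<in> S" using x by auto
      note lin = of_chart_linear_bij(1)[OF atlas c xc(1)]
      have lin1: "linear (\<lambda>v. G x v w)" for w
        using linear_compose[OF lin curv_low_bilinear(1)[OF xc(2), of Riem k i "of_chart A c x w"]]
        by (simp add: G_def[abs_def] comp_def)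
      have lin2: "linear (\<lambda>w. G x v w)" for v
        using linear_compose[OF lin curv_low_bilinear(2)[OF xc(2), of Riem k i "of_chart A c x v"]]
        by (simp add: G_def[abs_def] comp_def)
      have basis: "v = (\<Sum>j\<in>UNIV. v $ j *\<^sub>R axis j 1)" for v :: "real^4"
        using basis_expansion[of v] by (simp add: scalar_mult_eq_scaleR)
      have expand: "G x v w = (\<Sum>m\<in>UNIV. \<Sum>n\<in>UNIV. (v $ m * w $ n) *\<^sub>R G x (axis m 1) (axis n 1))" for v w
      proof -
        have "G x v w = (\<Sum>m\<in>UNIV. v $ m *\<^sub>R G x (axis m 1) w)"
          by (subst basis[of v]) (simp add: linear_sum[OF lin1] linear_scale[OF lin1])
        also have "\<dots> = (\<Sum>m\<in>UNIV. \<Sum>n\<in>UNIV. (v $ m * w $ n) *\<^sub>R G x (axis m 1) (axis n 1))"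
        proof (rule sum.cong[OF refl])
          fix m :: 4
          have "G x (axis m 1) w = (\<Sum>n\<in>UNIV. w $ n *\<^sub>R G x (axis m 1) (axis n 1))"
            by (subst basis[of w]) (simp add: linear_sum[OF lin2] linear_scale[OF lin2])
          then show "v $ m *\<^sub>R G x (axis m 1) w = (\<Sum>n\<in>UNIV. (v $ m * w $ n) *\<^sub>R G x (axis m 1) (axis n 1))"
            by (simp add: scaleR_sum_right)
        qed
        finally show ?thesis .
      qed
      show ?thesis using expand[of "W x a" "W x b"] by (simp only: G_def W(2)[OF x])
    qed
    have "continuous_on (fst c \<inter> S)
      (\<lambda>x. \<Sum>m\<in>UNIV. \<Sum>n\<in>UNIV. (W x a $ m * W x b $ n) *\<^sub>R G x (axis m 1) (axis n 1))"
      by (intro continuous_intros Wc Gc)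
    then show ?thesis by (subst continuous_on_cong[OF refl eq])
  qed
  then have "continuous_on (\<Union>c\<in>A. fst c \<inter> S) (\<lambda>x. curv_low \<theta> Riem k i x (frame x a) (frame x b))"
    using atlas_chart(1)[OF atlas] open_S by (intro continuous_on_open_UN) auto
  moreover have "(\<Union>c\<in>A. fst c \<inter> S) = S"
    using chart_at_mem[OF atlas] by blast
  ultimately show ?thesis by simp
qed

lemma \<theta>_frame:
  assumes "x \<in> S"
  shows "\<theta> 1 x (frame x a) = Complex (a $ 1) (a $ 2)" "\<theta> 2 x (frame x a) = Complex (a $ 1) (- (a $ 2))"
    "\<theta> 3 x (frame x a) = of_real (a $ 3)" "\<theta> 4 x (frame x a) = of_real (a $ 4)"
  unfolding coframe_components[OF assms] \<Theta>_frame[OF assms] by simp_all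

text \<open>Pairs of frame vectors isolate one basic two-form each: (4, 1) leaves
  \<open>wedge L M\<close>, (4, 3) leaves \<open>wedge L K\<close>, and (1, 3) leaves
  \<open>wedge Mb K\<close>. Here 3 and 4 stand for the vectors k and l, and 1 for the real vector
  that is the sum of m and its conjugate.\<close>

lemma weyl_from_curvature:
  assumes weyl: "weyl_coefficients S \<theta> Riem psi" and x: "x \<in> S"
  defines "F \<equiv> \<lambda>k i m j. curv_low \<theta> Riem k i x (frame x (axis m 1)) (frame x (axis j 1))"
  shows "psi 0 x = - cnj (F 1 4 4 1)" "psi 1 x = - cnj (F 1 4 4 3)"
    "psi 2 x = cnj ((F 2 3 4 1 + F 4 3 4 3 - F 1 2 4 3) / 3)"
    "psi 3 x = cnj (F 2 3 4 3)" "psi 4 x = cnj (F 2 3 1 3)"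
proof -
  have w: "F 2 3 m j =
            cnj (psi 4 x) * wedge (\<theta> 2) (\<theta> 3) x (frame x (axis m 1)) (frame x (axis j 1))
            + cnj (psi 3 x) * (wedge (\<theta> 4) (\<theta> 3) x (frame x (axis m 1)) (frame x (axis j 1))
              - wedge (\<theta> 1) (\<theta> 2) x (frame x (axis m 1)) (frame x (axis j 1)))
            + (cnj (psi 2 x) + scalar_curv Riem x / 12) * wedge (\<theta> 4) (\<theta> 1) x (frame x (axis m 1)) (frame x (axis j 1))"
    "F 1 4 m j =
            - (cnj (psi 2 x) + scalar_curv Riem x / 12) * wedge (\<theta> 2) (\<theta> 3) x (frame x (axis m 1)) (frame x (axis j 1))
            - cnj (psi 1 x) * (wedge (\<theta> 4) (\<theta> 3) x (frame x (axis m 1)) (frame x (axis j 1))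
              - wedge (\<theta> 1) (\<theta> 2) x (frame x (axis m 1)) (frame x (axis j 1)))
            - cnj (psi 0 x) * wedge (\<theta> 4) (\<theta> 1) x (frame x (axis m 1)) (frame x (axis j 1))"
    "(1/2) * (F 4 3 m j - F 1 2 m j) =
            cnj (psi 3 x) * wedge (\<theta> 2) (\<theta> 3) x (frame x (axis m 1)) (frame x (axis j 1))
            + (cnj (psi 2 x) - scalar_curv Riem x / 24) * (wedge (\<theta> 4) (\<theta> 3) x (frame x (axis m 1)) (frame x (axis j 1))
              - wedge (\<theta> 1) (\<theta> 2) x (frame x (axis m 1)) (frame x (axis j 1)))
            + cnj (psi 1 x) * wedge (\<theta> 4) (\<theta> 1) x (frame x (axis m 1)) (frame x (axis j 1))" for m j
    using weyl x unfolding weyl_coefficients_def Let_def F_def by blast+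
  have one: "Complex 1 0 = 1" "Complex 0 0 = 0" by (simp_all add: complex_eq_iff)
  note eval = wedge_def \<theta>_frame[OF x] axis_def one
  have "F 1 4 4 1 = - cnj (psi 0 x)" "F 1 4 4 3 = - cnj (psi 1 x)"
    "F 2 3 4 3 = cnj (psi 3 x)" "F 2 3 1 3 = cnj (psi 4 x)"
    unfolding w by (simp_all add: eval)
  then show "psi 0 x = - cnj (F 1 4 4 1)" "psi 1 x = - cnj (F 1 4 4 3)"
    "psi 3 x = cnj (F 2 3 4 3)" "psi 4 x = cnj (F 2 3 1 3)" by simp_all
  have h1: "F 2 3 4 1 = cnj (psi 2 x) + scalar_curv Riem x / 12"
    unfolding w by (simp add: eval)
  have h2: "(1/2) * (F 4 3 4 3 - F 1 2 4 3) = cnj (psi 2 x) - scalar_curv Riem x / 24"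
    unfolding w by (simp add: eval)
  \<comment> \<open>The weights 1 and 2 cancel the scalar curvature, since
    \<open>R/12 - 2 * (R/24) = 0\<close>, and leave three times the conjugate of
    \<open>psi 2 x\<close>.\<close>
  have "F 2 3 4 1 + F 4 3 4 3 - F 1 2 4 3 = F 2 3 4 1 + 2 * ((1/2) * (F 4 3 4 3 - F 1 2 4 3))"
    by simp
  also have "\<dots> = 3 * cnj (psi 2 x)" unfolding h1 h2 by (simp add: algebra_simps)
  finally show "psi 2 x = cnj ((F 2 3 4 1 + F 4 3 4 3 - F 1 2 4 3) / 3)" by simp
qed

lemma continuous_on_weyl:
  assumes conn: "connection_forms A S \<theta> \<Gamma>" and curv: "curvature_components A S \<theta> \<Gamma> Riem"
    and weyl: "weyl_coefficients S \<theta> Riem psi" and k: "k \<le> 4"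
  shows "continuous_on S (psi k)"
proof -
  note F = continuous_on_curv_frame[OF conn curv]
  note w = weyl_from_curvature[OF weyl]
  have "continuous_on S (psi 0)"
    by (subst continuous_on_cong[OF refl w(1)], assumption) (intro continuous_intros F)
  moreover have "continuous_on S (psi 1)"
    by (subst continuous_on_cong[OF refl w(2)], assumption) (intro continuous_intros F)
  moreover have "continuous_on S (psi 2)"
    by (subst continuous_on_cong[OF refl w(3)], assumption) (intro continuous_intros F; simp)
  moreover have "continuous_on S (psi 3)"
    by (subst continuous_on_cong[OF refl w(4)], assumption) (intro continuous_intros F)
  moreover have "continuous_on S (psi 4)"
    by (subst continuous_on_cong[OF refl w(5)], assumption) (intro continuous_intros F)
  moreover have "k = 0 \<or> k = 1 \<or> k = 2 \<or> k = 3 \<or> k = 4" using k by auto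
  ultimately show ?thesis by auto
qed

end

section \<open>The covering map\<close>

lemma Ck_on_mono: "Ck_on n S f \<Longrightarrow> T \<subseteq> S \<Longrightarrow> Ck_on n T f"
  by (induction n arbitrary: f) (auto intro: continuous_on_subset)

lemma smooth_form_mono:
  assumes "smooth_form A S \<omega>" "T \<subseteq> S"
  shows "smooth_form A T \<omega>"
proof -
  have "snd c ` (fst c \<inter> T) \<subseteq> snd c ` (fst c \<inter> S)" for c :: "'a chart" using assms(2) by blast
  note sub = this
  show ?thesis
    unfolding smooth_form_def smooth_on_def
  proof (intro conjI ballI allI)
    show "linear (\<omega> x)" if "x \<in> T" for x
      using assms that by (auto simp: smooth_form_def)
    show "Ck_on n (snd c ` (fst c \<inter> T)) (form_coeff A c \<omega> v)" if "c \<in> A" for c v n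
      by (rule Ck_on_mono[OF _ sub]) (use assms(1) that in \<open>simp add: smooth_form_def smooth_on_def\<close>)
  qed
qed

lemma null_coframe_mono:
  assumes "null_coframe A g S \<theta>" "T \<subseteq> S"
  shows "null_coframe A g T \<theta>"
proof -
  have "smooth_form A T (\<theta> i)" for i
    by (rule smooth_form_mono[OF _ assms(2)]) (use assms(1) in \<open>simp add: null_coframe_def\<close>)
  then show ?thesis using assms by (auto simp: null_coframe_def)
qed

section \<open>The subordinate variable \<open>y\<close> and its transition\<close>

lemma eqs1_iff: "(x, w, z, y) \<in> eqs1 psi S \<longleftrightarrow>
    \<Psi> psi x z * y + (1/4) * deriv (\<Psi> psi x) z = 0 \<and> (x, w, z) \<in> sheet 1 psi S"
  by (auto simp: eqs1_def sheet_def curve1_def)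

lemma eqs2_iff: "(x, w, z, y) \<in> eqs2 psi S \<longleftrightarrow>
    \<Psi>' psi x z * y + (1/4) * deriv (\<Psi>' psi x) z = 0 \<and> (x, w, z) \<in> sheet 2 psi S"
  by (auto simp: eqs2_def sheet_def curve2_def)

lemma unique_subordinate:
  fixes a b :: "'a::field"
  assumes "a \<noteq> 0"
  shows "P \<longleftrightarrow> (\<exists>!y. a * y + b = 0 \<and> P)"
proof -
  have "a * y + b = 0 \<longleftrightarrow> y = - b / a" for y
    using assms by (auto simp: field_simps eq_neg_iff_add_eq_0)
  then show ?thesis by auto
qed

lemma deriv_\<Psi>: "deriv (\<Psi> psi x) z = - 4 * cnj (psi 3 x) + 12 * cnj (psi 2 x) * z
    - 12 * cnj (psi 1 x) * z^2 + 4 * cnj (psi 0 x) * z^3"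
  by (rule DERIV_imp_deriv) (auto simp: \<Psi>_def[abs_def] intro!: derivative_eq_intros)

lemma deriv_\<Psi>': "deriv (\<Psi>' psi x) z = - 4 * cnj (psi 1 x) + 12 * cnj (psi 2 x) * z
    - 12 * cnj (psi 3 x) * z^2 + 4 * cnj (psi 4 x) * z^3"
  by (rule DERIV_imp_deriv) (auto simp: \<Psi>'_def[abs_def] intro!: derivative_eq_intros)

text \<open>Off the roots, \<open>y\<close> is minus a quarter of the logarithmic derivative of
  \<Psi>. The chain rule for \<open>z = 1 / z'\<close>, applied to \<Psi>(z) = \<Psi>'(z') / z'^4,
  gives \<open>y = - z' * (1 + y' * z')\<close>. Cleared of the division by \<Psi>, the identity
  persists at roots; the variables \<open>z\<close>, \<open>y\<close> here are the primed
  ones.\<close>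

lemma subordinate_transition:
  assumes "z \<noteq> 0"
  shows "\<Psi> psi x (1 / z) * (- z * (1 + y * z)) + (1/4) * deriv (\<Psi> psi x) (1 / z)
    = - (\<Psi>' psi x z * y + (1/4) * deriv (\<Psi>' psi x) z) / z^2"
  unfolding deriv_\<Psi> deriv_\<Psi>' \<Psi>_def \<Psi>'_def using assms
  by (simp add: field_simps power2_eq_square power3_eq_cube power4_eq_xxxx)

lemma eqs_transition:
  assumes "z \<noteq> 0"
  shows "(x, w, z, y) \<in> eqs2 psi S \<longleftrightarrow> (x, - w / z^2, 1 / z, - z * (1 + y * z)) \<in> eqs1 psi S"
proof -
  have sh: "(x, - w / z^2, 1 / z) \<in> sheet 1 psi S \<longleftrightarrow> (x, w, z) \<in> sheet 2 psi S"
    using sheet_flip[OF assms, of 2 x w psi S] by simp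
  have "- E / z^2 = 0 \<longleftrightarrow> E = 0" for E :: complex using assms by simp
  then show ?thesis
    unfolding eqs1_iff eqs2_iff subordinate_transition[OF assms] sh by (simp only:)
qed

section \<open>The covering map in the two charts and its root locus\<close>

context null_framed
begin

text \<open>The representatives of a class share one direction because the charts overlap by
  inversion. The image of the class is therefore a singleton, on which \<open>the_elem\<close> is
  meaningful.\<close>

lemma cover_map_cls:
  assumes i: "i \<in> {1, 2}" and sh: "(x, w, z) \<in> sheet i psi S"
  shows "cover_map g \<theta> (cls (i, x, w, z)) = direction i (x, z)"
proof -
  have x: "x \<in> S" using sh by (simp add: mem_sheet)
  have eq: "(\<lambda>(i :: nat, x, w :: complex, z). (x, if i = 1 then dir1 g \<theta> x z else dir2 g \<theta> x z)) (j, x, w, z) = direction j (x, z)" for j x w z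
    by (simp add: direction_def dir_chart1_def dir_chart2_def)
  have "direction (3 - i) (x, 1 / z) = direction i (x, z)" if "z \<noteq> 0"
    using i directions_overlap[OF x x, of z "1 / z"] directions_overlap[OF x x, of "1 / z" z] that by auto
  then have "(\<lambda>(i, x, w, z). (x, if i = 1 then dir1 g \<theta> x z else dir2 g \<theta> x z)) ` cls (i, x, w, z) = {direction i (x, z)}"
    unfolding cls_eq_insert[OF i] by (simp only: image_insert eq if_distrib[of "image _"] image_empty) auto
  then show ?thesis by (simp add: cover_map_def)
qed

lemma direction_cover: "direction_cover psi S (Pnull A g S) direction (cover_map g \<theta>)"
  using direction_chart_maps directions_cover directions_overlap cover_map_cls
  by unfold_locales

lemma direction_homeomorphic:
  assumes i: "i \<in> {1, 2}"
  shows "openin (Pnull A g S) (direction i ` (S \<times> UNIV))"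
    and "homeomorphic_map (top_of_set (S \<times> UNIV)) (subtopology (Pnull A g S) (direction i ` (S \<times> UNIV))) (direction i)"
proof -
  note d = direction_chart_maps[OF i]
  show "openin (Pnull A g S) (direction i ` (S \<times> UNIV))"
    using d(2) openin_subtopology_self unfolding open_map_def by blast
  show "homeomorphic_map (top_of_set (S \<times> UNIV)) (subtopology (Pnull A g S) (direction i ` (S \<times> UNIV))) (direction i)"
    using homeomorphic_map_open_restriction[OF d(1,2) _ d(3)] by (simp add: subtopology_subtopology)
qed

lemma root_locus_eq: "root_locus g \<theta> psi S =
    {direction i (x, z) | i x z. i \<in> {1, 2} \<and> x \<in> S \<and> quartic i psi x z = 0}"
proof -
  have "{direction i (x, z) | i x z. i \<in> {1, 2} \<and> x \<in> S \<and> quartic i psi x z = 0} =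
    {direction 1 (x, z) | x z. x \<in> S \<and> quartic 1 psi x z = 0} \<union> {direction 2 (x, z) | x z. x \<in> S \<and> quartic 2 psi x z = 0}"
    by blast
  then show ?thesis
    by (simp add: root_locus_def direction_def dir_chart1_def dir_chart2_def quartic_def)
qed

text \<open>Every root direction except that of \<open>z' = 0\<close> is seen in the first chart.
  The exceptional one is a root only if \<open>psi 0 x = 0\<close>, and then the first chart
  contributes at most three.\<close>

lemma root_locus_fibre:
  assumes x: "x \<in> S" and nz: "\<Psi> psi x z0 \<noteq> 0"
  shows "finite {l. (x, l) \<in> root_locus g \<theta> psi S}" "card {l. (x, l) \<in> root_locus g \<theta> psi S} \<le> 4"
proof -
  let ?L = "{l. (x, l) \<in> root_locus g \<theta> psi S}"
  let ?R = "{z. \<Psi> psi x z = 0}"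
  let ?E = "if psi 0 x = 0 then {dir2 g \<theta> x 0} else {}"
  note fin = finite_roots_\<Psi>[OF nz]
  have sub: "?L \<subseteq> dir1 g \<theta> x ` ?R \<union> ?E"
  proof
    fix l assume "l \<in> ?L"
    then consider z where "l = dir1 g \<theta> x z" "\<Psi> psi x z = 0" | z where "l = dir2 g \<theta> x z" "\<Psi>' psi x z = 0"
      by (auto simp: root_locus_def)
    then show "l \<in> dir1 g \<theta> x ` ?R \<union> ?E"
    proof cases
      case (2 z)
      show ?thesis
      proof (cases "z = 0")
        case True
        then have "psi 0 x = 0" using 2(2) by (simp add: \<Psi>'_def)
        then show ?thesis using 2(1) True by simp
      next
        case False
        have "dir1 g \<theta> x (1 / z) = dir2 g \<theta> x z" using dir1_eq_dir2_iff[OF x, of "1 / z" z] False by simp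
        moreover have "\<Psi> psi x (1 / z) = 0"
          using quartic_inverse[OF False, of 2 psi x] 2(2) by (simp add: quartic_def)
        ultimately have "l \<in> dir1 g \<theta> x ` ?R" using 2(1) by (intro image_eqI[of _ _ "1 / z"]) auto
        then show ?thesis by (rule UnI1)
      qed
    qed auto
  qed
  have fin': "finite (dir1 g \<theta> x ` ?R \<union> ?E)" using fin(1) by simp
  show "finite ?L" using finite_subset[OF sub fin'] .
  have "card ?L \<le> card (dir1 g \<theta> x ` ?R \<union> ?E)" by (rule card_mono[OF fin' sub])
  also have "\<dots> \<le> card (dir1 g \<theta> x ` ?R) + card ?E" by (rule card_Un_le)
  also have "\<dots> \<le> card ?R + card ?E" using card_image_le[OF fin(1)] by (intro add_right_mono)
  also have "\<dots> \<le> 4" using fin(2) by (simp split: if_splits)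
  finally show "card ?L \<le> 4" .
qed

lemma open_nonflat_part:
  assumes "\<And>k. k \<le> 4 \<Longrightarrow> continuous_on S (psi k)"
  shows "open (nonflat_part psi S)"
proof -
  have "open (S \<inter> (\<lambda>x. \<Psi> psi x z) -` (- {0}))" for z
    unfolding \<Psi>_def by (intro continuous_open_preimage continuous_intros assms open_S) auto
  then have "open (\<Union>z. S \<inter> (\<lambda>x. \<Psi> psi x z) -` (- {0}))" by blast
  moreover have "(\<Union>z. S \<inter> (\<lambda>x. \<Psi> psi x z) -` (- {0})) = nonflat_part psi S"
    by (auto simp: nonflat_part_def)
  ultimately show ?thesis by simp
qed

end

theorem mainTheorem2:
  fixes A :: "('m::{t2_space, second_countable_topology}) chart set"
    and g :: "'m metric"
    and T :: "'m \<Rightarrow> real^4"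
    and D :: "'m set"
    and \<theta> :: "4 \<Rightarrow> 'm form1"
    and \<Gamma> :: "4 \<Rightarrow> 4 \<Rightarrow> 'm form1"
    and Riem :: "'m riemann"
    and psi :: "nat \<Rightarrow> 'm \<Rightarrow> complex"
    and lam :: real
  assumes "oriented_smooth_atlas A"
    and "lorentzian_metric A g"
    and "time_orientation A g T"
    and "open D"
    and "null_coframe A g D \<theta>"
    and "connection_forms A D \<theta> \<Gamma>"
    and "curvature_components A D \<theta> \<Gamma> Riem"
    and einstein: "\<And>x i j. x \<in> D \<Longrightarrow> ricci Riem x i j = complex_of_real lam * \<eta> i j"
    and "weyl_coefficients D \<theta> Riem psi"
    and not_conformally_flat: "nonflat_part psi D \<noteq> {}"
  shows
   "
    \<comment> \<open>two coordinate charts on the spheres of null directions\<close>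
    (openin (Pnull A g D) (dir_chart1 g \<theta> ` (D \<times> UNIV)) \<and>
     homeomorphic_map (top_of_set (D \<times> UNIV)) (subtopology (Pnull A g D) (dir_chart1 g \<theta> ` (D \<times> UNIV)))
       (dir_chart1 g \<theta>) \<and>
     openin (Pnull A g D) (dir_chart2 g \<theta> ` (D \<times> UNIV)) \<and>
     homeomorphic_map (top_of_set (D \<times> UNIV)) (subtopology (Pnull A g D) (dir_chart2 g \<theta> ` (D \<times> UNIV)))
       (dir_chart2 g \<theta>) \<and>
     topspace (Pnull A g D) = dir_chart1 g \<theta> ` (D \<times> UNIV) \<union> dir_chart2 g \<theta> ` (D \<times> UNIV) \<and>
     (\<forall>x\<in>D. \<forall>z z'. dir1 g \<theta> x z = dir2 g \<theta> x z' \<longleftrightarrow> z \<noteq> 0 \<and> z' = 1 / z) \<and>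
     (\<forall>x\<in>D. subtopology (Pnull A g D) ({x} \<times> UNIV)
        homeomorphic_space top_of_set (sphere (0 :: real^3) 1))) \<and>
    \<comment> \<open>the variable y is determined by z away from the roots, compatibly with the gluing\<close>
    ((\<forall>x\<in>D. \<forall>w z. \<Psi> psi x z \<noteq> 0 \<longrightarrow>
        ((x, w, z) \<in> curve1 psi D \<longleftrightarrow> (\<exists>!y. (x, w, z, y) \<in> eqs1 psi D))) \<and>
     (\<forall>x\<in>D. \<forall>w' z'. \<Psi>' psi x z' \<noteq> 0 \<longrightarrow>
        ((x, w', z') \<in> curve2 psi D \<longleftrightarrow> (\<exists>!y'. (x, w', z', y') \<in> eqs2 psi D))) \<and>
     (\<forall>x\<in>D. \<forall>w' z' y'. z' \<noteq> 0 \<longrightarrow>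
        ((x, w', z', y') \<in> eqs2 psi D \<longleftrightarrow>
         (x, - w' / z'^2, 1 / z', - z' * (1 + y' * z')) \<in> eqs1 psi D))) \<and>
    \<comment> \<open>the map in the two pieces\<close>
    ((\<forall>x w z. (x, w, z) \<in> curve1 psi D \<longrightarrow> cover_map g \<theta> (cls (1, x, w, z)) = (x, dir1 g \<theta> x z)) \<and>
     (\<forall>x w' z'. (x, w', z') \<in> curve2 psi D \<longrightarrow> cover_map g \<theta> (cls (2, x, w', z')) = (x, dir2 g \<theta> x z'))) \<and>
    (continuous_map (Ptilde psi D) (Pnull A g D) (cover_map g \<theta>) \<and>
     cover_map g \<theta> ` topspace (Ptilde psi D) = topspace (Pnull A g D)) \<and>
    \<comment> \<open>the fibres of the map\<close>
    (\<forall>x\<in>D. \<forall>z. card {p \<in> topspace (Ptilde psi D). cover_map g \<theta> p = (x, dir1 g \<theta> x z)} =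
        (if - \<Psi> psi x z = 0 then 1 else 2)) \<and>
    (\<forall>x\<in>D. \<forall>z'. card {p \<in> topspace (Ptilde psi D). cover_map g \<theta> p = (x, dir2 g \<theta> x z')} =
        (if - \<Psi>' psi x z' = 0 then 1 else 2)) \<and>
    (\<forall>x\<in>nonflat_part psi D. finite {l. (x, l) \<in> root_locus g \<theta> psi D} \<and>
        card {l. (x, l) \<in> root_locus g \<theta> psi D} \<le> 4) \<and>
    \<comment> \<open>the branched cover and its branch points\<close>
    open (nonflat_part psi D) \<and>
    (double_branched_cover (Ptilde psi (nonflat_part psi D)) (Pnull A g (nonflat_part psi D))
       (cover_map g \<theta>) (root_locus g \<theta> psi (nonflat_part psi D))) \<and>
    (\<forall>p. singular_point (Ptilde psi (nonflat_part psi D)) (Pnull A g (nonflat_part psi D))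
           (cover_map g \<theta>) p \<longleftrightarrow>
         p \<in> topspace (Ptilde psi (nonflat_part psi D)) \<and>
         cover_map g \<theta> p \<in> root_locus g \<theta> psi (nonflat_part psi D)) \<and>
    (\<forall>p. singular_point (Ptilde psi (nonflat_part psi D)) (Pnull A g (nonflat_part psi D))
           (cover_map g \<theta>) p \<longrightarrow>
         branch_point (Ptilde psi (nonflat_part psi D)) (cover_map g \<theta>) p)"
proof -
  let ?N = "nonflat_part psi D"
  interpret F: null_framed A g D \<theta>
    by unfold_locales (fact assms)+
  have cont: "continuous_on D (psi k)" if "k \<le> 4" for k
    by (rule F.continuous_on_weyl[OF assms(6,7,9) that])
  have sub: "?N \<subseteq> D" by (auto simp: nonflat_part_def)
  have open_N: "open ?N" by (rule F.open_nonflat_part[OF cont])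
  \<comment> \<open>The spaces over \<open>?N\<close> are separate quotients, so the coframe is
    restricted and the frame theory instantiated again.\<close>
  interpret G: null_framed A g ?N \<theta>
    by unfold_locales (fact assms open_N null_coframe_mono[OF assms(5) sub])+
  \<comment> \<open>This supplies the claims on the map and its fibres over all of \<open>D\<close>,
    flat points included; \<open>NC\<close> supplies the branched cover over the nonflat
    part.\<close>
  interpret DC: direction_cover psi D "Pnull A g D" F.direction "cover_map g \<theta>"
    by (rule F.direction_cover)
  interpret NC: nonflat_direction_cover psi ?N "Pnull A g ?N" G.direction "cover_map g \<theta>"
  proof (intro nonflat_direction_cover.intro G.direction_cover nonflat_direction_cover_axioms.intro open_N)
    show "continuous_on ?N (psi k)" if "k \<le> 4" for k using cont[OF that] sub by (rule continuous_on_subset)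
    show "\<exists>z. \<Psi> psi x z \<noteq> 0" if "x \<in> ?N" for x using that by (simp add: nonflat_part_def)
  qed
  have locus: "root_locus g \<theta> psi ?N = NC.branch_locus"
    unfolding G.root_locus_eq NC.branch_locus_def ..
  have d: "F.direction 1 = dir_chart1 g \<theta>" "F.direction 2 = dir_chart2 g \<theta>"
    by (simp_all add: F.direction_def)
  have dp: "F.direction 1 (x, z) = (x, dir1 g \<theta> x z)" "F.direction 2 (x, z) = (x, dir2 g \<theta> x z)" for x z
    unfolding d dir_chart1_def dir_chart2_def by simp_all
  have one_two: "(1 :: nat) \<in> {1, 2}" "(2 :: nat) \<in> {1, 2}" by auto
  have sheets: "sheet 1 psi D = curve1 psi D" "sheet 2 psi D = curve2 psi D" by (simp_all add: sheet_def)
  have quartics: "quartic 1 psi = \<Psi> psi" "quartic 2 psi = \<Psi>' psi" by (simp_all add: quartic_def)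
  show ?thesis
  proof (intro conjI)
    show "openin (Pnull A g D) (dir_chart1 g \<theta> ` (D \<times> UNIV))"
      "homeomorphic_map (top_of_set (D \<times> UNIV)) (subtopology (Pnull A g D) (dir_chart1 g \<theta> ` (D \<times> UNIV)))
         (dir_chart1 g \<theta>)"
      using F.direction_homeomorphic[OF one_two(1)] unfolding d by blast+
    show "openin (Pnull A g D) (dir_chart2 g \<theta> ` (D \<times> UNIV))"
      "homeomorphic_map (top_of_set (D \<times> UNIV)) (subtopology (Pnull A g D) (dir_chart2 g \<theta> ` (D \<times> UNIV)))
         (dir_chart2 g \<theta>)"
      using F.direction_homeomorphic[OF one_two(2)] unfolding d by blast+
    show "topspace (Pnull A g D) = dir_chart1 g \<theta> ` (D \<times> UNIV) \<union> dir_chart2 g \<theta> ` (D \<times> UNIV)"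
      using F.directions_cover unfolding d .
    show "\<forall>x\<in>D. \<forall>z z'. dir1 g \<theta> x z = dir2 g \<theta> x z' \<longleftrightarrow> z \<noteq> 0 \<and> z' = 1 / z"
      by (intro ballI allI F.dir1_eq_dir2_iff)
    show "\<forall>x\<in>D. subtopology (Pnull A g D) ({x} \<times> UNIV)
        homeomorphic_space top_of_set (sphere (0 :: real^3) 1)"
      by (intro ballI F.fibre_Pnull_sphere)
    show "\<forall>x\<in>D. \<forall>w z. \<Psi> psi x z \<noteq> 0 \<longrightarrow>
        ((x, w, z) \<in> curve1 psi D \<longleftrightarrow> (\<exists>!y. (x, w, z, y) \<in> eqs1 psi D))"
      unfolding eqs1_iff sheets by (intro ballI allI impI unique_subordinate)
    show "\<forall>x\<in>D. \<forall>w' z'. \<Psi>' psi x z' \<noteq> 0 \<longrightarrow>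
        ((x, w', z') \<in> curve2 psi D \<longleftrightarrow> (\<exists>!y'. (x, w', z', y') \<in> eqs2 psi D))"
      unfolding eqs2_iff sheets by (intro ballI allI impI unique_subordinate)
    show "\<forall>x\<in>D. \<forall>w' z' y'. z' \<noteq> 0 \<longrightarrow>
        ((x, w', z', y') \<in> eqs2 psi D \<longleftrightarrow>
         (x, - w' / z'^2, 1 / z', - z' * (1 + y' * z')) \<in> eqs1 psi D)"
      by (intro ballI allI impI eqs_transition)
    show "\<forall>x w z. (x, w, z) \<in> curve1 psi D \<longrightarrow> cover_map g \<theta> (cls (1, x, w, z)) = (x, dir1 g \<theta> x z)"
      using F.cover_map_cls[OF one_two(1), of _ _ _ psi] unfolding sheets dp by (intro allI impI)
    show "\<forall>x w' z'. (x, w', z') \<in> curve2 psi D \<longrightarrow> cover_map g \<theta> (cls (2, x, w', z')) = (x, dir2 g \<theta> x z')"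
      using F.cover_map_cls[OF one_two(2), of _ _ _ psi] unfolding sheets dp by (intro allI impI)
    show "continuous_map (Ptilde psi D) (Pnull A g D) (cover_map g \<theta>)" by (rule DC.continuous_map_f)
    show "cover_map g \<theta> ` topspace (Ptilde psi D) = topspace (Pnull A g D)" by (rule DC.surj_f)
    show "\<forall>x\<in>D. \<forall>z. card {p \<in> topspace (Ptilde psi D). cover_map g \<theta> p = (x, dir1 g \<theta> x z)} =
        (if - \<Psi> psi x z = 0 then 1 else 2)"
      using DC.card_fibre[OF one_two(1)] unfolding dp quartics neg_equal_0_iff_equal by (intro ballI allI)
    show "\<forall>x\<in>D. \<forall>z'. card {p \<in> topspace (Ptilde psi D). cover_map g \<theta> p = (x, dir2 g \<theta> x z')} =
        (if - \<Psi>' psi x z' = 0 then 1 else 2)"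
      using DC.card_fibre[OF one_two(2)] unfolding dp quartics neg_equal_0_iff_equal by (intro ballI allI)
    show "\<forall>x\<in>?N. finite {l. (x, l) \<in> root_locus g \<theta> psi D} \<and>
        card {l. (x, l) \<in> root_locus g \<theta> psi D} \<le> 4"
    proof
      fix x assume "x \<in> ?N"
      then obtain z0 where "x \<in> D" "\<Psi> psi x z0 \<noteq> 0" by (auto simp: nonflat_part_def)
      then show "finite {l. (x, l) \<in> root_locus g \<theta> psi D} \<and> card {l. (x, l) \<in> root_locus g \<theta> psi D} \<le> 4"
        using F.root_locus_fibre by (intro conjI)
    qed
    show "open ?N" by (rule open_N)
    show "double_branched_cover (Ptilde psi ?N) (Pnull A g ?N) (cover_map g \<theta>) (root_locus g \<theta> psi ?N)"
      unfolding locus by (rule NC.double_branched_cover_f)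
    show "\<forall>p. singular_point (Ptilde psi ?N) (Pnull A g ?N) (cover_map g \<theta>) p \<longleftrightarrow>
         p \<in> topspace (Ptilde psi ?N) \<and> cover_map g \<theta> p \<in> root_locus g \<theta> psi ?N"
      unfolding locus by (intro allI NC.singular_point_iff)
    show "\<forall>p. singular_point (Ptilde psi ?N) (Pnull A g ?N) (cover_map g \<theta>) p \<longrightarrow>
         branch_point (Ptilde psi ?N) (cover_map g \<theta>) p"
      unfolding NC.singular_point_iff using NC.branch_point_f by (intro allI impI) (elim conjE)
  qed
qed

end
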